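(* Let $\beta\in\mathbb{R}$, $\eta>0$, $x_0<0$ and $\mathrm{Re}(\theta)>0$. Let $$\mathcal{V}(\theta;\eta,\beta)=-\sqrt{\eta}\,D_{-\theta}(-\beta)D_{-\theta/\eta}'\!\left(\tfrac{\beta}{\sqrt{\eta}}\right)-D_{-\theta}'(-\beta)D_{-\theta/\eta}\!\left(\tfrac{\beta}{\sqrt{\eta}}\right),$$ $$\mathcal{M}(\theta;\eta,\beta)=\sqrt{\eta}\,D_{-\theta}(\beta)D_{-\theta/\eta}'\!\left(\tfrac{\beta}{\sqrt{\eta}}\right)-D_{-\theta}'(\beta)D_{-\theta/\eta}\!\left(\tfrac{\beta}{\sqrt{\eta}}\right).$$ Then the Laplace transform $\hat p(x;\theta)=\int_0^\infty e^{-\theta t}p(x,t;x_0;\beta,\eta)\,dt$ of the transition density is given as follows. (i) For $x>0$, $$\hat p(x;\theta)=e^{\frac12\beta(x_0-x)}e^{\frac14(x_0^2-\eta x^2)}\,\frac{D_{-\theta}(-x_0-\beta)\,D_{-\theta/\eta}\!\left(\frac{\eta x+\beta}{\sqrt{\eta}}\right)}{\mathcal{V}(\theta;\eta,\beta)}.$$ (ii) For $x<x_0$, $$\hat p(x;\theta)=e^{\frac12\beta(x_0-x)}e^{\frac14(x_0^2-x^2)}\,\frac{\Gamma(\theta)D_{-\theta}(-x-\beta)}{\sqrt{2\pi}}\left(D_{-\theta}(x_0+\beta)+D_{-\theta}(-x_0-\beta)\frac{\mathcal{M}(\theta;\eta,\beta)}{\mathcal{V}(\theta;\eta,\beta)}\right).$$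 (iii) For $x_0<x<0$, $$\hat p(x;\theta)=e^{\frac12\beta(x_0-x)}e^{\frac14(x_0^2-x^2)}\,\frac{\Gamma(\theta)D_{-\theta}(-x_0-\beta)}{\sqrt{2\pi}}\left(D_{-\theta}(x+\beta)+D_{-\theta}(-x-\beta)\frac{\mathcal{M}(\theta;\eta,\beta)}{\mathcal{V}(\theta;\eta,\beta)}\right).$$
   Context: For $\beta\in\mathbb{R}$, $\eta>0$, $p=p(x,t;x_0;\beta,\eta)$ is the transition density of the Markov diffusion process on $\mathbb{R}$ satisfying $\partial_t p=-\partial_x[a(x)p]+\partial_x^2p$, with $a(x)=-\beta-\eta x$ for $x\ge0$ and $a(x)=-\beta-x$ for $x\le 0$, $p(x,0)=\delta(x-x_0)$ (Dirac delta), $p$ and $\partial_xp$ continuous at $x=0$, and decay as $x\to\pm\infty$. $D_\nu(z)=\frac{1}{i\sqrt{2\pi}}e^{z^2/4}\int_{\mathrm{Br}}u^\nu e^{-zu}e^{u^2/2}du$ is the parabolic cylinder function ($\mathrm{Br}$ an upward vertical line with $\mathrm{Re}(u)>0$, principal branch of $u^\nu$), and $D_\nu'(z)=\frac{d}{dz}D_\nu(z)$. *)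

theory Defs
  imports "HOL-Complex_Analysis.Complex_Analysis" "HOL-Probability.Probability"
    "HOL-Real_Asymp.Real_Asymp"
begin

text \<open>
  The integral of \<open>g\<close> along the upward vertical line through \<open>c\<close>, parametrised by
  \<open>u = c + \<i> s\<close>, so that \<open>du = \<i> ds\<close>.
\<close>

definition bromwich_integral :: "real \<Rightarrow> (complex \<Rightarrow> complex) \<Rightarrow> complex" where
  "bromwich_integral c g = \<i> * (LINT s|lborel. g (Complex c s))"

definition pcf_integrand :: "complex \<Rightarrow> complex \<Rightarrow> complex \<Rightarrow> complex" where
  "pcf_integrand \<nu> z u = u powr \<nu> * exp (- (z * u)) * exp (u\<^sup>2 / 2)"

text \<open>
  The contour is fixed to be the line \<open>Re u = 1\<close>; by \<open>parabolic_cylinder_contour\<close> below any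
  other line in the right half plane gives the same function, and by \<open>pcf_integrand_integrable\<close>
  the integral always converges absolutely.
\<close>

definition parabolic_cylinder :: "complex \<Rightarrow> complex \<Rightarrow> complex" where
  "parabolic_cylinder \<nu> z =
     1 / (\<i> * complex_of_real (sqrt (2 * pi))) * exp (z\<^sup>2 / 4)
       * bromwich_integral 1 (pcf_integrand \<nu> z)"

definition parabolic_cylinder' :: "complex \<Rightarrow> complex \<Rightarrow> complex" where
  "parabolic_cylinder' \<nu> z = deriv (parabolic_cylinder \<nu>) z"

lemma pcf_integrand_bound:
  assumes "0 < a" "a \<le> b"
  obtains K where "\<And>u. a \<le> Re u \<Longrightarrow> Re u \<le> b \<Longrightarrow>
    norm (pcf_integrand \<nu> z u) \<le> K * exp (- ((Im u)\<^sup>2 / 4))"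
proof
  define L where "L = \<bar>ln a\<bar>"
  define C0 where "C0 = \<bar>Re \<nu>\<bar> * (b + L) + \<bar>Im \<nu>\<bar> * pi + norm z * b + b\<^sup>2 / 2"
  define C1 where "C1 = \<bar>Re \<nu>\<bar> + norm z"
  fix u :: complex assume u: "a \<le> Re u" "Re u \<le> b"
  define s where "s = Im u"
  have u0: "u \<noteq> 0" using u assms by auto
  have nu1: "a \<le> norm u" using u complex_Re_le_cmod[of u] by linarith
  have nu2: "norm u \<le> b + \<bar>s\<bar>" using u assms cmod_le[of u] by (simp add: s_def)
  have ln_u: "\<bar>ln (norm u)\<bar> \<le> b + \<bar>s\<bar> + L"
  proof -
    have "ln (norm u) \<le> norm u" using u0 ln_less_self[of "norm u"] by (simp add: less_imp_le)
    moreover have "ln a \<le> ln (norm u)" using nu1 assms u0 by simp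
    ultimately show ?thesis using nu2 assms unfolding L_def by linarith
  qed
  have "Re \<nu> * ln (norm u) \<le> \<bar>Re \<nu>\<bar> * \<bar>ln (norm u)\<bar>"
    by (metis abs_ge_self abs_mult)
  also have "\<dots> \<le> \<bar>Re \<nu>\<bar> * (b + \<bar>s\<bar> + L)" using ln_u by (intro mult_left_mono) auto
  finally have 1: "Re \<nu> * ln (norm u) \<le> \<bar>Re \<nu>\<bar> * (b + \<bar>s\<bar> + L)" .
  have "- Im \<nu> * Arg u \<le> \<bar>Im \<nu>\<bar> * \<bar>Arg u\<bar>" by (metis abs_ge_self abs_minus abs_mult)
  also have "\<dots> \<le> \<bar>Im \<nu>\<bar> * pi"
    using Arg_bounded[of u] by (intro mult_left_mono) auto
  finally have 2: "- Im \<nu> * Arg u \<le> \<bar>Im \<nu>\<bar> * pi" .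
  have "Re (- (z * u)) \<le> norm (- (z * u))" by (rule complex_Re_le_cmod)
  also have "\<dots> \<le> norm z * (b + \<bar>s\<bar>)" using nu2 by (simp add: norm_mult mult_left_mono)
  finally have 3: "Re (- (z * u)) \<le> norm z * (b + \<bar>s\<bar>)" .
  have "(Re u)\<^sup>2 \<le> b\<^sup>2" using u assms by (intro power_mono) auto
  then have 4: "Re (u\<^sup>2 / 2) \<le> b\<^sup>2 / 2 - s\<^sup>2 / 2"
    by (simp add: s_def power2_eq_square field_simps)
  have "C1 * \<bar>s\<bar> \<le> C1\<^sup>2 + s\<^sup>2 / 4"
  proof -
    have "0 \<le> (C1 - \<bar>s\<bar> / 2)\<^sup>2" by simp
    also have "\<dots> = C1\<^sup>2 - C1 * \<bar>s\<bar> + s\<^sup>2 / 4"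
      by (simp add: power2_eq_square algebra_simps)
    finally show ?thesis by simp
  qed
  moreover have "\<bar>Re \<nu>\<bar> * (b + \<bar>s\<bar> + L) + \<bar>Im \<nu>\<bar> * pi + norm z * (b + \<bar>s\<bar>) + (b\<^sup>2 / 2 - s\<^sup>2 / 2)
      = C0 + C1 * \<bar>s\<bar> - s\<^sup>2 / 2"
    by (simp add: C0_def C1_def algebra_simps)
  ultimately have "Re \<nu> * ln (norm u) + (- Im \<nu> * Arg u) + Re (- (z * u)) + Re (u\<^sup>2 / 2)
      \<le> C0 + C1\<^sup>2 - s\<^sup>2 / 4"
    using 1 2 3 4 by linarith
  moreover have "norm (pcf_integrand \<nu> z u) =
      exp (Re \<nu> * ln (norm u) + (- Im \<nu> * Arg u) + Re (- (z * u)) + Re (u\<^sup>2 / 2))"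
    using u0 by (simp add: pcf_integrand_def norm_mult norm_exp_eq_Re powr_def Arg_eq_Im_Ln
        flip: exp_add)
  ultimately have "norm (pcf_integrand \<nu> z u) \<le> exp (C0 + C1\<^sup>2 - s\<^sup>2 / 4)" by simp
  also have "\<dots> = exp (C0 + C1\<^sup>2) * exp (- ((Im u)\<^sup>2 / 4))"
    by (simp add: s_def flip: exp_add)
  finally show "norm (pcf_integrand \<nu> z u) \<le> exp (C0 + C1\<^sup>2) * exp (- ((Im u)\<^sup>2 / 4))" .
qed

lemma gaussian_quarter_integrable: "integrable lborel (\<lambda>s::real. exp (- (s\<^sup>2 / 4)))"
proof -
  have "integrable lborel (\<lambda>s. sqrt (4 * pi) * normal_density 0 (sqrt 2) s)"
    by (intro integrable_mult_right integrable_normal_density) auto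
  moreover have "(\<lambda>s. sqrt (4 * pi) * normal_density 0 (sqrt 2) s) = (\<lambda>s. exp (- (s\<^sup>2 / 4)))"
    by (auto simp: normal_density_def)
  ultimately show ?thesis by simp
qed

lemma pcf_integrand_holomorphic: "pcf_integrand \<nu> z holomorphic_on {u. 0 < Re u}"
  unfolding pcf_integrand_def
  by (intro holomorphic_intros) (auto simp: complex_nonpos_Reals_iff)

lemma pcf_integrand_continuous:
  assumes "0 < c" shows "continuous_on A (\<lambda>s. pcf_integrand \<nu> z (Complex c s))"
  unfolding Complex_eq
  by (rule continuous_on_compose2
      [OF holomorphic_on_imp_continuous_on[OF pcf_integrand_holomorphic]])
    (use assms in \<open>auto intro!: continuous_intros\<close>)

lemma pcf_integrand_integrable:
  assumes "0 < c" shows "integrable lborel (\<lambda>s. pcf_integrand \<nu> z (Complex c s))"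
proof -
  obtain K where K: "\<And>u. c \<le> Re u \<Longrightarrow> Re u \<le> c \<Longrightarrow>
      norm (pcf_integrand \<nu> z u) \<le> K * exp (- ((Im u)\<^sup>2 / 4))"
    using pcf_integrand_bound[of c c] assms by blast
  have "(\<lambda>s. pcf_integrand \<nu> z (Complex c s)) \<in> borel_measurable lborel"
    using borel_measurable_continuous_onI[OF pcf_integrand_continuous[OF assms]] by simp
  moreover have "norm (pcf_integrand \<nu> z (Complex c s)) \<le> norm (K * exp (- (s\<^sup>2 / 4)))" for s
    using K[of "Complex c s"] by (simp add: abs_mult) (smt (verit) exp_gt_zero mult_right_mono)
  ultimately show ?thesis
    using Bochner_Integration.integrable_bound
      [OF integrable_mult_right[OF gaussian_quarter_integrable, of K]] by auto
qed

lemma bromwich_integral_pcf_le: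
  assumes "0 < a" "a \<le> b"
  shows "bromwich_integral b (pcf_integrand \<nu> z) = bromwich_integral a (pcf_integrand \<nu> z)"
proof -
  let ?H = "{u::complex. 0 < Re u}" and ?g = "pcf_integrand \<nu> z"
  obtain K where K: "\<And>u. a \<le> Re u \<Longrightarrow> Re u \<le> b \<Longrightarrow>
      norm (?g u) \<le> K * exp (- ((Im u)\<^sup>2 / 4))"
    using pcf_integrand_bound[of a b] assms by blast
  have opn: "open ?H" by (rule open_halfspace_Re_gt)
  obtain G where G: "\<And>u. u \<in> ?H \<Longrightarrow> (G has_field_derivative ?g u) (at u within ?H)"
    using holomorphic_convex_primitive'[OF convex_halfspace_Re_gt opn pcf_integrand_holomorphic]
    by blast
  have G': "(G has_field_derivative ?g u) (at u)" if "u \<in> ?H" for u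
    using G[OF that] at_within_open[OF that opn] by simp
  define J where "J c R = (LINT s:{-R..R}|lborel. ?g (Complex c s))" for c R :: real
  have J: "J c R = - \<i> * (G (Complex c R) - G (Complex c (- R)))"
    if "0 < c" "0 \<le> R" for c R
  proof -
    have d: "((\<lambda>s. - \<i> * G (Complex c s)) has_vector_derivative ?g (Complex c s))
        (at s within {-R..R})" for s
    proof -
      have "((\<lambda>s. Complex c s) has_vector_derivative \<i>) (at s within {-R..R})"
        unfolding Complex_eq by (auto intro!: derivative_eq_intros)
      from field_vector_diff_chain_within
        [OF this has_field_derivative_at_within[OF G'[of "Complex c s"]]] that
      have "((\<lambda>s. G (Complex c s)) has_vector_derivative \<i> * ?g (Complex c s))
          (at s within {-R..R})"
        by (simp add: o_def)
      from has_vector_derivative_mult_right[OF this, of "- \<i>"] show ?thesis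
        by (simp flip: mult.assoc)
    qed
    show ?thesis unfolding J_def set_lebesgue_integral_def
      using integral_FTC_Icc[of "- R" R "\<lambda>s. - \<i> * G (Complex c s)"] d that
        pcf_integrand_continuous
      by (simp add: right_diff_distrib)
  qed
  have lim: "((\<lambda>R. J c R) \<longlongrightarrow> (LINT s|lborel. ?g (Complex c s))) at_top" if "0 < c" for c
    unfolding J_def set_lebesgue_integral_def
  proof (rule integral_dominated_convergence_at_top)
    show "integrable lborel (\<lambda>s. norm (?g (Complex c s)))"
      using pcf_integrand_integrable[OF that] by simp
    show "AE s in lborel. ((\<lambda>R. indicator {-R..R} s *\<^sub>R ?g (Complex c s))
        \<longlongrightarrow> ?g (Complex c s)) at_top"
    proof (intro AE_I2 tendsto_eventually)
      fix s :: real
      show "\<forall>\<^sub>F R in at_top. indicator {-R..R} s *\<^sub>R ?g (Complex c s) = ?g (Complex c s)"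
        using eventually_ge_at_top[of "\<bar>s\<bar>"] by eventually_elim (auto simp: indicator_def)
    qed
    show "\<forall>\<^sub>F R in at_top. AE s in lborel.
        norm (indicator {-R..R} s *\<^sub>R ?g (Complex c s)) \<le> norm (?g (Complex c s))"
      by (intro always_eventually allI AE_I2) (auto simp: indicator_def)
    show "(\<lambda>s. ?g (Complex c s)) \<in> borel_measurable lborel"
      using pcf_integrand_integrable[OF that] by simp
    then show "(\<lambda>s. indicator {-R..R} s *\<^sub>R ?g (Complex c s)) \<in> borel_measurable lborel" for R
      by simp
  qed
  have edge: "norm (G (Complex b s) - G (Complex a s)) \<le> K * exp (- (s\<^sup>2 / 4)) * (b - a)" for s
  proof -
    have "norm (G (Complex b s) - G (Complex a s))
        \<le> K * exp (- (s\<^sup>2 / 4)) * norm (Complex b s - Complex a s)"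
    proof (rule field_differentiable_bound)
      let ?S = "{u. s \<le> Im u} \<inter> {u. Im u \<le> s} \<inter> {u. a \<le> Re u} \<inter> {u. Re u \<le> b}"
      show "convex ?S"
        by (intro convex_Int convex_halfspace_Im_ge convex_halfspace_Im_le
            convex_halfspace_Re_ge convex_halfspace_Re_le)
      show "(G has_field_derivative ?g u) (at u within ?S)" if "u \<in> ?S" for u
      proof -
        have "u \<in> ?H" using that assms(1) by simp
        then show ?thesis by (rule has_field_derivative_at_within[OF G'])
      qed
      show "norm (?g u) \<le> K * exp (- (s\<^sup>2 / 4))" if "u \<in> ?S" for u
      proof -
        have "Im u = s" and "a \<le> Re u" and "Re u \<le> b" using that by simp_all
        with K[of u] show ?thesis by blast
      qed
      show "Complex b s \<in> ?S" "Complex a s \<in> ?S" using assms by simp_all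
    qed
    also have "norm (Complex b s - Complex a s) = b - a"
      using assms by (simp add: cmod_def)
    finally show ?thesis .
  qed
  have "((\<lambda>R. J b R - J a R) \<longlongrightarrow> 0) at_top"
  proof (rule Lim_null_comparison)
    show "\<forall>\<^sub>F R in at_top. norm (J b R - J a R) \<le> 2 * (K * exp (- (R\<^sup>2 / 4)) * (b - a))"
      using eventually_ge_at_top[of 0]
    proof eventually_elim
      case (elim R)
      have "J b R - J a R = - \<i> * ((G (Complex b R) - G (Complex a R))
          - (G (Complex b (- R)) - G (Complex a (- R))))"
        using assms elim by (simp add: J algebra_simps)
      then have "norm (J b R - J a R) = norm ((G (Complex b R) - G (Complex a R))
          - (G (Complex b (- R)) - G (Complex a (- R))))"
        by (simp add: norm_mult)
      also have "\<dots> \<le> norm (G (Complex b R) - G (Complex a R))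
          + norm (G (Complex b (- R)) - G (Complex a (- R)))"
        by (rule norm_triangle_ineq4)
      finally show ?case using edge[of R] edge[of "- R"] by simp
    qed
    show "((\<lambda>R. 2 * (K * exp (- (R\<^sup>2 / 4)) * (b - a))) \<longlongrightarrow> 0) at_top"
    proof -
      have "((\<lambda>R::real. exp (- (R\<^sup>2 / 4))) \<longlongrightarrow> 0) at_top"
        by real_asymp
      from tendsto_mult_right[OF this, of "2 * K * (b - a)"] show ?thesis
        by (simp add: algebra_simps)
    qed
  qed
  moreover have "((\<lambda>R. J b R - J a R) \<longlongrightarrow>
      (LINT s|lborel. ?g (Complex b s)) - (LINT s|lborel. ?g (Complex a s))) at_top"
    using assms by (intro tendsto_diff lim) auto
  ultimately have "(LINT s|lborel. ?g (Complex b s)) - (LINT s|lborel. ?g (Complex a s)) = 0"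
    using tendsto_unique trivial_limit_at_top_linorder by metis
  then show ?thesis by (simp add: bromwich_integral_def)
qed

lemma parabolic_cylinder_contour:
  assumes "0 < c"
  shows "parabolic_cylinder \<nu> z =
     1 / (\<i> * complex_of_real (sqrt (2 * pi))) * exp (z\<^sup>2 / 4)
       * bromwich_integral c (pcf_integrand \<nu> z)"
proof -
  have "bromwich_integral 1 (pcf_integrand \<nu> z) = bromwich_integral c (pcf_integrand \<nu> z)"
  proof (cases "c \<le> 1")
    case True
    with assms show ?thesis by (rule bromwich_integral_pcf_le)
  next
    case False
    then show ?thesis by (intro bromwich_integral_pcf_le[symmetric]) auto
  qed
  then show ?thesis by (simp only: parabolic_cylinder_def)
qed

definition drift :: "real \<Rightarrow> real \<Rightarrow> real \<Rightarrow> real" where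
  "drift \<beta> \<eta> x = (if 0 \<le> x then - \<beta> - \<eta> * x else - \<beta> - x)"

text \<open>
  Classical solutions of \<open>\<partial>\<^sub>t p = - \<partial>\<^sub>x (a p) + \<partial>\<^sub>x\<^sup>2 p\<close> for \<open>t > 0\<close>, where \<open>p x t\<close> is the value at
  position \<open>x\<close> and time \<open>t\<close>.  The slope of the drift jumps at \<open>x = 0\<close>, so the equation is imposed
  on the two open half lines, together with continuity of \<open>p\<close> and \<open>\<partial>\<^sub>x p\<close> across \<open>x = 0\<close>.
\<close>

definition fokker_planck_solution :: "real \<Rightarrow> real \<Rightarrow> (real \<Rightarrow> real \<Rightarrow> real) \<Rightarrow> bool" where
  "fokker_planck_solution \<beta> \<eta> p \<longleftrightarrow>
    (\<exists>px pxx pt :: real \<Rightarrow> real \<Rightarrow> real.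
       (\<forall>x. \<forall>t>0. ((\<lambda>y. p y t) has_real_derivative px x t) (at x)) \<and>
       (\<forall>x. \<forall>t>0. x \<noteq> 0 \<longrightarrow> ((\<lambda>y. px y t) has_real_derivative pxx x t) (at x)) \<and>
       (\<forall>x. \<forall>t>0. x \<noteq> 0 \<longrightarrow> ((\<lambda>s. p x s) has_real_derivative pt x t) (at t)) \<and>
       continuous_on (UNIV \<times> {0<..}) (\<lambda>(x, t). p x t) \<and>
       continuous_on (UNIV \<times> {0<..}) (\<lambda>(x, t). px x t) \<and>
       continuous_on ((- {0}) \<times> {0<..}) (\<lambda>(x, t). pxx x t) \<and>
       continuous_on ((- {0}) \<times> {0<..}) (\<lambda>(x, t). pt x t) \<and>
       (\<forall>x. \<forall>t>0. x \<noteq> 0 \<longrightarrow>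
          pt x t = - deriv (\<lambda>y. drift \<beta> \<eta> y * p y t) x + pxx x t))"

text \<open>
  The Dirac initial condition is weak convergence of the laws \<open>p x t dx\<close> to the point mass at
  \<open>x0\<close>; the values \<open>p x t\<close> for \<open>t \<le> 0\<close> are irrelevant.
\<close>

definition transition_density ::
    "real \<Rightarrow> real \<Rightarrow> real \<Rightarrow> (real \<Rightarrow> real \<Rightarrow> real) \<Rightarrow> bool" where
  "transition_density \<beta> \<eta> x0 p \<longleftrightarrow>
     (\<forall>x. \<forall>t>0. 0 \<le> p x t) \<and>
     (\<forall>t>0. has_bochner_integral lborel (\<lambda>x. p x t) 1) \<and>
     fokker_planck_solution \<beta> \<eta> p \<and>
     (\<forall>f :: real \<Rightarrow> real. continuous_on UNIV f \<longrightarrow> bounded (range f) \<longrightarrow>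
        ((\<lambda>t. LINT x|lborel. f x * p x t) \<longlongrightarrow> f x0) (at_right 0)) \<and>
     (\<forall>t>0. ((\<lambda>x. p x t) \<longlongrightarrow> 0) at_top \<and> ((\<lambda>x. p x t) \<longlongrightarrow> 0) at_bot)"

definition has_laplace_transform :: "(real \<Rightarrow> real) \<Rightarrow> complex \<Rightarrow> complex \<Rightarrow> bool" where
  "has_laplace_transform f \<theta> L \<longleftrightarrow>
     set_integrable lborel {0<..} (\<lambda>t. exp (- (\<theta> * of_real t)) * of_real (f t)) \<and>
     (LINT t:{0<..}|lborel. exp (- (\<theta> * of_real t)) * of_real (f t)) = L"

definition \<V> :: "complex \<Rightarrow> real \<Rightarrow> real \<Rightarrow> complex" where
  "\<V> \<theta> \<eta> \<beta> =
     - of_real (sqrt \<eta>) * parabolic_cylinder (- \<theta>) (of_real (- \<beta>))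
         * parabolic_cylinder' (- \<theta> / of_real \<eta>) (of_real (\<beta> / sqrt \<eta>))
     - parabolic_cylinder' (- \<theta>) (of_real (- \<beta>))
         * parabolic_cylinder (- \<theta> / of_real \<eta>) (of_real (\<beta> / sqrt \<eta>))"

definition \<M> :: "complex \<Rightarrow> real \<Rightarrow> real \<Rightarrow> complex" where
  "\<M> \<theta> \<eta> \<beta> =
     of_real (sqrt \<eta>) * parabolic_cylinder (- \<theta>) (of_real \<beta>)
         * parabolic_cylinder' (- \<theta> / of_real \<eta>) (of_real (\<beta> / sqrt \<eta>))
     - parabolic_cylinder' (- \<theta>) (of_real \<beta>)
         * parabolic_cylinder (- \<theta> / of_real \<eta>) (of_real (\<beta> / sqrt \<eta>))"

end

theory Submission
  imports Defs
begin

text \<open>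
  For \<open>\<epsilon> < T\<close> the truncated transform \<open>P(y) = \<integral> e\<^sup>-\<^sup>\<theta>\<^sup>t p(y,t) dt\<close> over \<open>[\<epsilon>, T]\<close> satisfies the resolvent
  equation \<open>P'' - (a P)' - \<theta> P = r\<close> with \<open>r = e\<^sup>-\<^sup>\<theta>\<^sup>T p(\<cdot>,T) - e\<^sup>-\<^sup>\<theta>\<^sup>\<epsilon> p(\<cdot>,\<epsilon>)\<close>, and \<open>P\<close> and \<open>r\<close> are
  integrable on the line.  Let \<open>u\<^sub>1\<close> and \<open>u\<^sub>2\<close> solve the adjoint equation
  \<open>u'' + a u' = \<theta> u\<close> and be bounded at \<open>-\<infinity>\<close> and \<open>+\<infinity>\<close>, and put
  \<open>g(y) = u\<^sub>1(min x y) u\<^sub>2(max x y)\<close>.  Green's identity expresses \<open>P(x)\<close> as a multiple of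
  \<open>\<integral> g r\<close>.  As \<open>\<epsilon> \<rightarrow> 0\<close> and \<open>T \<rightarrow> \<infinity>\<close> the initial condition turns this into
  \<open>\<integral>\<^sub>0\<^sup>\<infinity> e\<^sup>-\<^sup>\<theta>\<^sup>t p(x,t) dt = u\<^sub>1(min x x\<^sub>0) u\<^sub>2(max x x\<^sub>0) m(x) / W\<close>, where \<open>m\<close> is the stationary weight and \<open>W\<close> the
  Wronskian at \<open>0\<close>.

  The adjoint solutions are built from \<open>e\<^bsup>z\<^sup>2/4\<^esup> D\<^bsub>-s\<^esub>(z) = \<Gamma>(s)\<^sup>-\<^sup>1 \<integral>\<^sub>0\<^sup>\<infinity> t\<^bsup>s-1\<^esup> e\<^bsup>-zt-t\<^sup>2/2\<^esup> dt\<close>,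
  which is bounded as \<open>z \<rightarrow> +\<infinity>\<close>.
\<close>

section \<open>Laplace-type integrals\<close>

text \<open>Neither the size of the spatial derivative of \<open>p\<close> nor the pointwise
  behaviour of \<open>p\<close> as t tends to 0 is controlled, so the full transform can be neither
  differentiated in x nor assumed to converge. On a compact time interval differentiation under the
  integral is classical, and unit mass at each time supplies integrability in x. Testing against
  bounded adjoint solutions fits this information: the flux P' - a P, of which no growth is known,
  enters the two half-line identities with opposite signs and drops out at x. Two further obstacles
  shape the argument. For complex \<theta>, convergence of the truncated transforms does not by
  itself give absolute integrability, so a Green function is also built at the real point Re
  \<theta>, where the integrand is nonnegative. The same product shows that h has no real
  zeros.\<close>

lemma exp_remainder_bound:
  fixes x :: complex
  shows "norm (exp x - 1 - x) \<le> exp \<bar>Re x\<bar> * norm x ^ 2"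
  using Taylor_exp[of x 1] by (simp add: power2_eq_square algebra_simps)

text \<open>The second-order remainder of the exponential is dominated by |w - z|^2 t^2 |f t|
  e^(-(Re z - r) t): for w in the disc of radius r, the margin r pays for the growth factor of the
  remainder bound. The difference quotient therefore converges at rate O(|w - z|).\<close>

lemma laplace_integral_has_field_derivative:
  fixes f :: "real \<Rightarrow> complex" and z :: complex
  assumes r: "0 < r"
    and f: "\<And>w. Re z - r < Re w \<Longrightarrow> set_integrable lborel {0<..} (\<lambda>t. f t * exp (- (w * of_real t)))"
    and f1: "set_integrable lborel {0<..} (\<lambda>t. of_real t * f t * exp (- (z * of_real t)))"
    and f2: "set_integrable lborel {0<..} (\<lambda>t. of_real t ^ 2 * f t * exp (- ((z - of_real r) * of_real t)))"
  shows "((\<lambda>w. LINT t:{0<..}|lborel. f t * exp (- (w * of_real t))) has_field_derivative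
      - (LINT t:{0<..}|lborel. of_real t * f t * exp (- (z * of_real t)))) (at z)"
proof -
  let ?F = "\<lambda>w. LINT t:{0<..}|lborel. f t * exp (- (w * of_real t))"
  let ?D = "LINT t:{0<..}|lborel. of_real t * f t * exp (- (z * of_real t))"
  define C where "C = (LINT t:{0<..}|lborel. norm (of_real t ^ 2 * f t * exp (- ((z - of_real r) * of_real t))))"
  have main: "norm (?F w - ?F z + (w - z) * ?D) \<le> C * norm (w - z) ^ 2" if w: "norm (w - z) < r" for w
  proof -
    have rew: "\<bar>Re (w - z)\<bar> < r" using w abs_Re_le_cmod[of "w - z"] by linarith
    have iw: "set_integrable lborel {0<..} (\<lambda>t. f t * exp (- (w * of_real t)))"
      using rew by (intro f) auto
    have iz: "set_integrable lborel {0<..} (\<lambda>t. f t * exp (- (z * of_real t)))"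
      using r by (intro f) auto
    have i1: "set_integrable lborel {0<..} (\<lambda>t. (w - z) * (of_real t * f t * exp (- (z * of_real t))))"
      using f1 by (rule set_integrable_mult_right)
    let ?R = "\<lambda>t. f t * exp (- (w * of_real t)) - f t * exp (- (z * of_real t))
      + (w - z) * (of_real t * f t * exp (- (z * of_real t)))"
    have "norm (?F w - ?F z + (w - z) * ?D) = norm (LINT t:{0<..}|lborel. ?R t)"
      using iw iz i1 by (simp add: set_integral_diff set_integral_add)
    also have "\<dots> \<le> (LINT t:{0<..}|lborel. norm (w - z) ^ 2 *
        norm (of_real t ^ 2 * f t * exp (- ((z - of_real r) * of_real t))))"
      unfolding set_lebesgue_integral_def
    proof (rule Bochner_Integration.integral_norm_bound_integral)
      show "integrable lborel (\<lambda>t. indicator {0<..} t *\<^sub>R ?R t)"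
        using set_integral_add(1)[OF set_integral_diff(1)[OF iw iz] i1]
        by (simp add: set_integrable_def)
      show "integrable lborel (\<lambda>t. indicator {0<..} t *\<^sub>R (norm (w - z) ^ 2 *
          norm (of_real t ^ 2 * f t * exp (- ((z - of_real r) * of_real t)))))"
        using set_integrable_mult_right[OF set_integrable_norm[OF f2]]
        by (simp add: set_integrable_def)
      fix t :: real
      have "norm (?R t) \<le> norm (w - z) ^ 2 *
          norm (of_real t ^ 2 * f t * exp (- ((z - of_real r) * of_real t)))" if t: "0 < t"
      proof -
        define x where "x = - ((w - z) * of_real t)"
        have e: "exp (- (w * of_real t)) = exp (- (z * of_real t)) * exp x"
          by (simp add: x_def algebra_simps flip: exp_add)
        have "?R t = f t * exp (- (z * of_real t)) * (exp x - 1 - x)"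
          unfolding e by (simp add: x_def algebra_simps)
        then have "norm (?R t) = norm (f t * exp (- (z * of_real t)) * (exp x - 1 - x))" by simp
        also have "\<dots> \<le> norm (f t) * norm (exp (- (z * of_real t))) * (exp \<bar>Re x\<bar> * norm x ^ 2)"
          using exp_remainder_bound[of x] by (simp add: norm_mult mult_left_mono)
        also have "\<bar>Re x\<bar> \<le> r * t"
          using rew t by (simp add: x_def abs_mult mult_right_mono)
        also have "norm x = norm (w - z) * t" using t by (simp add: x_def norm_mult)
        finally have "norm (?R t) \<le> norm (f t) * norm (exp (- (z * of_real t))) *
            (exp (r * t) * (norm (w - z) * t) ^ 2)"
          by (simp add: mult_left_mono mult_right_mono)
        also have "\<dots> = norm (w - z) ^ 2 * (t ^ 2 * norm (f t) *
            (norm (exp (- (z * of_real t))) * exp (r * t)))"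
          by (simp add: power_mult_distrib)
        also have "norm (exp (- (z * of_real t))) * exp (r * t) =
            norm (exp (- ((z - of_real r) * of_real t)))"
          by (simp add: norm_exp_eq_Re left_diff_distrib flip: exp_add)
        also have "t ^ 2 * norm (f t) * \<dots> = norm (of_real t ^ 2 * f t * exp (- ((z - of_real r) * of_real t)))"
          by (simp add: norm_mult norm_power)
        finally show ?thesis .
      qed
      then show "norm (indicator {0<..} t *\<^sub>R ?R t) \<le> indicator {0<..} t *\<^sub>R (norm (w - z) ^ 2 *
          norm (of_real t ^ 2 * f t * exp (- ((z - of_real r) * of_real t))))"
        by (auto simp: indicator_def)
    qed
    also have "\<dots> = C * norm (w - z) ^ 2"
      unfolding C_def by (subst set_integral_mult_right) (rule mult.commute)
    finally show ?thesis .
  qed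
  have "((\<lambda>w. (?F w - ?F z) / (w - z) + ?D) \<longlongrightarrow> 0) (at z)"
  proof (rule Lim_null_comparison)
    have eq: "a / b + d = (a + b * d) / b" if "b \<noteq> 0" for a b d :: complex
      using that by (simp add: field_simps)
    show "\<forall>\<^sub>F w in at z. norm ((?F w - ?F z) / (w - z) + ?D) \<le> C * norm (w - z)"
      unfolding eventually_at
    proof (intro exI conjI ballI impI)
      fix w assume w: "w \<noteq> z \<and> dist w z < r"
      have "norm ((?F w - ?F z) / (w - z) + ?D) = norm ((?F w - ?F z + (w - z) * ?D) / (w - z))"
        using w by (simp add: eq)
      also have "\<dots> \<le> C * norm (w - z) ^ 2 / norm (w - z)"
        unfolding norm_divide using w by (intro divide_right_mono main) (auto simp: dist_norm)
      also have "\<dots> = C * norm (w - z)" using w by (simp add: power2_eq_square)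
      finally show "norm ((?F w - ?F z) / (w - z) + ?D) \<le> C * norm (w - z)" .
    qed (rule r)
    show "((\<lambda>w. C * norm (w - z)) \<longlongrightarrow> 0) (at z)"
      by (auto intro!: tendsto_eq_intros)
  qed
  then have "((\<lambda>w. (?F w - ?F z) / (w - z) + ?D - ?D) \<longlongrightarrow> 0 - ?D) (at z)"
    by (intro tendsto_intros)
  then show ?thesis by (simp add: has_field_derivative_iff)
qed

lemma integral_derivative_half_line:
  fixes F f :: "real \<Rightarrow> complex"
  assumes F: "\<And>t. 0 < t \<Longrightarrow> (F has_vector_derivative f t) (at t)"
    and f: "\<And>t. 0 < t \<Longrightarrow> isCont f t"
    and int: "set_integrable lborel {0<..} f"
    and lim: "(F \<longlongrightarrow> A) (at_right 0)" "(F \<longlongrightarrow> B) at_top"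
  shows "(LINT t:{0<..}|lborel. f t) = B - A"
proof -
  have eq: "einterval 0 \<infinity> = {0<..}" by (auto simp: einterval_def)
  have "(LBINT t=0..\<infinity>. f t) = B - A"
  proof (rule interval_integral_FTC_integrable)
    show "((F \<circ> real_of_ereal) \<longlongrightarrow> A) (at_right 0)"
      using lim(1) by (simp add: ereal_tendsto_simps zero_ereal_def)
    show "((F \<circ> real_of_ereal) \<longlongrightarrow> B) (at_left \<infinity>)"
      using lim(2) by (simp add: ereal_tendsto_simps)
  qed (use assms eq in auto)
  then show ?thesis by (simp add: interval_lebesgue_integral_def eq)
qed

section \<open>Gamma integrals with complex parameters\<close>

lemma set_integrable_powr_exp_bound:
  fixes s :: complex and g :: "real \<Rightarrow> complex"
  assumes s: "0 < Re s" and c: "0 < c" and g: "continuous_on {0<..} g"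
    and bound: "\<And>t. 0 < t \<Longrightarrow> norm (g t) \<le> K * exp (- (c * t))"
  shows "set_integrable lborel {0<..} (\<lambda>t. of_real t powr (s - 1) * g t)"
proof -
  have m: "set_borel_measurable lborel {0<..} h" if "continuous_on {0<..} h" for h :: "real \<Rightarrow> complex"
    unfolding set_borel_measurable_def using borel_measurable_continuous_on_indicator[OF _ that] by simp
  have cp: "continuous_on {0<..} (\<lambda>t. complex_of_real t powr (s - 1))"
    by (intro continuous_intros) (auto simp: complex_nonpos_Reals_iff)
  \<comment> \<open>The Gamma integral with rate c is given for the completed measure; Borel
    measurability of the integrand brings it back to \<open>lborel\<close>.\<close>
  have "set_integrable lebesgue {0<..} (\<lambda>t. complex_of_real t powr (s - 1) / of_real (exp (c * t)))"
    using absolutely_integrable_Gamma_integral[OF s c] .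
  moreover have "set_borel_measurable lborel {0<..} (\<lambda>t. complex_of_real t powr (s - 1) / of_real (exp (c * t)))"
    by (intro m continuous_intros cp) auto
  ultimately have "set_integrable lborel {0<..} (\<lambda>t. complex_of_real t powr (s - 1) / of_real (exp (c * t)))"
    unfolding set_integrable_def set_borel_measurable_def by (simp add: integrable_completion)
  from set_integrable_mult_right[OF this, of "of_real K"]
  have "set_integrable lborel {0<..} (\<lambda>t. K *\<^sub>R (complex_of_real t powr (s - 1) / of_real (exp (c * t))))"
    by (simp add: scaleR_conv_of_real)
  then show ?thesis
  proof (rule set_integrable_bound)
    show "set_borel_measurable lborel {0<..} (\<lambda>t. of_real t powr (s - 1) * g t)"
      by (intro m continuous_intros cp g)
    have "norm (complex_of_real t powr (s - 1) * g t) \<le> norm (K *\<^sub>R (complex_of_real t powr (s - 1) / of_real (exp (c * t))))"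
      if "0 < t" for t
    proof -
      have "norm (complex_of_real t powr (s - 1) * g t) \<le> norm (complex_of_real t powr (s - 1)) * (K * exp (- (c * t)))"
        using bound[OF that] by (simp add: norm_mult mult_left_mono)
      also have "\<dots> \<le> norm (complex_of_real t powr (s - 1)) * (\<bar>K\<bar> * exp (- (c * t)))"
        by (intro mult_left_mono mult_right_mono) auto
      finally show ?thesis by (simp add: norm_mult norm_divide exp_minus field_simps)
    qed
    then show "AE t in lborel. t \<in> {0<..} \<longrightarrow> norm (complex_of_real t powr (s - 1) * g t)
        \<le> norm (K *\<^sub>R (complex_of_real t powr (s - 1) / of_real (exp (c * t))))"
      by simp
  qed
qed

text \<open>No rotation of the ray is needed: integration by parts gives u A(s + 1, u) = s A(s, u),
  so A(s, u) u^s has derivative 0 in u on the right half plane. The constant is read off at u = 1,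
  where A is Euler's integral.\<close>

lemma integral_powr_exp:
  fixes s u :: complex
  assumes s: "0 < Re s" and u: "0 < Re u"
  shows "set_integrable lborel {0<..} (\<lambda>t. of_real t powr (s - 1) * exp (- (u * of_real t)))" (is ?int)
    and "(LINT t:{0<..}|lborel. of_real t powr (s - 1) * exp (- (u * of_real t))) = Gamma s * u powr (- s)"
proof -
  let ?A = "\<lambda>s u. LINT t:{0<..}|lborel. of_real t powr (s - 1) * exp (- (u * of_real t))"
  have int: "set_integrable lborel {0<..} (\<lambda>t. of_real t powr (s - 1) * exp (- (u * of_real t)))"
    if "0 < Re s" "0 < Re u" for s u :: complex
    using that by (intro set_integrable_powr_exp_bound[where c = "Re u" and K = 1])
      (auto intro!: continuous_intros)
  show ?int using int s u .
  have shift: "complex_of_real t * complex_of_real t powr (s - 1) = complex_of_real t powr s" if "0 < t" for t s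
    using that by (simp add: powr_diff)
  have parts: "u * ?A (s + 1) u = s * ?A s u" if u: "0 < Re u" for u
  proof -
    have i1: "set_integrable lborel {0<..} (\<lambda>t. s * (of_real t powr (s - 1) * exp (- (u * of_real t))))"
      using int[OF s u] by (rule set_integrable_mult_right)
    have i2: "set_integrable lborel {0<..} (\<lambda>t. u * (of_real t powr s * exp (- (u * of_real t))))"
      using int[of "s + 1", OF _ u] s by (intro set_integrable_mult_right) auto
    have "(LINT t:{0<..}|lborel. s * (of_real t powr (s - 1) * exp (- (u * of_real t)))
        - u * (of_real t powr s * exp (- (u * of_real t)))) = 0 - 0"
    proof (rule integral_derivative_half_line)
      show "((\<lambda>t. of_real t powr s * exp (- (u * of_real t))) has_vector_derivative
          s * (of_real t powr (s - 1) * exp (- (u * of_real t)))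
        - u * (of_real t powr s * exp (- (u * of_real t)))) (at t)" if "0 < t" for t
        using that by (auto intro!: has_vector_derivative_real_field derivative_eq_intros
            simp: complex_nonpos_Reals_iff algebra_simps)
      show "isCont (\<lambda>t. s * (of_real t powr (s - 1) * exp (- (u * of_real t)))
        - u * (of_real t powr s * exp (- (u * of_real t)))) t" if "0 < t" for t
        using that by (auto intro!: continuous_intros simp: complex_nonpos_Reals_iff)
      show "set_integrable lborel {0<..} (\<lambda>t. s * (of_real t powr (s - 1) * exp (- (u * of_real t)))
        - u * (of_real t powr s * exp (- (u * of_real t))))"
        using i1 i2 by (rule set_integral_diff)
      show "((\<lambda>t. of_real t powr s * exp (- (u * of_real t))) \<longlongrightarrow> 0) (at_right 0)"
      proof (rule Lim_null_comparison)
        show "\<forall>\<^sub>F t in at_right 0. norm (of_real t powr s * exp (- (u * of_real t))) \<le> t powr Re s * exp (- (Re u * t))"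
          using eventually_at_right_less[of 0] by eventually_elim (simp add: norm_mult norm_powr_real_powr)
        show "((\<lambda>t. t powr Re s * exp (- (Re u * t))) \<longlongrightarrow> 0) (at_right 0)"
          using s u by real_asymp
      qed
      show "((\<lambda>t. of_real t powr s * exp (- (u * of_real t))) \<longlongrightarrow> 0) at_top"
      proof (rule Lim_null_comparison)
        show "\<forall>\<^sub>F t in at_top. norm (of_real t powr s * exp (- (u * of_real t))) \<le> t powr Re s * exp (- (Re u * t))"
          using eventually_gt_at_top[of 0] by eventually_elim (simp add: norm_mult norm_powr_real_powr)
        show "((\<lambda>t. t powr Re s * exp (- (Re u * t))) \<longlongrightarrow> 0) at_top"
          using s u by real_asymp
      qed
    qed
    then show ?thesis using i1 i2 by (simp add: set_integral_diff)
  qed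
  have deriv: "(?A s has_field_derivative - ?A (s + 1) u) (at u)" if u: "0 < Re u" for u
  proof -
    have "(?A s has_field_derivative - (LINT t:{0<..}|lborel. of_real t * of_real t powr (s - 1) * exp (- (u * of_real t)))) (at u)"
    \<comment> \<open>The radius Re u / 2 keeps the shifted point u - r inside the open right half
      plane.\<close>
    proof (rule laplace_integral_has_field_derivative[where r = "Re u / 2"])
      show "set_integrable lborel {0<..} (\<lambda>t. of_real t powr (s - 1) * exp (- (w * of_real t)))"
        if "Re u - Re u / 2 < Re w" for w
        using that u s by (intro int) auto
      show "set_integrable lborel {0<..} (\<lambda>t. of_real t * of_real t powr (s - 1) * exp (- (u * of_real t)))"
        using int[of "s + 1" u] s u
        by (subst set_integrable_cong[OF refl refl, where f' = "\<lambda>t. of_real t powr s * exp (- (u * of_real t))"])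
          (simp_all add: shift)
      show "set_integrable lborel {0<..} (\<lambda>t. (of_real t)\<^sup>2 * of_real t powr (s - 1)
          * exp (- ((u - of_real (Re u / 2)) * of_real t)))"
      proof -
        have "complex_of_real t ^ 2 * of_real t powr (s - 1) = of_real t powr (s + 2 - 1)" if "0 < t" for t
          using shift[OF that, of s] shift[OF that, of "s + 1"]
          by (simp add: power2_eq_square mult.assoc add.commute)
        then show ?thesis using int[of "s + 2" "u - of_real (Re u / 2)"] s u
          by (subst set_integrable_cong[OF refl refl, where f' = "\<lambda>t. of_real t powr (s + 2 - 1)
            * exp (- ((u - of_real (Re u / 2)) * of_real t))"]) simp_all
      qed
    qed (use u in auto)
    also have "(LINT t:{0<..}|lborel. of_real t * of_real t powr (s - 1) * exp (- (u * of_real t))) = ?A (s + 1) u"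
      by (rule set_lebesgue_integral_cong) (simp_all add: shift)
    finally show ?thesis .
  qed
  have "\<exists>c. \<forall>w\<in>{w. 0 < Re w}. ?A s w * w powr s = c"
  proof (rule has_field_derivative_zero_constant)
    show "convex {w. 0 < Re w}" by (rule convex_halfspace_Re_gt)
    fix w :: complex assume "w \<in> {w. 0 < Re w}"
    then have w: "0 < Re w" by simp
    have nz: "w \<noteq> 0" using w by auto
    have "((\<lambda>w. ?A s w * w powr s) has_field_derivative
        - ?A (s + 1) w * w powr s + s * w powr (s - 1) * ?A s w) (at w)"
      by (rule DERIV_mult'[THEN DERIV_cong] deriv has_field_derivative_powr w | use w in \<open>simp add: complex_nonpos_Reals_iff\<close>)+
    also have "- ?A (s + 1) w * w powr s + s * w powr (s - 1) * ?A s w =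
      (s * ?A s w - w * ?A (s + 1) w) * w powr s / w" using nz by (simp add: powr_diff field_simps)
    also have "\<dots> = 0" using parts[OF w] by simp
    finally show "((\<lambda>w. ?A s w * w powr s) has_field_derivative 0) (at w within {w. 0 < Re w})"
      by (rule has_field_derivative_at_within)
  qed
  then obtain c where c: "\<And>w. 0 < Re w \<Longrightarrow> ?A s w * w powr s = c" by auto
  have "?A s 1 = Gamma s"
  proof -
    have "((\<lambda>t. of_real t powr (s - 1) * exp (- (1 * of_real t))) has_integral ?A s 1) {0<..}"
      using set_borel_integral_eq_integral[OF int[OF s, of 1]] by (simp add: has_integral_iff)
    moreover have "((\<lambda>t. of_real t powr (s - 1) * exp (- (1 * of_real t))) has_integral Gamma s) {0<..}"
      using Gamma_integral_complex'[OF s] by (simp add: exp_minus field_simps flip: exp_of_real)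
    ultimately show ?thesis by (rule has_integral_unique)
  qed
  with c[of 1] c[OF u] have "?A s u * u powr s = Gamma s" by simp
  moreover have "u \<noteq> 0" using u by auto
  ultimately show "?A s u = Gamma s * u powr (- s)" by (simp add: powr_minus field_simps)
qed

section \<open>The Gaussian Mellin transform\<close>

definition gaussian_mellin :: "complex \<Rightarrow> complex \<Rightarrow> complex" where
  "gaussian_mellin s z =
     (LINT t:{0<..}|lborel. of_real t powr (s - 1) * exp (- (of_real t)\<^sup>2 / 2) * exp (- (z * of_real t)))"

text \<open>Completing the square: the two exponents differ by (t - (1 - Re z))^2 / 2. Every z is
  thus covered by the decay rate 1, which is what makes the transform entire in z.\<close>

lemma norm_gaussian_exp_le:
  "norm (exp (- (of_real t)\<^sup>2 / 2) * exp (- (z * of_real t))) \<le> exp ((1 - Re z)\<^sup>2 / 2) * exp (- t)"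
  for t :: real and z :: complex
proof -
  have "- (t\<^sup>2 / 2) - Re z * t \<le> (1 - Re z)\<^sup>2 / 2 - t"
    using sum_power2_ge_zero[of "t - (1 - Re z)" 0] by (simp add: power2_eq_square algebra_simps)
  then show ?thesis
    by (simp add: norm_mult power2_eq_square flip: exp_add)
qed

lemma gaussian_mellin_integrable:
  assumes "0 < Re s"
  shows "set_integrable lborel {0<..}
    (\<lambda>t. of_real t powr (s - 1) * exp (- (of_real t)\<^sup>2 / 2) * exp (- (z * of_real t)))"
  unfolding mult.assoc
proof (rule set_integrable_powr_exp_bound[OF assms zero_less_one])
  show "norm (exp (- (of_real t)\<^sup>2 / 2) * exp (- (z * of_real t))) \<le> exp ((1 - Re z)\<^sup>2 / 2) * exp (- (1 * t))" for t
    using norm_gaussian_exp_le[of t z] by simp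
qed (auto intro!: continuous_intros)

lemma of_real_mult_powr_diff_1:
  "0 < t \<Longrightarrow> complex_of_real t * complex_of_real t powr (s - 1) = complex_of_real t powr s"
  by (simp add: powr_diff)

lemma gaussian_mellin_has_field_derivative:
  assumes s: "0 < Re s"
  shows "(gaussian_mellin s has_field_derivative - gaussian_mellin (s + 1) z) (at z)"
proof -
  have "(gaussian_mellin s has_field_derivative - (LINT t:{0<..}|lborel. of_real t *
      (of_real t powr (s - 1) * exp (- (of_real t)\<^sup>2 / 2)) * exp (- (z * of_real t)))) (at z)"
    unfolding gaussian_mellin_def
  proof (rule laplace_integral_has_field_derivative[OF zero_less_one])
    show "set_integrable lborel {0<..} (\<lambda>t. of_real t powr (s - 1) * exp (- (of_real t)\<^sup>2 / 2) * exp (- (w * of_real t)))" for w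
      using s by (rule gaussian_mellin_integrable)
    show "set_integrable lborel {0<..} (\<lambda>t. of_real t * (of_real t powr (s - 1) * exp (- (of_real t)\<^sup>2 / 2)) * exp (- (z * of_real t)))"
      using gaussian_mellin_integrable[of "s + 1" z] s
      by (subst set_integrable_cong[OF refl refl,
            where f' = "\<lambda>t. of_real t powr s * exp (- (of_real t)\<^sup>2 / 2) * exp (- (z * of_real t))"])
        (simp_all add: of_real_mult_powr_diff_1 flip: mult.assoc)
    show "set_integrable lborel {0<..} (\<lambda>t. (of_real t)\<^sup>2 * (of_real t powr (s - 1) * exp (- (of_real t)\<^sup>2 / 2))
          * exp (- ((z - of_real 1) * of_real t)))"
    proof -
      have "complex_of_real t ^ 2 * of_real t powr (s - 1) = of_real t powr (s + 2 - 1)" if "0 < t" for t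
        using of_real_mult_powr_diff_1[OF that, of s] of_real_mult_powr_diff_1[OF that, of "s + 1"]
        by (simp add: power2_eq_square mult.assoc add.commute)
      then show ?thesis using gaussian_mellin_integrable[of "s + 2" "z - 1"] s
        by (subst set_integrable_cong[OF refl refl, where f' = "\<lambda>t. of_real t powr (s + 2 - 1)
            * exp (- (of_real t)\<^sup>2 / 2) * exp (- ((z - 1) * of_real t))"])
          (simp_all flip: mult.assoc)
    qed
  qed
  also have "(LINT t:{0<..}|lborel. of_real t * (of_real t powr (s - 1) * exp (- (of_real t)\<^sup>2 / 2))
      * exp (- (z * of_real t))) = gaussian_mellin (s + 1) z"
    unfolding gaussian_mellin_def
    by (rule set_lebesgue_integral_cong) (simp_all add: of_real_mult_powr_diff_1 flip: mult.assoc)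
  finally show ?thesis .
qed

text \<open>The derivative of t^s e^(-t^2/2 - z t) integrates to 0 over the half line. This relation
  later becomes the differential equation of \<open>hermite_fn\<close>.\<close>

lemma gaussian_mellin_recurrence:
  assumes s: "0 < Re s"
  shows "gaussian_mellin (s + 2) z = s * gaussian_mellin s z - z * gaussian_mellin (s + 1) z"
proof -
  let ?g = "\<lambda>a t. complex_of_real t powr (a - 1) * exp (- (of_real t)\<^sup>2 / 2) * exp (- (z * of_real t))"
  have i: "set_integrable lborel {0<..} (\<lambda>t. c * ?g a t)" if "0 < Re a" for a c
    using gaussian_mellin_integrable[OF that] by (rule set_integrable_mult_right)
  have ii: "set_integrable lborel {0<..} (\<lambda>t. s * ?g s t - z * ?g (s + 1) t - 1 * ?g (s + 2) t)"
    using s by (intro set_integral_diff i) auto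
  have "(LINT t:{0<..}|lborel. s * ?g s t - z * ?g (s + 1) t - 1 * ?g (s + 2) t) = 0 - 0"
  proof (rule integral_derivative_half_line)
    show "((\<lambda>t. of_real t powr s * exp (- (of_real t)\<^sup>2 / 2) * exp (- (z * of_real t))) has_vector_derivative
        s * ?g s t - z * ?g (s + 1) t - 1 * ?g (s + 2) t) (at t)" if "0 < t" for t
    proof -
      have "complex_of_real t powr (s + 2 - 1) = of_real t * of_real t powr s"
        using of_real_mult_powr_diff_1[OF that, of "s + 1"] by (simp add: add.commute)
      then show ?thesis
      using that by (auto intro!: has_vector_derivative_real_field derivative_eq_intros
          simp: complex_nonpos_Reals_iff algebra_simps simp flip: power2_eq_square)
    qed
    show "isCont (\<lambda>t. s * ?g s t - z * ?g (s + 1) t - 1 * ?g (s + 2) t) t" if "0 < t" for t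
      using that by (auto intro!: continuous_intros simp: complex_nonpos_Reals_iff)
    have norm: "norm (complex_of_real t powr s * exp (- (of_real t)\<^sup>2 / 2) * exp (- (z * of_real t)))
        = t powr Re s * exp (- t\<^sup>2 / 2) * exp (- (Re z * t))" if "0 < t" for t
      using that by (simp add: norm_mult norm_powr_real_powr power2_eq_square)
    show "((\<lambda>t. of_real t powr s * exp (- (of_real t)\<^sup>2 / 2) * exp (- (z * of_real t))) \<longlongrightarrow> 0) (at_right 0)"
    proof (rule Lim_null_comparison)
      show "\<forall>\<^sub>F t in at_right 0. norm (of_real t powr s * exp (- (of_real t)\<^sup>2 / 2) * exp (- (z * of_real t)))
          \<le> t powr Re s * exp (- t\<^sup>2 / 2) * exp (- (Re z * t))"
        using eventually_at_right_less[of 0] by eventually_elim (simp only: norm order_refl)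
      show "((\<lambda>t. t powr Re s * exp (- t\<^sup>2 / 2) * exp (- (Re z * t))) \<longlongrightarrow> 0) (at_right 0)"
        using s by real_asymp
    qed
    show "((\<lambda>t. of_real t powr s * exp (- (of_real t)\<^sup>2 / 2) * exp (- (z * of_real t))) \<longlongrightarrow> 0) at_top"
    proof (rule Lim_null_comparison)
      show "\<forall>\<^sub>F t in at_top. norm (of_real t powr s * exp (- (of_real t)\<^sup>2 / 2) * exp (- (z * of_real t)))
          \<le> exp ((1 - Re z)\<^sup>2 / 2) * (t powr Re s * exp (- t))"
        using eventually_gt_at_top[of 0]
      proof eventually_elim
        case (elim t)
        then have "norm (of_real t powr s * (exp (- (of_real t)\<^sup>2 / 2) * exp (- (z * of_real t))))
            \<le> t powr Re s * (exp ((1 - Re z)\<^sup>2 / 2) * exp (- t))"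
          unfolding norm_mult[of "of_real t powr s"]
          by (intro mult_mono norm_gaussian_exp_le) (simp_all add: norm_powr_real_powr)
        then show ?case by (simp only: mult_ac)
      qed
      have "((\<lambda>t. t powr Re s * exp (- t)) \<longlongrightarrow> 0) at_top"
        using s by real_asymp
      then show "((\<lambda>t. exp ((1 - Re z)\<^sup>2 / 2) * (t powr Re s * exp (- t))) \<longlongrightarrow> 0) at_top"
        by (rule tendsto_mult_right_zero)
    qed
  qed (rule ii)
  moreover have "(LINT t:{0<..}|lborel. s * ?g s t - z * ?g (s + 1) t - 1 * ?g (s + 2) t)
      = s * gaussian_mellin s z - z * gaussian_mellin (s + 1) z - 1 * gaussian_mellin (s + 2) z"
    unfolding gaussian_mellin_def using s
    by (subst set_integral_diff(2), (intro set_integral_diff(1) i; simp), (intro i; simp),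
        subst set_integral_diff(2), (intro i; simp), (intro i; simp), simp only: set_integral_mult_right)
  ultimately show ?thesis by simp
qed

lemma not_nonpos_Ints_Re_pos:
  fixes z :: complex
  assumes "0 < Re z" shows "z \<notin> \<int>\<^sub>\<le>\<^sub>0"
proof
  assume "z \<in> \<int>\<^sub>\<le>\<^sub>0"
  then obtain n where "z = of_int n" "n \<le> 0" by (elim nonpos_Ints_cases)
  with assms show False by simp
qed

text \<open>The substitution u = t^2/2 leads to Euler's integral at s/2. The power of 2 is written
  as an exponential to match the form of Legendre duplication in
  \<open>hermite_fn_wronskian\<close>.\<close>

lemma gaussian_mellin_0:
  assumes s: "0 < Re s"
  shows "gaussian_mellin s 0 = exp ((s / 2 - 1) * of_real (ln 2)) * Gamma (s / 2)"
proof -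
  let ?f = "\<lambda>u. complex_of_real u powr (s / 2 - 1) / of_real (exp u)"
  let ?g = "\<lambda>t::real. t\<^sup>2 / 2"
  have s2: "0 < Re (s / 2)" using s by simp
  have im: "?g ` {0<..} = {0<..}"
  proof -
    have "x \<in> ?g ` {0<..}" if "0 < x" for x
      using that by (intro image_eqI[of _ _ "sqrt (2 * x)"]) auto
    then show ?thesis by auto
  qed
  \<comment> \<open>Integrability and value travel together because the change of variables is an
    equivalence for the pair.\<close>
  have "?f absolutely_integrable_on ?g ` {0<..} \<and> integral (?g ` {0<..}) ?f = Gamma (s / 2)"
    unfolding im using absolutely_integrable_Gamma_integral'[OF s2] Gamma_integral_complex'[OF s2]
    by (simp add: integral_unique)
  also have "?this \<longleftrightarrow> (\<lambda>t. \<bar>t\<bar> *\<^sub>R ?f (?g t)) absolutely_integrable_on {0<..} \<and>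
      integral {0<..} (\<lambda>t. \<bar>t\<bar> *\<^sub>R ?f (?g t)) = Gamma (s / 2)"
    by (rule has_absolute_integral_change_of_variables_real[symmetric])
      (auto intro!: derivative_eq_intros inj_onI)
  finally have 1: "integral {0<..} (\<lambda>t. \<bar>t\<bar> *\<^sub>R ?f (?g t)) = Gamma (s / 2)" by simp
  have eq: "\<bar>t\<bar> *\<^sub>R ?f (?g t) = exp ((1 - s / 2) * of_real (ln 2)) *
      (of_real t powr (s - 1) * exp (- (of_real t)\<^sup>2 / 2) * exp (- (0 * of_real t)))" if t: "0 < t" for t
  proof -
    have p: "complex_of_real x powr a = exp (a * of_real (ln x))" if "0 < x" for x a
      using that by (simp add: powr_def Ln_of_real)
    have "of_real t = exp (complex_of_real (ln t))" using t by (simp add: exp_of_real)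
    moreover have "ln (t\<^sup>2 / 2) = 2 * ln t - ln 2"
      using t by (simp add: ln_div ln_realpow)
    ultimately have "of_real t * ?f (?g t) = exp (of_real (ln t)) *
        (exp ((s / 2 - 1) * (2 * of_real (ln t) - of_real (ln 2))) * exp (- (of_real t)\<^sup>2 / 2))"
      using t by (subst p) (simp_all only: divide_pos_pos zero_less_power zero_less_numeral
          exp_of_real[symmetric] of_real_diff of_real_mult of_real_numeral exp_minus[symmetric] divide_inverse,
          simp_all add: field_simps exp_minus)
    also have "\<dots> = exp ((1 - s / 2) * of_real (ln 2)) * (exp ((s - 1) * of_real (ln t)) * exp (- (of_real t)\<^sup>2 / 2))"
      by (simp add: algebra_simps flip: exp_add)
    finally show ?thesis using t by (subst p) (simp_all add: scaleR_conv_of_real)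
  qed
  have "Gamma (s / 2) = integral {0<..} (\<lambda>t. exp ((1 - s / 2) * of_real (ln 2)) *
      (of_real t powr (s - 1) * exp (- (of_real t)\<^sup>2 / 2) * exp (- (0 * of_real t))))"
    unfolding 1[symmetric] by (rule Henstock_Kurzweil_Integration.integral_cong) (use eq in auto)
  also have "\<dots> = exp ((1 - s / 2) * of_real (ln 2)) * gaussian_mellin s 0"
    unfolding gaussian_mellin_def set_borel_integral_eq_integral(2)[OF gaussian_mellin_integrable[OF s]]
    by (rule integral_mult_right)
  finally have "exp ((s / 2 - 1) * of_real (ln 2)) * Gamma (s / 2) =
     exp ((s / 2 - 1) * of_real (ln 2)) * exp ((1 - s / 2) * of_real (ln 2)) * gaussian_mellin s 0"
    by simp
  also have "exp ((s / 2 - 1) * complex_of_real (ln 2)) * exp ((1 - s / 2) * of_real (ln 2)) = 1"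
    by (simp add: algebra_simps flip: exp_add)
  finally show ?thesis by simp
qed

text \<open>Taking absolute values inside the integral replaces s and z by their real parts, and the
  resulting real integral decreases in Re z. One constant therefore serves a whole half plane Re z
  \<ge> c.\<close>

lemma norm_gaussian_mellin_le:
  assumes s: "0 < Re s" and c: "c \<le> Re z"
  shows "norm (gaussian_mellin s z) \<le> norm (gaussian_mellin (of_real (Re s)) (of_real c))"
proof -
  let ?f = "\<lambda>s z t. complex_of_real t powr (s - 1) * exp (- (of_real t)\<^sup>2 / 2) * exp (- (z * of_real t))"
  let ?g = "\<lambda>t. t powr (Re s - 1) * exp (- t\<^sup>2 / 2) * exp (- (c * t))"
  have f: "?f (of_real (Re s)) (of_real c) t = of_real (?g t)" if "0 < t" for t
    using that powr_of_real[of t "Re s - 1"] by (simp flip: exp_of_real)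
  have fi: "set_integrable lborel {0<..} (?f (of_real (Re s)) (of_real c))"
    using s by (intro gaussian_mellin_integrable) simp
  then have "set_integrable lborel {0<..} (\<lambda>t. complex_of_real (?g t))"
    by (rule set_integrable_cong[OF refl refl, THEN iffD1, rotated]) (simp only: f greaterThan_iff)
  then have gi: "set_integrable lborel {0<..} ?g"
    using complex_of_real_integrable_eq[of lborel "\<lambda>t. indicator {0<..} t * ?g t"]
    by (simp add: set_integrable_def scaleR_conv_of_real)
  have "norm (gaussian_mellin s z) \<le> (LINT t:{0<..}|lborel. ?g t)"
    unfolding gaussian_mellin_def set_lebesgue_integral_def
  proof (rule Bochner_Integration.integral_norm_bound_integral)
    show "integrable lborel (\<lambda>t. indicator {0<..} t *\<^sub>R ?f s z t)"
      using gaussian_mellin_integrable[OF s] by (simp add: set_integrable_def)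
    show "integrable lborel (\<lambda>t. indicator {0<..} t *\<^sub>R ?g t)"
      using gi by (simp add: set_integrable_def)
    have "norm (?f s z t) \<le> ?g t" if t: "0 < t" for t
    proof -
      have "norm (?f s z t) = t powr (Re s - 1) * exp (- t\<^sup>2 / 2) * exp (- (Re z * t))"
        using t by (simp add: norm_mult norm_powr_real_powr power2_eq_square)
      also have "\<dots> \<le> ?g t" using t c by (intro mult_left_mono) (auto intro: mult_right_mono)
      finally show ?thesis .
    qed
    then show "norm (indicator {0<..} t *\<^sub>R ?f s z t) \<le> indicator {0<..} t *\<^sub>R ?g t" for t
      by (auto simp: indicator_def)
  qed
  also have "(LINT t:{0<..}|lborel. ?g t) \<le> norm (complex_of_real (LINT t:{0<..}|lborel. ?g t))" by simp
  also have "complex_of_real (LINT t:{0<..}|lborel. ?g t) = (LINT t:{0<..}|lborel. complex_of_real (?g t))"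
    by (rule set_integral_complex_of_real[symmetric])
  also have "\<dots> = gaussian_mellin (of_real (Re s)) (of_real c)"
    unfolding gaussian_mellin_def
    by (rule set_lebesgue_integral_cong, simp) (intro allI impI f[symmetric], simp)
  finally show ?thesis .
qed

section \<open>Hermite functions: differential equation, Wronskian and sign\<close>

definition hermite_fn :: "complex \<Rightarrow> complex \<Rightarrow> complex" where
  "hermite_fn s z = gaussian_mellin s z / Gamma s"

definition hermite_fn' :: "complex \<Rightarrow> complex \<Rightarrow> complex" where
  "hermite_fn' s z = - gaussian_mellin (s + 1) z / Gamma s"

lemma hermite_fn_has_field_derivative:
  "0 < Re s \<Longrightarrow> (hermite_fn s has_field_derivative hermite_fn' s z) (at z)"
  unfolding hermite_fn_def hermite_fn'_def
  by (intro DERIV_cdivide gaussian_mellin_has_field_derivative)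

text \<open>Dividing the recurrence by Gamma(s) gives h'' = z h' + s h, the equation solved by
  2^(s/2) H(z / sqrt 2) with H the Hermite function of order -s.\<close>

lemma hermite_fn'_has_field_derivative:
  assumes "0 < Re s"
  shows "(hermite_fn' s has_field_derivative z * hermite_fn' s z + s * hermite_fn s z) (at z)"
proof -
  have "(hermite_fn' s has_field_derivative - (- gaussian_mellin (s + 1 + 1) z) / Gamma s) (at z)"
    unfolding hermite_fn'_def using assms
    by (intro DERIV_cdivide DERIV_minus gaussian_mellin_has_field_derivative) simp
  then show ?thesis
    using gaussian_mellin_recurrence[OF assms, of z]
    by (simp add: hermite_fn_def hermite_fn'_def diff_divide_distrib add.assoc)
qed

lemma hermite_fn_bounded:
  assumes "0 < Re s"
  obtains C where "\<And>z. c \<le> Re z \<Longrightarrow> norm (hermite_fn s z) \<le> C"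
    "\<And>z. c \<le> Re z \<Longrightarrow> norm (hermite_fn' s z) \<le> C"
proof
  let ?A = "norm (gaussian_mellin (of_real (Re s)) (of_real c)) / norm (Gamma s)"
  let ?B = "norm (gaussian_mellin (of_real (Re (s + 1))) (of_real c)) / norm (Gamma s)"
  fix z assume z: "c \<le> Re z"
  have "norm (hermite_fn s z) \<le> ?A" "norm (hermite_fn' s z) \<le> ?B"
    unfolding hermite_fn_def hermite_fn'_def norm_divide norm_minus_cancel using assms z
    by (intro divide_right_mono norm_gaussian_mellin_le; simp)+
  then show "norm (hermite_fn s z) \<le> max ?A ?B" "norm (hermite_fn' s z) \<le> max ?A ?B" by auto
qed

text \<open>By Abel's identity the Wronskian of h(z) and h(-z) is a constant multiple of e^(z^2/2);
  the plus sign comes from differentiating h(-z). Legendre duplication merges the two Gamma values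
  at 0 into a single Gamma(s), which cancels one of the two normalising factors.\<close>

lemma hermite_fn_wronskian:
  assumes s: "0 < Re s"
  shows "hermite_fn' s z * hermite_fn s (- z) + hermite_fn s z * hermite_fn' s (- z)
    = - exp (z\<^sup>2 / 2) * of_real (sqrt (2 * pi)) / Gamma s"
proof -
  let ?h = "hermite_fn s" and ?h' = "hermite_fn' s"
  define W where "W z = exp (- z\<^sup>2 / 2) * (?h' z * ?h (- z) + ?h z * ?h' (- z))" for z
  note [derivative_intros] = DERIV_chain2[OF hermite_fn_has_field_derivative[OF s]]
    DERIV_chain2[OF hermite_fn'_has_field_derivative[OF s]]
  have "(W has_field_derivative 0) (at z)" for z
    unfolding W_def by (auto intro!: derivative_eq_intros simp: algebra_simps power2_eq_square)
  then obtain c where c: "\<And>z. W z = c"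
    using has_field_derivative_zero_constant[of UNIV W] by auto
  have G0: "Gamma s \<noteq> 0" using not_nonpos_Ints_Re_pos[OF s] by (simp add: Gamma_eq_zero_iff)
  have "W 0 = - (2 * gaussian_mellin s 0 * gaussian_mellin (s + 1) 0) / (Gamma s)\<^sup>2"
    by (simp add: W_def hermite_fn_def hermite_fn'_def power2_eq_square field_simps)
  also have "2 * gaussian_mellin s 0 * gaussian_mellin (s + 1) 0 =
     2 * exp ((s / 2 - 1) * of_real (ln 2)) * exp (((s + 1) / 2 - 1) * of_real (ln 2))
       * (Gamma (s / 2) * Gamma (s / 2 + 1 / 2))"
    using s by (simp add: gaussian_mellin_0 add_divide_distrib)
  also have "Gamma (s / 2) * Gamma (s / 2 + 1 / 2) =
      exp ((1 - 2 * (s / 2)) * of_real (ln 2)) * of_real (sqrt pi) * Gamma (2 * (s / 2))"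
    using s by (intro Gamma_legendre_duplication not_nonpos_Ints_Re_pos) simp_all
  also have "2 * exp ((s / 2 - 1) * of_real (ln 2)) * exp (((s + 1) / 2 - 1) * of_real (ln 2))
       * (exp ((1 - 2 * (s / 2)) * of_real (ln 2)) * of_real (sqrt pi) * Gamma (2 * (s / 2)))
     = 2 * exp (- of_real (ln 2) / 2) * of_real (sqrt pi) * Gamma s"
    by (simp add: field_simps flip: exp_add)
  also have "2 * exp (- complex_of_real (ln 2) / 2) = of_real (2 * exp (- (ln 2 / 2)))"
    by (simp flip: exp_of_real)
  also have "2 * exp (- (ln 2 / 2)) = sqrt 2"
  proof -
    have "exp (ln 2 / 2) = sqrt 2" using powr_half_sqrt[of 2] by (simp add: powr_def)
    then show ?thesis by (simp add: exp_minus field_simps)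
  qed
  finally have "W 0 = - of_real (sqrt (2 * pi)) / Gamma s"
    using G0 by (simp add: power2_eq_square real_sqrt_mult)
  with c[of 0] c[of z] have Wz: "W z = - of_real (sqrt (2 * pi)) / Gamma s"
    by simp
  have "?h' z * ?h (- z) + ?h z * ?h' (- z) = exp (z\<^sup>2 / 2) * W z"
    by (simp add: W_def exp_minus)
  then show ?thesis unfolding Wz by simp
qed

text \<open>The weight e^(-x^2/2) absorbs the first-order term of the equation, so the weighted
  product k has derivative e^(-x^2/2) (|h'|^2 + Re s |h|^2) > 0. Since h and h' stay bounded at
  +\<infinity>, k tends to 0 there, and a strictly increasing function with limit 0 is
  negative.\<close>

lemma Re_hermite_fn'_cnj_neg:
  fixes x :: real
  assumes s: "0 < Re s"
  shows "Re (hermite_fn' s (of_real x) * cnj (hermite_fn s (of_real x))) < 0"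
proof -
  let ?h = "\<lambda>x::real. hermite_fn s (of_real x)" and ?h' = "\<lambda>x::real. hermite_fn' s (of_real x)"
  define k where "k x = exp (- x\<^sup>2 / 2) * Re (?h' x * cnj (?h x))" for x
  have dh: "(?h has_vector_derivative ?h' x) (at x)" for x
    using has_vector_derivative_real_field[OF hermite_fn_has_field_derivative[OF s]] by simp
  have dh': "(?h' has_vector_derivative of_real x * ?h' x + s * ?h x) (at x)" for x
    using has_vector_derivative_real_field[OF hermite_fn'_has_field_derivative[OF s]] by simp
  have dk: "(k has_real_derivative exp (- x\<^sup>2 / 2) * (norm (?h' x) ^ 2 + Re s * norm (?h x) ^ 2)) (at x)" for x
  proof -
    have "((\<lambda>x. ?h' x * cnj (?h x)) has_vector_derivative
        ?h' x * cnj (?h' x) + (of_real x * ?h' x + s * ?h x) * cnj (?h x)) (at x)"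
      by (intro has_vector_derivative_mult dh' bounded_linear.has_vector_derivative[OF bounded_linear_cnj dh])
    from bounded_linear.has_vector_derivative[OF bounded_linear_Re this]
    have "((\<lambda>x. Re (?h' x * cnj (?h x))) has_real_derivative
        Re (?h' x * cnj (?h' x) + (of_real x * ?h' x + s * ?h x) * cnj (?h x))) (at x)"
      by (simp add: has_real_derivative_iff_has_vector_derivative)
    note d2 = this
    have d1: "((\<lambda>x. exp (- x\<^sup>2 / 2)) has_real_derivative - x * exp (- x\<^sup>2 / 2)) (at x)"
      by (auto intro!: derivative_eq_intros)
    have "Re (?h' x * cnj (?h' x) + (of_real x * ?h' x + s * ?h x) * cnj (?h x))
        = norm (?h' x) ^ 2 + Re s * norm (?h x) ^ 2 + x * Re (?h' x * cnj (?h x))"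
      by (simp only: cmod_power2) (simp add: algebra_simps power2_eq_square)
    note eq = this
    show ?thesis unfolding k_def
      by (rule DERIV_cong[OF DERIV_mult[OF d1 d2]], unfold eq) (simp only: algebra_simps)
  qed
  have pos: "0 < exp (- x\<^sup>2 / 2) * (norm (?h' x) ^ 2 + Re s * norm (?h x) ^ 2)" for x
  proof -
    have "Gamma s \<noteq> 0" using not_nonpos_Ints_Re_pos[OF s] by (simp add: Gamma_eq_zero_iff)
    \<comment> \<open>h and h' cannot vanish together, since the Wronskian with the reflected
      solution would then be 0.\<close>
    then have "?h' x * hermite_fn s (- of_real x) + ?h x * hermite_fn' s (- of_real x) \<noteq> 0"
      using s by (subst hermite_fn_wronskian) auto
    then have "?h x \<noteq> 0 \<or> ?h' x \<noteq> 0" by auto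
    then have "0 < norm (?h' x) ^ 2 + Re s * norm (?h x) ^ 2"
      using s by (auto intro: add_pos_nonneg add_nonneg_pos)
    then show ?thesis by simp
  qed
  have mono: "k x < k y" if "x < y" for x y
    using DERIV_pos_imp_increasing[OF that, of k] dk pos by blast
  obtain C where C: "\<And>z. 0 \<le> Re z \<Longrightarrow> norm (hermite_fn s z) \<le> C"
    "\<And>z. 0 \<le> Re z \<Longrightarrow> norm (hermite_fn' s z) \<le> C"
    using hermite_fn_bounded[OF s, of 0] by blast
  have "(k \<longlongrightarrow> 0) at_top"
  proof (rule Lim_null_comparison)
    show "\<forall>\<^sub>F x in at_top. norm (k x) \<le> exp (- x\<^sup>2 / 2) * (C * C)"
      using eventually_ge_at_top[of 0]
    proof eventually_elim
      case (elim x)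
      have "\<bar>Re (?h' x * cnj (?h x))\<bar> \<le> norm (?h' x) * norm (?h x)"
        using abs_Re_le_cmod[of "?h' x * cnj (?h x)"] by (simp add: norm_mult)
      also have "\<dots> \<le> C * C" using C[of "of_real x"] elim
        by (intro mult_mono) (auto intro: order_trans[OF norm_ge_zero])
      finally show ?case by (simp add: k_def abs_mult)
    qed
    have "((\<lambda>x::real. exp (- x\<^sup>2 / 2)) \<longlongrightarrow> 0) at_top" by real_asymp
    then show "((\<lambda>x. exp (- x\<^sup>2 / 2) * (C * C)) \<longlongrightarrow> 0) at_top" by (rule tendsto_mult_left_zero)
  qed
  \<comment> \<open>The limit yields only a weak inequality; it is taken at x + 1, and strict
    monotonicity supplies the rest.\<close>
  then have "k (x + 1) \<le> 0"
  proof (rule tendsto_lowerbound)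
    show "\<forall>\<^sub>F y in at_top. k (x + 1) \<le> k y"
      using eventually_gt_at_top[of "x + 1"] by eventually_elim (auto intro: less_imp_le mono)
  qed simp
  with mono[of x "x + 1"] have "k x < 0" by simp
  then show ?thesis by (simp add: k_def mult_less_0_iff)
qed

section \<open>Link with the Bromwich integral\<close>

text \<open>With u = w + c + i x the exponent u^2/2 - w u becomes ((c + i x)^2 - w^2)/2. Choosing c
  = 1 - Re w puts u on the line Re u = 1, and what remains is the characteristic function of the
  standard normal law at c.\<close>

lemma gaussian_vertical_line:
  "(LINT s|lborel. pcf_integrand 0 w (Complex 1 s)) = of_real (sqrt (2 * pi)) * exp (- w\<^sup>2 / 2)"
proof -
  define c where "c = 1 - Re w"
  have char: "(LINT x|lborel. exp (- (of_real x)\<^sup>2 / 2) * exp (\<i> * of_real (c * x)))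
      = of_real (sqrt (2 * pi)) * exp (- (of_real c)\<^sup>2 / 2)"
  proof -
    have "char std_normal_distribution c = (LINT x|lborel. std_normal_density x *\<^sub>R exp (\<i> * of_real (c * x)))"
      unfolding char_def by (subst integral_density) (auto intro!: measurable_compose[OF _ borel_measurable_continuous_onI] continuous_intros)
    then have "(LINT x|lborel. std_normal_density x *\<^sub>R exp (\<i> * of_real (c * x))) = exp (- (of_real c)\<^sup>2 / 2)"
      by (simp add: char_std_normal_distribution flip: exp_of_real)
    then have "of_real (sqrt (2 * pi)) * (LINT x|lborel. std_normal_density x *\<^sub>R exp (\<i> * of_real (c * x)))
        = of_real (sqrt (2 * pi)) * exp (- (of_real c)\<^sup>2 / 2)" by simp
    moreover have "of_real (sqrt (2 * pi)) * (LINT x|lborel. std_normal_density x *\<^sub>R exp (\<i> * of_real (c * x)))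
        = (LINT x|lborel. of_real (sqrt (2 * pi)) * (std_normal_density x *\<^sub>R exp (\<i> * of_real (c * x))))"
      by (rule integral_mult_right_zero[symmetric])
    moreover have "of_real (sqrt (2 * pi)) * (std_normal_density x *\<^sub>R exp (\<i> * of_real (c * x)))
        = exp (- (of_real x)\<^sup>2 / 2) * exp (\<i> * of_real (c * x))" for x
      by (simp add: std_normal_density_def scaleR_conv_of_real flip: exp_of_real)
    ultimately show ?thesis by simp
  qed
  have eq: "pcf_integrand 0 w (Complex 1 (Im w + 1 * x)) =
      exp ((of_real c)\<^sup>2 / 2 - w\<^sup>2 / 2) * (exp (- (of_real x)\<^sup>2 / 2) * exp (\<i> * of_real (c * x)))" for x
  proof -
    define u where "u = Complex 1 (Im w + 1 * x)"
    have u: "u = w + (of_real c + \<i> * of_real x)"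
      by (simp add: u_def c_def complex_eq_iff)
    have "u \<noteq> 0" by (simp add: u_def complex_eq_iff)
    then have "pcf_integrand 0 w u = exp (- (w * u)) * exp (u\<^sup>2 / 2)"
      by (simp add: pcf_integrand_def)
    also have "\<dots> = exp (- (w * u) + u\<^sup>2 / 2)" by (rule exp_add[symmetric])
    also have "- (w * u) + u\<^sup>2 / 2 = ((of_real c)\<^sup>2 / 2 - w\<^sup>2 / 2) + (- (of_real x)\<^sup>2 / 2) + \<i> * of_real (c * x)"
      unfolding u by (simp add: power2_eq_square field_simps)
    finally show ?thesis by (simp only: u_def exp_add mult.assoc)
  qed
  have "(LINT s|lborel. pcf_integrand 0 w (Complex 1 s)) = (LINT s|lborel. pcf_integrand 0 w (Complex 1 (Im w + 1 * s)))"
    by (subst lborel_integral_real_affine[of 1 _ "Im w"]) simp_all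
  also have "\<dots> = exp ((of_real c)\<^sup>2 / 2 - w\<^sup>2 / 2) * (of_real (sqrt (2 * pi)) * exp (- (of_real c)\<^sup>2 / 2))"
    unfolding eq char[symmetric] by (rule integral_mult_right_zero)
  also have "\<dots> = of_real (sqrt (2 * pi)) * (exp ((of_real c)\<^sup>2 / 2 - w\<^sup>2 / 2) * exp (- (of_real c)\<^sup>2 / 2))"
    by (simp only: mult_ac)
  also have "exp ((of_real c)\<^sup>2 / 2 - w\<^sup>2 / 2) * exp (- (of_real c)\<^sup>2 / 2) = exp (- w\<^sup>2 / 2)"
    unfolding exp_add[symmetric] by (rule arg_cong[where f = exp]) (simp add: field_simps)
  finally show ?thesis .
qed

text \<open>
  Writing \<open>\<Gamma>(s) u\<^sup>-\<^sup>s\<close> as a Laplace integral turns the Bromwich integral into a Gaussian integral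
  along the vertical line.
\<close>

lemma bromwich_integral_pcf_gaussian_mellin:
  assumes s: "0 < Re s"
  shows "Gamma s * (LINT \<sigma>|lborel. pcf_integrand (- s) z (Complex 1 \<sigma>))
    = of_real (sqrt (2 * pi)) * exp (- z\<^sup>2 / 2) * gaussian_mellin s z"
proof -
  let ?u = "\<lambda>\<sigma>. Complex 1 \<sigma>"
  define A where "A t = indicator {0<..} t *\<^sub>R (complex_of_real t powr (s - 1) * exp (- (1 * of_real t)))" for t
  define B where "B \<sigma> = pcf_integrand 0 z (?u \<sigma>)" for \<sigma>
  define f where "f \<sigma> t = A t * exp (- (\<i> * of_real \<sigma> * of_real t)) * B \<sigma>" for \<sigma> t
  have A: "integrable lborel A"
    using integral_powr_exp(1)[OF s, of 1] unfolding A_def set_integrable_def by simp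
  have B: "integrable lborel B"
    unfolding B_def by (rule pcf_integrand_integrable) simp
  have [measurable]: "A \<in> borel_measurable borel" "B \<in> borel_measurable borel"
    using A B by (auto dest: borel_measurable_integrable)
  \<comment> \<open>On the line Re u = 1 the kernel e^(-u t) has modulus e^(-t) for every \<sigma>,
    so |f| is a product and Fubini reduces to the integrability of A and B separately.\<close>
  have nf: "norm (f \<sigma> t) = norm (A t) * norm (B \<sigma>)" for \<sigma> t
    by (simp add: f_def norm_mult norm_exp_eq_Re)
  have "integrable (lborel \<Otimes>\<^sub>M lborel) (case_prod f)"
  proof (rule lborel_pair.Fubini_integrable)
    show fm: "case_prod f \<in> borel_measurable (lborel \<Otimes>\<^sub>M lborel)"
      unfolding f_def by measurable
    show "integrable lborel (\<lambda>\<sigma>. LINT t|lborel. norm (case_prod f (\<sigma>, t)))"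
      using A B by (simp add: nf)
    show "AE \<sigma> in lborel. integrable lborel (\<lambda>t. case_prod f (\<sigma>, t))"
    proof (rule AE_I2)
      fix \<sigma> :: real
      have "(\<lambda>t. f \<sigma> t) \<in> borel_measurable lborel" unfolding f_def by measurable
      then show "integrable lborel (\<lambda>t. case_prod f (\<sigma>, t))"
        using A by (intro Bochner_Integration.integrable_bound[OF integrable_mult_left[OF integrable_norm[OF A], of "norm (B \<sigma>)"]])
          (auto simp: nf)
    qed
  qed
  note fub = lborel_pair.Fubini_integral[OF this]
  have "Gamma s * (LINT \<sigma>|lborel. pcf_integrand (- s) z (?u \<sigma>)) = (LINT \<sigma>|lborel. (LINT t|lborel. f \<sigma> t))"
    unfolding integral_mult_right_zero[symmetric]
  proof (rule Bochner_Integration.integral_cong[OF refl])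
    fix \<sigma> :: real
    have nz: "?u \<sigma> \<noteq> 0" by (simp add: complex_eq_iff)
    have "Gamma s * pcf_integrand (- s) z (?u \<sigma>) = Gamma s * ?u \<sigma> powr (- s) * B \<sigma>"
      using nz by (simp add: pcf_integrand_def B_def)
    also have "\<dots> = (LINT t:{0<..}|lborel. of_real t powr (s - 1) * exp (- (?u \<sigma> * of_real t))) * B \<sigma>"
      using s by (subst integral_powr_exp(2)) simp_all
    also have "\<dots> = (LINT t|lborel. f \<sigma> t)"
      unfolding set_lebesgue_integral_def integral_mult_left_zero[symmetric]
    proof (rule Bochner_Integration.integral_cong[OF refl])
      fix t :: real
      have "exp (- (?u \<sigma> * of_real t)) = exp (- (1 * of_real t)) * exp (- (\<i> * of_real \<sigma> * of_real t))"
        by (simp add: Complex_eq algebra_simps flip: exp_add)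
      then show "(indicator {0<..} t *\<^sub>R (of_real t powr (s - 1) * exp (- (?u \<sigma> * of_real t)))) * B \<sigma> = f \<sigma> t"
        by (simp add: f_def A_def)
    qed
    finally show "Gamma s * pcf_integrand (- s) z (?u \<sigma>) = (LINT t|lborel. f \<sigma> t)" .
  qed
  also have "\<dots> = (LINT t|lborel. (LINT \<sigma>|lborel. f \<sigma> t))" by (rule fub[symmetric])
  also have "\<dots> = (LINT t|lborel. (of_real (sqrt (2 * pi)) * exp (- z\<^sup>2 / 2)) *
      (indicator {0<..} t *\<^sub>R (of_real t powr (s - 1) * exp (- (of_real t)\<^sup>2 / 2) * exp (- (z * of_real t)))))"
  proof (rule Bochner_Integration.integral_cong[OF refl])
    fix t :: real
    \<comment> \<open>The factor e^(-u t) shifts z to z + t in the Gaussian integrand, so the inner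
      integral is \<open>gaussian_vertical_line\<close> at z + t.\<close>
    have "f \<sigma> t = indicator {0<..} t *\<^sub>R (of_real t powr (s - 1)) * pcf_integrand 0 (z + of_real t) (?u \<sigma>)" for \<sigma>
    proof -
      have "exp (- (1 * of_real t)) * exp (- (\<i> * of_real \<sigma> * of_real t)) * B \<sigma> = pcf_integrand 0 (z + of_real t) (?u \<sigma>)"
        by (simp add: B_def pcf_integrand_def Complex_eq algebra_simps flip: exp_add)
      then show ?thesis by (simp add: f_def A_def mult.assoc)
    qed
    then have "(LINT \<sigma>|lborel. f \<sigma> t) = indicator {0<..} t *\<^sub>R (of_real t powr (s - 1)) *
       (of_real (sqrt (2 * pi)) * exp (- (z + of_real t)\<^sup>2 / 2))"
      by (simp only: integral_mult_right_zero gaussian_vertical_line)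
    also have "exp (- (z + of_real t)\<^sup>2 / 2) = exp (- z\<^sup>2 / 2) * (exp (- (of_real t)\<^sup>2 / 2) * exp (- (z * of_real t)))"
    proof -
      have "- (z + of_real t)\<^sup>2 / 2 = - z\<^sup>2 / 2 + (- (of_real t)\<^sup>2 / 2 + - (z * of_real t))"
        by (simp add: power2_eq_square field_simps)
      then show ?thesis by (simp only: exp_add)
    qed
    finally show "(LINT \<sigma>|lborel. f \<sigma> t) = (of_real (sqrt (2 * pi)) * exp (- z\<^sup>2 / 2)) *
      (indicator {0<..} t *\<^sub>R (of_real t powr (s - 1) * exp (- (of_real t)\<^sup>2 / 2) * exp (- (z * of_real t))))"
      by (simp add: scaleR_conv_of_real mult_ac)
  qed
  also have "\<dots> = (of_real (sqrt (2 * pi)) * exp (- z\<^sup>2 / 2)) * gaussian_mellin s z"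
    unfolding gaussian_mellin_def set_lebesgue_integral_def by (rule integral_mult_right_zero)
  finally show ?thesis .
qed

lemma parabolic_cylinder_eq_hermite_fn:
  assumes s: "0 < Re s"
  shows "parabolic_cylinder (- s) z = exp (- z\<^sup>2 / 4) * hermite_fn s z"
proof -
  have G: "Gamma s \<noteq> 0" using not_nonpos_Ints_Re_pos[OF s] by (simp add: Gamma_eq_zero_iff)
  have "(LINT \<sigma>|lborel. pcf_integrand (- s) z (Complex 1 \<sigma>)) =
     of_real (sqrt (2 * pi)) * exp (- z\<^sup>2 / 2) * hermite_fn s z"
    using bromwich_integral_pcf_gaussian_mellin[OF s, of z] G by (simp add: hermite_fn_def field_simps)
  then have "parabolic_cylinder (- s) z = exp (z\<^sup>2 / 4) * exp (- z\<^sup>2 / 2) * hermite_fn s z"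
    by (simp add: parabolic_cylinder_def bromwich_integral_def del: real_sqrt_mult)
  also have "exp (z\<^sup>2 / 4) * exp (- z\<^sup>2 / 2) = exp (- z\<^sup>2 / 4)"
    by (simp flip: exp_add)
  finally show ?thesis .
qed

lemma parabolic_cylinder'_eq_hermite_fn:
  assumes s: "0 < Re s"
  shows "parabolic_cylinder' (- s) z = exp (- z\<^sup>2 / 4) * (hermite_fn' s z - z / 2 * hermite_fn s z)"
proof -
  have "parabolic_cylinder (- s) = (\<lambda>z. exp (- z\<^sup>2 / 4) * hermite_fn s z)"
    using parabolic_cylinder_eq_hermite_fn[OF s] by auto
  moreover have "((\<lambda>z. exp (- z\<^sup>2 / 4) * hermite_fn s z) has_field_derivative
      exp (- z\<^sup>2 / 4) * (hermite_fn' s z - z / 2 * hermite_fn s z)) (at z)"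
    by (auto intro!: derivative_eq_intros hermite_fn_has_field_derivative[OF s] simp: algebra_simps)
  ultimately show ?thesis
    unfolding parabolic_cylinder'_def by (simp add: DERIV_imp_deriv)
qed

section \<open>Green's identity for the resolvent equation\<close>

lemma has_vector_derivative_imp_continuous_on:
  "(\<And>x. (f has_vector_derivative f' x) (at x)) \<Longrightarrow> continuous_on UNIV f"
  by (intro continuous_at_imp_continuous_on ballI has_vector_derivative_continuous)

lemma has_vector_derivative_reflect:
  fixes f :: "real \<Rightarrow> 'a :: real_normed_vector"
  assumes "(f has_vector_derivative f') (at (- y))"
  shows "((\<lambda>y. f (- y)) has_vector_derivative - f') (at y)"
  using vector_diff_chain_at[of uminus "-1" y f f'] assms
  by (simp add: o_def has_vector_derivative_minus has_vector_derivative_id)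

text \<open>The equation is split through the flux F = P' - a P, so that the kink of the drift shows
  up only as a missing derivative of F at 0. Leaving a arbitrary with linear growth makes the class
  stable under y \<mapsto> -y.\<close>

locale forced_equation =
  fixes a :: "real \<Rightarrow> real" and C :: real and \<theta> :: complex and P F r :: "real \<Rightarrow> complex"
  assumes a_cont: "continuous_on UNIV a"
    and a_le: "\<bar>a y\<bar> \<le> C * (1 + \<bar>y\<bar>)"
    and P_deriv: "(P has_vector_derivative F y + of_real (a y) * P y) (at y)"
    and F_deriv: "y \<noteq> 0 \<Longrightarrow> (F has_vector_derivative \<theta> * P y + r y) (at y)"
    and F_cont: "continuous_on UNIV F"
    and r_cont: "continuous_on UNIV r"
    and P_int: "integrable lborel P"
    and r_int: "integrable lborel r"
begin

lemma P_cont: "continuous_on UNIV P"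
  by (rule has_vector_derivative_imp_continuous_on[OF P_deriv])

text \<open>
  No growth bound on \<open>F\<close> is available, so the boundary term at infinity is removed with the
  cutoff \<open>(1 - y\<^sup>2 / R\<^sup>2)\<^sup>2\<close>, whose derivatives vanish fast enough to compensate the linear
  growth of \<open>a\<close>.
\<close>

lemma integral_right:
  fixes u v :: "real \<Rightarrow> complex"
  assumes u: "\<And>y. (u has_vector_derivative v y) (at y)"
    and v: "\<And>y. (v has_vector_derivative \<theta> * u y - of_real (a y) * v y) (at y)"
    and bu: "\<And>y. x \<le> y \<Longrightarrow> norm (u y) \<le> M" and bv: "\<And>y. x \<le> y \<Longrightarrow> norm (v y) \<le> M"
  shows "(LINT y:{x..}|lborel. u y * r y) = v x * P x - u x * F x"
proof -
  define c0 :: "real \<Rightarrow> real \<Rightarrow> real" where "c0 R y = (1 - y\<^sup>2 / R\<^sup>2)\<^sup>2" for R y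
  define c1 :: "real \<Rightarrow> real \<Rightarrow> real" where "c1 R y = - (4 * y / R\<^sup>2) * (1 - y\<^sup>2 / R\<^sup>2)" for R y
  define c2 :: "real \<Rightarrow> real \<Rightarrow> real" where "c2 R y = - (4 / R\<^sup>2) + 12 * y\<^sup>2 / (R\<^sup>2)\<^sup>2" for R y
  \<comment> \<open>For the cut-off solution w = \<open>c0 R\<close> u, \<psi> is w'' + a w' -
    \<theta> w, the error that the cutoff causes in the adjoint equation. B is the boundary form w F
    - w' P, and b is its derivative.\<close>
  define \<psi> where "\<psi> R y = 2 * v y * of_real (c1 R y) + u y * of_real (c2 R y) + of_real (a y) * u y * of_real (c1 R y)" for R y
  define B where "B R y = of_real (c0 R y) * (u y * F y - v y * P y) - u y * of_real (c1 R y) * P y" for R y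
  define b where "b R y = of_real (c0 R y) * (u y * r y) - \<psi> R y * P y" for R y
  have cu: "continuous_on UNIV u" and cv: "continuous_on UNIV v"
    by (rule has_vector_derivative_imp_continuous_on[OF u] has_vector_derivative_imp_continuous_on[OF v])+
  have M0: "0 \<le> M" using bu[of x] norm_ge_zero[of "u x"] by linarith
  have C0: "0 \<le> C" using a_le[of 0] by simp
  have dc0: "((\<lambda>y. of_real (c0 R y)) has_vector_derivative complex_of_real (c1 R y)) (at y)" for R y
  proof -
    have "((\<lambda>y. c0 R y) has_real_derivative c1 R y) (at y)"
      unfolding c0_def c1_def by (cases "R = 0") (auto intro!: derivative_eq_intros simp: field_simps)
    then show ?thesis
      by (simp add: has_vector_derivative_of_real has_real_derivative_iff_has_vector_derivative)
  qed
  have dc1: "((\<lambda>y. of_real (c1 R y)) has_vector_derivative complex_of_real (c2 R y)) (at y)" for R y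
  proof -
    have "((\<lambda>y. c1 R y) has_real_derivative c2 R y) (at y)"
      unfolding c1_def c2_def
      by (cases "R = 0") (auto intro!: derivative_eq_intros simp: field_simps power2_eq_square)
    then show ?thesis
      by (simp add: has_vector_derivative_of_real has_real_derivative_iff_has_vector_derivative)
  qed
  have cc: "continuous_on UNIV (c0 R)" "continuous_on UNIV (c1 R)" "continuous_on UNIV (c2 R)" for R
    unfolding c0_def[abs_def] c1_def[abs_def] c2_def[abs_def]
    by (cases "R = 0"; auto intro!: continuous_intros)+
  have cc': "continuous_on UNIV (\<lambda>y. complex_of_real (c0 R y))" "continuous_on UNIV (\<lambda>y. complex_of_real (c1 R y))"
    "continuous_on UNIV (\<lambda>y. complex_of_real (c2 R y))" "continuous_on UNIV (\<lambda>y. complex_of_real (a y))" for R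
    by (intro continuous_on_of_real cc a_cont)+
  have b_cont: "continuous_on UNIV (b R)" for R
    unfolding b_def \<psi>_def by (intro continuous_intros cc' cu cv P_cont r_cont)
  have B_cont: "continuous_on UNIV (B R)" for R
    unfolding B_def by (intro continuous_intros cc' cu cv P_cont F_cont)
  have B_deriv: "(B R has_vector_derivative b R y) (at y)" if "y \<noteq> 0" for R y
  proof -
    have "(B R has_vector_derivative
        (of_real (c0 R y) * ((u y * (\<theta> * P y + r y) + v y * F y)
           - (v y * (F y + of_real (a y) * P y) + (\<theta> * u y - of_real (a y) * v y) * P y))
         + of_real (c1 R y) * (u y * F y - v y * P y))
        - (u y * of_real (c1 R y) * (F y + of_real (a y) * P y)
           + (u y * of_real (c2 R y) + v y * of_real (c1 R y)) * P y)) (at y)"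
      unfolding B_def
      by (intro has_vector_derivative_diff has_vector_derivative_mult dc0 dc1 u v P_deriv F_deriv that)
    also have "(of_real (c0 R y) * ((u y * (\<theta> * P y + r y) + v y * F y)
           - (v y * (F y + of_real (a y) * P y) + (\<theta> * u y - of_real (a y) * v y) * P y))
         + of_real (c1 R y) * (u y * F y - v y * P y))
        - (u y * of_real (c1 R y) * (F y + of_real (a y) * P y)
           + (u y * of_real (c2 R y) + v y * of_real (c1 R y)) * P y) = b R y"
      unfolding b_def \<psi>_def by (simp add: algebra_simps)
    finally show ?thesis .
  qed
  \<comment> \<open>The summand |x| + 1 keeps the interval from x to \<open>\<rho> n\<close> inside
    |y| \<le> \<open>\<rho> n\<close>, where the cutoff is at most 1, and keeps the radius at least
    1.\<close>
  define \<rho> where "\<rho> n = real n + (\<bar>x\<bar> + 1)" for n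
  have \<rho>: "x \<le> \<rho> n" "\<bar>x\<bar> \<le> \<rho> n" "1 \<le> \<rho> n" for n by (auto simp: \<rho>_def)
  have \<rho>_lim: "filterlim \<rho> at_top sequentially" unfolding \<rho>_def by real_asymp
  define s where "s n y = indicator {x..\<rho> n} y *\<^sub>R b (\<rho> n) y" for n y
  \<comment> \<open>The square in the cutoff makes both \<open>c0 R\<close> and its derivative
    vanish at R.\<close>
  have B_end: "B R R = 0" if "R \<noteq> 0" for R
    using that by (simp add: B_def c0_def c1_def)
  have s_int: "integrable lborel (s n)" for n
    using borel_integrable_atLeastAtMost'[OF continuous_on_subset[OF b_cont], of x "\<rho> n" "\<rho> n"]
    unfolding s_def set_integrable_def by simp
  have s_val: "integral\<^sup>L lborel (s n) = - B (\<rho> n) x" for n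
  proof -
    \<comment> \<open>The derivative of F is not provided at 0, so 0 is an exceptional point;
      continuity of B suffices there.\<close>
    have "(b (\<rho> n) has_integral B (\<rho> n) (\<rho> n) - B (\<rho> n) x) {x..\<rho> n}"
      using \<rho>[of n] B_deriv continuous_on_subset[OF B_cont]
      by (intro fundamental_theorem_of_calculus_interior_strong[of "{0}"]) auto
    moreover have "integral\<^sup>L lborel (s n) = integral {x..\<rho> n} (b (\<rho> n))"
      using set_borel_integral_eq_integral(2)[OF borel_integrable_atLeastAtMost'[OF continuous_on_subset[OF b_cont]], of x "\<rho> n" "\<rho> n"]
      by (simp add: s_def[abs_def] set_lebesgue_integral_def)
    ultimately show ?thesis using B_end[of "\<rho> n"] \<rho>[of n] by (simp add: integral_unique)
  qed
  have lim0: "((\<lambda>R. c0 R y) \<longlongrightarrow> 1) at_top" "((\<lambda>R. c1 R y) \<longlongrightarrow> 0) at_top" "((\<lambda>R. c2 R y) \<longlongrightarrow> 0) at_top" for y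
    unfolding c0_def c1_def c2_def by real_asymp+
  note lim = lim0[THEN filterlim_compose[OF _ \<rho>_lim], THEN tendsto_of_real, where 'a = complex, unfolded of_real_0 of_real_1]
  have B_lim: "(\<lambda>n. - B (\<rho> n) x) \<longlonglongrightarrow> - (1 * (u x * F x - v x * P x) - u x * 0 * P x)"
    unfolding B_def by (intro tendsto_intros lim)
  have "(\<lambda>n. integral\<^sup>L lborel (s n)) \<longlonglongrightarrow> (LINT y|lborel. indicator {x..} y *\<^sub>R (u y * r y))"
  proof (rule integral_dominated_convergence)
    show "(\<lambda>y. indicator {x..} y *\<^sub>R (u y * r y)) \<in> borel_measurable lborel"
      using borel_measurable_continuous_onI[OF cu] borel_measurable_continuous_onI[OF r_cont] by simp
    show "s n \<in> borel_measurable lborel" for n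
      using s_int by (rule borel_measurable_integrable)
    \<comment> \<open>The three constants bound the summands of \<psi> uniformly in the radius: |c1|
      \<le> 4 for 2 v c1, |c2| \<le> 16 for u c2, and (1 + |y|) |c1| \<le> 8 for a u c1.\<close>
    show "integrable lborel (\<lambda>y. M * norm (r y) + (8 * M + 16 * M + 8 * (C * M)) * norm (P y))"
      using r_int P_int by simp
    show "AE y in lborel. (\<lambda>n. s n y) \<longlonglongrightarrow> indicator {x..} y *\<^sub>R (u y * r y)"
    proof (rule AE_I2)
      fix y
      have "(\<lambda>n. b (\<rho> n) y) \<longlonglongrightarrow> 1 * (u y * r y) - (2 * v y * 0 + u y * 0 + of_real (a y) * u y * 0) * P y"
        unfolding b_def \<psi>_def by (intro tendsto_intros lim)
      then have "(\<lambda>n. indicator {x..} y *\<^sub>R b (\<rho> n) y) \<longlonglongrightarrow> indicator {x..} y *\<^sub>R (u y * r y)"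
        by (intro tendsto_intros) simp
      moreover have "\<forall>\<^sub>F n in sequentially. indicator {x..} y *\<^sub>R b (\<rho> n) y = s n y"
        using eventually_compose_filterlim[OF eventually_ge_at_top[of y] \<rho>_lim]
        by eventually_elim (simp add: s_def indicator_def)
      ultimately show "(\<lambda>n. s n y) \<longlonglongrightarrow> indicator {x..} y *\<^sub>R (u y * r y)"
        by (rule Lim_transform_eventually)
    qed
    show "AE y in lborel. norm (s n y) \<le> M * norm (r y) + (8 * M + 16 * M + 8 * (C * M)) * norm (P y)" for n
    proof (rule AE_I2)
      fix y
      show "norm (s n y) \<le> M * norm (r y) + (8 * M + 16 * M + 8 * (C * M)) * norm (P y)"
      proof (cases "x \<le> y \<and> y \<le> \<rho> n")
        case False
        then show ?thesis using M0 C0 by (auto simp: s_def indicator_def)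
      next
        case True
        define R where "R = \<rho> n"
        have R: "1 \<le> R" and yR: "\<bar>y\<bar> \<le> R" and xy: "x \<le> y" and R1: "1 \<le> R\<^sup>2"
          using True \<rho>[of n] by (auto simp: R_def)
        have "y\<^sup>2 \<le> R\<^sup>2" using yR power_mono[of "\<bar>y\<bar>" R 2] by simp
        then have q: "0 \<le> y\<^sup>2 / R\<^sup>2" "y\<^sup>2 / R\<^sup>2 \<le> 1" using R by (auto simp: divide_le_eq_1)
        have n0: "\<bar>c0 R y\<bar> \<le> 1"
          using q by (auto simp: c0_def intro: power_le_one)
        have n1: "\<bar>c1 R y\<bar> \<le> 4 * \<bar>y\<bar> / R\<^sup>2"
        proof -
          have "\<bar>c1 R y\<bar> = 4 * \<bar>y\<bar> / R\<^sup>2 * (1 - y\<^sup>2 / R\<^sup>2)"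
            using q by (simp add: c1_def abs_mult)
          also have "\<dots> \<le> 4 * \<bar>y\<bar> / R\<^sup>2 * 1" using q by (intro mult_left_mono) auto
          finally show ?thesis by simp
        qed
        have "R \<le> R\<^sup>2" using R self_le_power[of R 2] by simp
        then have y1: "\<bar>y\<bar> / R\<^sup>2 \<le> 1" using yR R by (simp add: divide_le_eq_1)
        have n1': "\<bar>c1 R y\<bar> \<le> 4" using n1 y1 by simp
        have "(1 + \<bar>y\<bar>) * \<bar>c1 R y\<bar> = \<bar>c1 R y\<bar> + \<bar>y\<bar> * \<bar>c1 R y\<bar>" by (simp add: algebra_simps)
        also have "\<bar>y\<bar> * \<bar>c1 R y\<bar> \<le> \<bar>y\<bar> * (4 * \<bar>y\<bar> / R\<^sup>2)" using n1 by (intro mult_left_mono) auto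
        also have "\<bar>y\<bar> * (4 * \<bar>y\<bar> / R\<^sup>2) = 4 * (y\<^sup>2 / R\<^sup>2)" by (simp add: power2_eq_square)
        finally have n1'': "(1 + \<bar>y\<bar>) * \<bar>c1 R y\<bar> \<le> 8" using n1' q by linarith
        have "c2 R y = (12 * (y\<^sup>2 / R\<^sup>2) - 4) / R\<^sup>2"
          using R by (simp add: c2_def field_simps power2_eq_square)
        then have "\<bar>c2 R y\<bar> = \<bar>12 * (y\<^sup>2 / R\<^sup>2) - 4\<bar> / R\<^sup>2" by simp
        also have "\<dots> \<le> 16 / 1"
        proof (rule frac_le)
          show "\<bar>12 * (y\<^sup>2 / R\<^sup>2) - 4\<bar> \<le> 16" using q by linarith
        qed (use R1 in auto)
        finally have n2: "\<bar>c2 R y\<bar> \<le> 16" by simp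
        have "norm (of_real (a y) * u y * of_real (c1 R y)) = \<bar>a y\<bar> * \<bar>c1 R y\<bar> * norm (u y)"
          by (simp add: norm_mult)
        also have "\<dots> \<le> (C * (1 + \<bar>y\<bar>)) * \<bar>c1 R y\<bar> * M"
          using a_le[of y] bu[OF xy] C0 M0 by (intro mult_mono) auto
        also have "\<dots> = C * M * ((1 + \<bar>y\<bar>) * \<bar>c1 R y\<bar>)" by simp
        also have "\<dots> \<le> C * M * 8" using n1'' C0 M0 by (intro mult_left_mono) auto
        finally have t3: "norm (of_real (a y) * u y * of_real (c1 R y)) \<le> 8 * (C * M)" by simp
        have "norm (2 * v y * of_real (c1 R y)) = 2 * norm (v y) * \<bar>c1 R y\<bar>" by (simp add: norm_mult)
        also have "\<dots> \<le> 2 * M * 4" using bv[OF xy] n1' M0 by (intro mult_mono) auto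
        finally have t1: "norm (2 * v y * of_real (c1 R y)) \<le> 8 * M" by simp
        have "norm (u y * of_real (c2 R y)) = norm (u y) * \<bar>c2 R y\<bar>" by (simp add: norm_mult)
        also have "\<dots> \<le> M * 16" using bu[OF xy] n2 M0 by (intro mult_mono) auto
        finally have t2: "norm (u y * of_real (c2 R y)) \<le> 16 * M" by simp
        have t: "norm (\<psi> R y) \<le> 8 * M + 16 * M + 8 * (C * M)"
          unfolding \<psi>_def by (intro norm_triangle_mono t1 t2 t3)
        have "norm (of_real (c0 R y) * (u y * r y)) = \<bar>c0 R y\<bar> * (norm (u y) * norm (r y))" by (simp add: norm_mult)
        also have "\<dots> \<le> 1 * (M * norm (r y))"
          using n0 bu[OF xy] M0 by (intro mult_mono) auto
        finally have t0: "norm (of_real (c0 R y) * (u y * r y)) \<le> M * norm (r y)" by simp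
        have "norm (\<psi> R y * P y) \<le> (8 * M + 16 * M + 8 * (C * M)) * norm (P y)"
          unfolding norm_mult using t by (rule mult_right_mono) simp
        from order_trans[OF norm_triangle_ineq4 add_mono[OF t0 this]]
        have "norm (b R y) \<le> M * norm (r y) + (8 * M + 16 * M + 8 * (C * M)) * norm (P y)"
          unfolding b_def .
        then show ?thesis using True by (simp add: s_def R_def)
      qed
    qed
  qed
  moreover have "(\<lambda>n. integral\<^sup>L lborel (s n)) \<longlonglongrightarrow> v x * P x - u x * F x"
    using B_lim by (simp add: s_val)
  ultimately show ?thesis
    unfolding set_lebesgue_integral_def by (rule LIMSEQ_unique)
qed

text \<open>Under y \<mapsto> -y the drift becomes -a(-y) and the flux changes sign. Left half lines
  are thereby reduced to right ones.\<close>

lemma reflect: "forced_equation (\<lambda>y. - a (- y)) C \<theta> (\<lambda>y. P (- y)) (\<lambda>y. - F (- y)) (\<lambda>y. r (- y))"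
proof
  have cm: "continuous_on UNIV (\<lambda>y. f (- y))" if "continuous_on UNIV f" for f :: "real \<Rightarrow> 'x :: topological_space"
    by (rule continuous_on_compose2[OF that]) (auto intro!: continuous_intros)
  show "continuous_on UNIV (\<lambda>y. - a (- y))" "continuous_on UNIV (\<lambda>y. - F (- y))" "continuous_on UNIV (\<lambda>y. r (- y))"
    by (intro continuous_on_minus cm a_cont F_cont r_cont)+
  show "\<bar>- a (- y)\<bar> \<le> C * (1 + \<bar>y\<bar>)" for y using a_le[of "- y"] by simp
  show "((\<lambda>y. P (- y)) has_vector_derivative - F (- y) + of_real (- a (- y)) * P (- y)) (at y)" for y
    using has_vector_derivative_reflect[OF P_deriv] by simp
  show "((\<lambda>y. - F (- y)) has_vector_derivative \<theta> * P (- y) + r (- y)) (at y)" if "y \<noteq> 0" for y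
  proof -
    have "((\<lambda>y. - F (- y)) has_vector_derivative - (- (\<theta> * P (- y) + r (- y)))) (at y)"
      using that by (intro has_vector_derivative_minus has_vector_derivative_reflect F_deriv) simp
    then show ?thesis by (simp only: minus_minus)
  qed
  show "integrable lborel (\<lambda>y. P (- y))" "integrable lborel (\<lambda>y. r (- y))"
    using lborel_integrable_real_affine[OF P_int, of "-1" 0] lborel_integrable_real_affine[OF r_int, of "-1" 0] by simp_all
qed

lemma integral_left:
  fixes u v :: "real \<Rightarrow> complex"
  assumes u: "\<And>y. (u has_vector_derivative v y) (at y)"
    and v: "\<And>y. (v has_vector_derivative \<theta> * u y - of_real (a y) * v y) (at y)"
    and bu: "\<And>y. y \<le> x \<Longrightarrow> norm (u y) \<le> M" and bv: "\<And>y. y \<le> x \<Longrightarrow> norm (v y) \<le> M"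
  shows "(LINT y:{..x}|lborel. u y * r y) = u x * F x - v x * P x"
proof -
  interpret rf: forced_equation "\<lambda>y. - a (- y)" C \<theta> "\<lambda>y. P (- y)" "\<lambda>y. - F (- y)" "\<lambda>y. r (- y)"
    by (rule reflect)
  have "(LINT y:{..x}|lborel. u y * r y) = (LINT y:{- x..}|lborel. u (- y) * r (- y))"
    unfolding set_lebesgue_integral_def
    by (subst lborel_integral_real_affine[of "-1" _ 0]) (auto intro!: Bochner_Integration.integral_cong simp: indicator_def)
  also have "\<dots> = - v (- (- x)) * P (- (- x)) - u (- (- x)) * - F (- (- x))"
  proof (rule rf.integral_right)
    show "((\<lambda>y. u (- y)) has_vector_derivative - v (- y)) (at y)" for y by (rule has_vector_derivative_reflect[OF u])
    show "((\<lambda>y. - v (- y)) has_vector_derivative \<theta> * u (- y) - of_real (- a (- y)) * - v (- y)) (at y)" for y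
      using has_vector_derivative_minus[OF has_vector_derivative_reflect[OF v]] by simp
    show "norm (u (- y)) \<le> M" "norm (- v (- y)) \<le> M" if "- x \<le> y" for y
      using bu[of "- y"] bv[of "- y"] that by simp_all
  qed
  finally show ?thesis by simp
qed

text \<open>The left integral is weighted by u2(x) and the right one by u1(x); the two terms
  containing F(x) then cancel, and a multiple of P(x) remains.\<close>

lemma green_identity:
  fixes u1 v1 u2 v2 :: "real \<Rightarrow> complex"
  assumes u1: "\<And>y. (u1 has_vector_derivative v1 y) (at y)"
    and v1: "\<And>y. (v1 has_vector_derivative \<theta> * u1 y - of_real (a y) * v1 y) (at y)"
    and b1: "\<And>y. y \<le> x \<Longrightarrow> norm (u1 y) \<le> M1" "\<And>y. y \<le> x \<Longrightarrow> norm (v1 y) \<le> M1"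
    and u2: "\<And>y. (u2 has_vector_derivative v2 y) (at y)"
    and v2: "\<And>y. (v2 has_vector_derivative \<theta> * u2 y - of_real (a y) * v2 y) (at y)"
    and b2: "\<And>y. x \<le> y \<Longrightarrow> norm (u2 y) \<le> M2" "\<And>y. x \<le> y \<Longrightarrow> norm (v2 y) \<le> M2"
  shows "(LINT y|lborel. u1 (min x y) * u2 (max x y) * r y) = (u1 x * v2 x - v1 x * u2 x) * P x"
proof -
  have int: "set_integrable lborel S (\<lambda>y. u y * r y)"
    if S: "S \<in> sets lborel" and cont: "continuous_on UNIV u" and b: "\<And>y. y \<in> S \<Longrightarrow> norm (u y) \<le> M"
    for S u M
    unfolding set_integrable_def
  proof (rule Bochner_Integration.integrable_bound)
    show "integrable lborel (\<lambda>y. M * norm (r y))" using r_int by simp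
    show "(\<lambda>y. indicator S y *\<^sub>R (u y * r y)) \<in> borel_measurable lborel"
      using S borel_measurable_continuous_onI[OF cont] borel_measurable_continuous_onI[OF r_cont] by simp
    show "AE y in lborel. norm (indicator S y *\<^sub>R (u y * r y)) \<le> norm (M * norm (r y))"
      by (intro AE_I2) (auto simp: indicator_def norm_mult abs_mult intro!: mult_right_mono order_trans[OF b abs_ge_self])
  qed
  have c1: "continuous_on UNIV u1" and c2: "continuous_on UNIV u2"
    by (rule has_vector_derivative_imp_continuous_on[OF u1] has_vector_derivative_imp_continuous_on[OF u2])+
  have i1: "set_integrable lborel {..x} (\<lambda>y. u1 y * r y)" and i2: "set_integrable lborel {x..} (\<lambda>y. u2 y * r y)"
    using b1(1) b2(1) by (auto intro!: int c1 c2)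
  have "(LINT y|lborel. u1 (min x y) * u2 (max x y) * r y) =
    (LINT y|lborel. u2 x * (indicator {..x} y *\<^sub>R (u1 y * r y)) + u1 x * (indicator {x..} y *\<^sub>R (u2 y * r y)))"
  \<comment> \<open>The two half lines share the point x, where the sum counts the integrand
    twice.\<close>
  proof (rule integral_cong_AE)
    show "AE y in lborel. u1 (min x y) * u2 (max x y) * r y =
      u2 x * (indicator {..x} y *\<^sub>R (u1 y * r y)) + u1 x * (indicator {x..} y *\<^sub>R (u2 y * r y))"
      using AE_lborel_singleton[of x] by eventually_elim (auto simp: indicator_def min_def max_def)
    have "continuous_on UNIV (\<lambda>y. u1 (min x y))" "continuous_on UNIV (\<lambda>y. u2 (max x y))"
      by (rule continuous_on_compose2[OF c1] continuous_on_compose2[OF c2]; auto intro!: continuous_intros)+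
    from this[THEN borel_measurable_continuous_onI] borel_measurable_continuous_onI[OF r_cont]
    show "(\<lambda>y. u1 (min x y) * u2 (max x y) * r y) \<in> borel_measurable lborel" by simp
    show "(\<lambda>y. u2 x * (indicator {..x} y *\<^sub>R (u1 y * r y)) + u1 x * (indicator {x..} y *\<^sub>R (u2 y * r y))) \<in> borel_measurable lborel"
      using c1[THEN borel_measurable_continuous_onI] c2[THEN borel_measurable_continuous_onI]
        borel_measurable_continuous_onI[OF r_cont] by simp
  qed
  also have "\<dots> = u2 x * (LINT y:{..x}|lborel. u1 y * r y) + u1 x * (LINT y:{x..}|lborel. u2 y * r y)"
    using i1 i2 unfolding set_lebesgue_integral_def set_integrable_def
    by (subst Bochner_Integration.integral_add) (simp_all only: integrable_mult_right integral_mult_right_zero)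
  also have "\<dots> = (u1 x * v2 x - v1 x * u2 x) * P x"
  proof -
    have "(LINT y:{..x}|lborel. u1 y * r y) = u1 x * F x - v1 x * P x"
      by (rule integral_left[OF u1 v1]) (rule b1, assumption)+
    moreover have "(LINT y:{x..}|lborel. u2 y * r y) = v2 x * P x - u2 x * F x"
      by (rule integral_right[OF u2 v2]) (rule b2, assumption)+
    ultimately show ?thesis by (simp only:) (simp add: algebra_simps)
  qed
  finally show ?thesis .
qed

end

section \<open>The stationary weight and the Wronskian\<close>

definition drift_weight :: "real \<Rightarrow> real \<Rightarrow> real \<Rightarrow> real" where
  "drift_weight \<beta> \<eta> x = (if x \<le> 0 then exp (- \<beta> * x - x\<^sup>2 / 2) else exp (- \<beta> * x - \<eta> * x\<^sup>2 / 2))"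

lemma has_vector_derivative_glue_0:
  fixes f g :: "real \<Rightarrow> 'a :: real_normed_vector"
  assumes f: "\<And>x. x \<le> 0 \<Longrightarrow> (f has_vector_derivative f' x) (at x)"
    and g: "\<And>x. 0 \<le> x \<Longrightarrow> (g has_vector_derivative g' x) (at x)"
    and eq: "f 0 = g 0" "f' 0 = g' 0"
  shows "((\<lambda>x. if x \<le> 0 then f x else g x) has_vector_derivative (if x \<le> 0 then f' x else g' x)) (at x)"
proof -
  have "((\<lambda>x. if x \<in> {..0} then f x else g x) has_vector_derivative (if x \<in> {..0} then f' x else g' x)) (at x within UNIV)"
    by (rule has_vector_derivative_If_within_closures[where T = "{0<..}"])
      (use assms in \<open>auto intro: has_vector_derivative_at_within\<close>)
  then show ?thesis by simp
qed

lemma drift_weight_deriv: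
  "(drift_weight \<beta> \<eta> has_real_derivative drift \<beta> \<eta> x * drift_weight \<beta> \<eta> x) (at x)"
proof -
  have "((\<lambda>x. if x \<le> 0 then exp (- \<beta> * x - x\<^sup>2 / 2) else exp (- \<beta> * x - \<eta> * x\<^sup>2 / 2)) has_vector_derivative
      (if x \<le> 0 then (- \<beta> - x) * exp (- \<beta> * x - x\<^sup>2 / 2) else (- \<beta> - \<eta> * x) * exp (- \<beta> * x - \<eta> * x\<^sup>2 / 2))) (at x)"
    by (rule has_vector_derivative_glue_0)
      (auto intro!: derivative_eq_intros simp: field_simps simp flip: has_real_derivative_iff_has_vector_derivative)
  also have "(if x \<le> 0 then (- \<beta> - x) * exp (- \<beta> * x - x\<^sup>2 / 2) else (- \<beta> - \<eta> * x) * exp (- \<beta> * x - \<eta> * x\<^sup>2 / 2))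
     = drift \<beta> \<eta> x * drift_weight \<beta> \<eta> x"
    by (auto simp: drift_def drift_weight_def)
  finally show ?thesis
    unfolding has_real_derivative_iff_has_vector_derivative by (subst drift_weight_def[abs_def])
qed

text \<open>Abel's identity: the Wronskian w of two adjoint solutions satisfies w' = - a w, while
  the weight satisfies m' = a m. As m(0) = 1, the constant is the Wronskian at 0.\<close>

lemma drift_weight_wronskian:
  fixes u1 v1 u2 v2 :: "real \<Rightarrow> complex"
  assumes u1: "\<And>y. (u1 has_vector_derivative v1 y) (at y)"
    and v1: "\<And>y. (v1 has_vector_derivative \<theta> * u1 y - of_real (drift \<beta> \<eta> y) * v1 y) (at y)"
    and u2: "\<And>y. (u2 has_vector_derivative v2 y) (at y)"
    and v2: "\<And>y. (v2 has_vector_derivative \<theta> * u2 y - of_real (drift \<beta> \<eta> y) * v2 y) (at y)"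
  shows "of_real (drift_weight \<beta> \<eta> x) * (v1 x * u2 x - u1 x * v2 x) = v1 0 * u2 0 - u1 0 * v2 0"
proof -
  let ?W = "\<lambda>x. of_real (drift_weight \<beta> \<eta> x) * (v1 x * u2 x - u1 x * v2 x)"
  have "(?W has_vector_derivative 0) (at x)" for x
  proof -
    have "(?W has_vector_derivative
        of_real (drift_weight \<beta> \<eta> x) * ((v1 x * v2 x + (\<theta> * u1 x - of_real (drift \<beta> \<eta> x) * v1 x) * u2 x)
          - (u1 x * (\<theta> * u2 x - of_real (drift \<beta> \<eta> x) * v2 x) + v1 x * v2 x))
        + of_real (drift \<beta> \<eta> x * drift_weight \<beta> \<eta> x) * (v1 x * u2 x - u1 x * v2 x)) (at x)"
      by (intro has_vector_derivative_mult has_vector_derivative_diff u1 v1 u2 v2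
          has_vector_derivative_of_real drift_weight_deriv)
    then show ?thesis by (simp add: algebra_simps)
  qed
  then obtain c where c: "\<And>x. ?W x = c"
    using has_vector_derivative_zero_constant[of UNIV ?W] by (metis UNIV_I convex_UNIV)
  from c[of x] c[of 0] show ?thesis by (simp add: drift_weight_def)
qed

section \<open>Adjoint solutions built from parabolic cylinder functions\<close>

text \<open>Putting z = k y + d into h'' = z h' + s h gives u'' = k (k y + d) u' + k^2 s u, hence
  the order \<theta> / k^2. The square of k matches the slope of the drift, and its sign selects the
  side on which the solution stays bounded.\<close>

lemma hermite_fn_scaled_solution:
  fixes k d :: real
  assumes s: "0 < Re \<theta>" and k: "k \<noteq> 0"
  defines "u \<equiv> \<lambda>y. hermite_fn (\<theta> / of_real (k\<^sup>2)) (of_real (k * y + d))"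
    and "v \<equiv> \<lambda>y. of_real k * hermite_fn' (\<theta> / of_real (k\<^sup>2)) (of_real (k * y + d))"
  shows "(u has_vector_derivative v y) (at y)"
    and "(v has_vector_derivative \<theta> * u y + of_real (k * (k * y + d)) * v y) (at y)"
proof -
  have s': "0 < Re (\<theta> / of_real (k\<^sup>2))"
    using s k by (simp only: Re_divide_of_real) (simp add: field_simps)
  have lin: "((\<lambda>y. k * y + d) has_vector_derivative k) (at y)"
    by (auto intro!: derivative_eq_intros simp flip: has_real_derivative_iff_has_vector_derivative)
  have chain: "((\<lambda>y. g (of_real (k * y + d))) has_vector_derivative k *\<^sub>R g') (at y)"
    if "(g has_field_derivative g') (at (of_real (k * y + d)))" for g g'
    using vector_diff_chain_at[OF lin has_vector_derivative_real_field[OF that]] by (simp add: o_def)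
  show "(u has_vector_derivative v y) (at y)"
    unfolding u_def v_def using chain[OF hermite_fn_has_field_derivative[OF s']] by (simp add: scaleR_conv_of_real)
  have "(v has_vector_derivative of_real k * (k *\<^sub>R (of_real (k * y + d) * hermite_fn' (\<theta> / of_real (k\<^sup>2)) (of_real (k * y + d))
      + \<theta> / of_real (k\<^sup>2) * hermite_fn (\<theta> / of_real (k\<^sup>2)) (of_real (k * y + d))))) (at y)"
    unfolding v_def by (intro has_vector_derivative_mult_right chain hermite_fn'_has_field_derivative s')
  also have "of_real k * (k *\<^sub>R (of_real (k * y + d) * hermite_fn' (\<theta> / of_real (k\<^sup>2)) (of_real (k * y + d))
      + \<theta> / of_real (k\<^sup>2) * hermite_fn (\<theta> / of_real (k\<^sup>2)) (of_real (k * y + d))))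
      = \<theta> * u y + of_real (k * (k * y + d)) * v y"
    unfolding u_def v_def using k by (simp add: scaleR_conv_of_real field_simps power2_eq_square)
  finally show "(v has_vector_derivative \<theta> * u y + of_real (k * (k * y + d)) * v y) (at y)" .
qed

lemma hermite_fn_real_nonzero: "0 < Re s \<Longrightarrow> hermite_fn s (of_real x) \<noteq> 0"
  using Re_hermite_fn'_cnj_neg[of s x] by auto

lemma Re_hermite_fn_log_deriv_neg:
  assumes "0 < Re s"
  shows "Re (hermite_fn' s (of_real x) / hermite_fn s (of_real x)) < 0"
proof -
  have "Re (hermite_fn' s (of_real x) / hermite_fn s (of_real x)) =
    Re (hermite_fn' s (of_real x) * cnj (hermite_fn s (of_real x))) / (norm (hermite_fn s (of_real x)))\<^sup>2"
    by (subst complex_div_cnj) (simp flip: of_real_power)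
  then show ?thesis
    using Re_hermite_fn'_cnj_neg[OF assms, of x] hermite_fn_real_nonzero[OF assms, of x]
    by (simp add: divide_less_0_iff)
qed

text \<open>This and \<open>reflected_wronskian\<close> are V and M stripped of their Gaussian
  factors. It is the Wronskian at 0 of h(-y - \<beta>), the solution bounded on the left, and the
  right-hand solution; the other one has the mirror image h(y + \<beta>) in the first place and the
  opposite sign.\<close>

definition left_right_wronskian :: "complex \<Rightarrow> real \<Rightarrow> real \<Rightarrow> complex" where
  "left_right_wronskian \<theta> \<eta> \<beta> =
     - hermite_fn' \<theta> (of_real (- \<beta>)) * hermite_fn (\<theta> / of_real \<eta>) (of_real (\<beta> / sqrt \<eta>))
     - of_real (sqrt \<eta>) * hermite_fn \<theta> (of_real (- \<beta>)) * hermite_fn' (\<theta> / of_real \<eta>) (of_real (\<beta> / sqrt \<eta>))"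

definition reflected_wronskian :: "complex \<Rightarrow> real \<Rightarrow> real \<Rightarrow> complex" where
  "reflected_wronskian \<theta> \<eta> \<beta> =
     of_real (sqrt \<eta>) * hermite_fn \<theta> (of_real \<beta>) * hermite_fn' (\<theta> / of_real \<eta>) (of_real (\<beta> / sqrt \<eta>))
     - hermite_fn' \<theta> (of_real \<beta>) * hermite_fn (\<theta> / of_real \<eta>) (of_real (\<beta> / sqrt \<eta>))"

text \<open>
  Decay of the two factors on opposite sides forces their logarithmic derivatives to have
  real parts of opposite sign.
\<close>

lemma left_right_wronskian_nonzero:
  assumes \<eta>: "0 < \<eta>" and \<theta>: "0 < Re \<theta>"
  shows "left_right_wronskian \<theta> \<eta> \<beta> \<noteq> 0"
proof -
  let ?l = "hermite_fn \<theta> (of_real (- \<beta>))" and ?l' = "hermite_fn' \<theta> (of_real (- \<beta>))"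
  let ?r = "hermite_fn (\<theta> / of_real \<eta>) (of_real (\<beta> / sqrt \<eta>))" and ?r' = "hermite_fn' (\<theta> / of_real \<eta>) (of_real (\<beta> / sqrt \<eta>))"
  have \<theta>': "0 < Re (\<theta> / of_real \<eta>)" using \<eta> \<theta> by simp
  have nz: "?l \<noteq> 0" "?r \<noteq> 0" using hermite_fn_real_nonzero[OF \<theta>] hermite_fn_real_nonzero[OF \<theta>'] by blast+
  have "Re (?l' / ?l + of_real (sqrt \<eta>) * (?r' / ?r)) = Re (?l' / ?l) + sqrt \<eta> * Re (?r' / ?r)"
    by (simp only: plus_complex.sel times_complex.sel Re_complex_of_real Im_complex_of_real mult_zero_left diff_zero)
  also have "\<dots> < 0"
    using Re_hermite_fn_log_deriv_neg[OF \<theta>, of "- \<beta>"] Re_hermite_fn_log_deriv_neg[OF \<theta>', of "\<beta> / sqrt \<eta>"] \<eta>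
    by (intro add_neg_neg mult_pos_neg) simp_all
  finally have "?l' / ?l + of_real (sqrt \<eta>) * (?r' / ?r) \<noteq> 0" by (metis less_irrefl zero_complex.sel(1))
  moreover have "left_right_wronskian \<theta> \<eta> \<beta> = - (?l * ?r) * (?l' / ?l + of_real (sqrt \<eta>) * (?r' / ?r))"
    unfolding left_right_wronskian_def using nz by (simp add: field_simps)
  ultimately show ?thesis using nz by simp
qed

text \<open>Differentiating e^(-z^2/4) h(z) adds a term -z/2 times the function. The two such terms
  are \<beta>/2 times the product of the values with opposite signs, so they cancel and leave a
  common Gaussian factor.\<close>

lemma V_M_eq_wronskians:
  assumes \<eta>: "0 < \<eta>" and \<theta>: "0 < Re \<theta>"
  shows "\<V> \<theta> \<eta> \<beta> = of_real (exp (- \<beta>\<^sup>2 / 4 - \<beta>\<^sup>2 / (4 * \<eta>))) * left_right_wronskian \<theta> \<eta> \<beta>" (is ?V)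
    and "\<M> \<theta> \<eta> \<beta> = of_real (exp (- \<beta>\<^sup>2 / 4 - \<beta>\<^sup>2 / (4 * \<eta>))) * reflected_wronskian \<theta> \<eta> \<beta>" (is ?M)
proof -
  define s where "s = complex_of_real (sqrt \<eta>)"
  define b where "b = complex_of_real \<beta>"
  have s: "s \<noteq> 0" "s * s = of_real \<eta>" using \<eta> by (simp_all add: s_def flip: of_real_mult)
  have \<theta>': "0 < Re (\<theta> / of_real \<eta>)" using \<eta> \<theta> by simp
  have bs: "complex_of_real (\<beta> / sqrt \<eta>) = b / s" "complex_of_real (- \<beta>) = - b" "complex_of_real \<beta> = b"
    by (simp_all add: b_def s_def)
  define E1 where "E1 = exp (- b\<^sup>2 / 4)"
  define E2 where "E2 = exp (- (b / s)\<^sup>2 / 4)"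
  have E: "complex_of_real (exp (- \<beta>\<^sup>2 / 4 - \<beta>\<^sup>2 / (4 * \<eta>))) = E1 * E2"
    using s by (simp add: E1_def E2_def b_def power_divide power2_eq_square mult.commute flip: exp_of_real exp_add)
  have md: "- \<theta> / complex_of_real \<eta> = - (\<theta> / of_real \<eta>)" by simp
  note pc = parabolic_cylinder_eq_hermite_fn parabolic_cylinder'_eq_hermite_fn
  show ?V
    unfolding \<V>_def left_right_wronskian_def E md pc[OF \<theta>] pc[OF \<theta>'] bs power2_minus s_def[symmetric] E1_def[symmetric] E2_def[symmetric]
    using s(1) by (simp add: field_simps)
  show ?M
    unfolding \<M>_def reflected_wronskian_def E md pc[OF \<theta>] pc[OF \<theta>'] bs power2_minus s_def[symmetric] E1_def[symmetric] E2_def[symmetric]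
    using s(1) by (simp add: field_simps)
qed

text \<open>Compactness covers the gap between c and z. Explicit bounds exist only where a solution
  is given by its bounded branch, whereas Green's identity is applied at arbitrary x.\<close>

lemma bounded_atMost_extend:
  fixes f :: "real \<Rightarrow> complex"
  assumes f: "continuous_on UNIV f" and C: "\<And>y. y \<le> c \<Longrightarrow> norm (f y) \<le> C"
  shows "\<exists>M. \<forall>y\<le>z. norm (f y) \<le> M"
proof -
  have "bounded (f ` {c..z})"
    by (intro compact_imp_bounded compact_continuous_image continuous_on_subset[OF f]) auto
  then obtain B where "\<And>y. y \<in> {c..z} \<Longrightarrow> norm (f y) \<le> B"
    by (metis bounded_iff imageI)
  with C have "\<forall>y\<le>z. norm (f y) \<le> max B C" by (metis atLeastAtMost_iff le_max_iff_disj linear)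
  then show ?thesis by blast
qed

lemma bounded_atLeast_extend:
  fixes f :: "real \<Rightarrow> complex"
  assumes f: "continuous_on UNIV f" and C: "\<And>y. c \<le> y \<Longrightarrow> norm (f y) \<le> C"
  shows "\<exists>M. \<forall>y\<ge>z. norm (f y) \<le> M"
proof -
  have "\<exists>M. \<forall>y\<le>- z. norm (f (- y)) \<le> M"
    by (rule bounded_atMost_extend[where c = "- c" and C = C])
      (auto intro!: continuous_intros continuous_on_compose2[OF f] C)
  then show ?thesis by (metis minus_minus neg_le_iff_le)
qed

lemma bounded_pair:
  fixes f g :: "real \<Rightarrow> complex"
  assumes "\<exists>M. \<forall>y. P y \<longrightarrow> norm (f y) \<le> M" "\<exists>M. \<forall>y. P y \<longrightarrow> norm (g y) \<le> M"
  shows "\<exists>M. \<forall>y. P y \<longrightarrow> norm (f y) \<le> M \<and> norm (g y) \<le> M"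
proof -
  obtain M1 M2 where "\<forall>y. P y \<longrightarrow> norm (f y) \<le> M1" "\<forall>y. P y \<longrightarrow> norm (g y) \<le> M2"
    using assms by blast
  then have "\<forall>y. P y \<longrightarrow> norm (f y) \<le> max M1 M2 \<and> norm (g y) \<le> max M1 M2" by (auto simp: le_max_iff_disj)
  then show ?thesis by blast
qed

text \<open>Both equations have the coefficient \<beta> at 0, so matching value and slope there
  forces the two second derivatives to agree. The glued slope is therefore differentiable at 0 as
  well.\<close>

lemma glued_solution:
  fixes f f' g g' :: "real \<Rightarrow> complex"
  assumes f: "\<And>y. (f has_vector_derivative f' y) (at y)"
      "\<And>y. (f' has_vector_derivative \<theta> * f y + of_real (\<beta> + y) * f' y) (at y)"
    and g: "\<And>y. (g has_vector_derivative g' y) (at y)"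
      "\<And>y. (g' has_vector_derivative \<theta> * g y + of_real (\<beta> + \<eta> * y) * g' y) (at y)"
    and eq: "f 0 = g 0" "f' 0 = g' 0"
  shows "((\<lambda>y. if y \<le> 0 then f y else g y) has_vector_derivative (if y \<le> 0 then f' y else g' y)) (at y)"
    and "((\<lambda>y. if y \<le> 0 then f' y else g' y) has_vector_derivative
      \<theta> * (if y \<le> 0 then f y else g y) - of_real (drift \<beta> \<eta> y) * (if y \<le> 0 then f' y else g' y)) (at y)"
proof -
  show "((\<lambda>y. if y \<le> 0 then f y else g y) has_vector_derivative (if y \<le> 0 then f' y else g' y)) (at y)"
    by (rule has_vector_derivative_glue_0) (use assms in auto)
  have "((\<lambda>y. if y \<le> 0 then f' y else g' y) has_vector_derivative
      (if y \<le> 0 then \<theta> * f y + of_real (\<beta> + y) * f' y else \<theta> * g y + of_real (\<beta> + \<eta> * y) * g' y)) (at y)"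
    by (rule has_vector_derivative_glue_0) (use assms in auto)
  also have "(if y \<le> 0 then \<theta> * f y + of_real (\<beta> + y) * f' y else \<theta> * g y + of_real (\<beta> + \<eta> * y) * g' y) =
     \<theta> * (if y \<le> 0 then f y else g y) - of_real (drift \<beta> \<eta> y) * (if y \<le> 0 then f' y else g' y)"
    by (auto simp: drift_def algebra_simps)
  finally show "((\<lambda>y. if y \<le> 0 then f' y else g' y) has_vector_derivative
      \<theta> * (if y \<le> 0 then f y else g y) - of_real (drift \<beta> \<eta> y) * (if y \<le> 0 then f' y else g' y)) (at y)" .
qed

section \<open>The truncated Laplace transform of the density\<close>

lemma abs_drift_le: "0 < \<eta> \<Longrightarrow> \<bar>drift \<beta> \<eta> y\<bar> \<le> (\<bar>\<beta>\<bar> + \<eta> + 1) * (1 + \<bar>y\<bar>)"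
proof -
  assume "0 < \<eta>"
  have "\<bar>drift \<beta> \<eta> y\<bar> \<le> \<bar>\<beta>\<bar> + (\<eta> + 1) * \<bar>y\<bar>"
  proof (cases "0 \<le> y")
    case True
    then have "0 \<le> \<eta> * y" using \<open>0 < \<eta>\<close> by simp
    then show ?thesis using True by (simp add: drift_def algebra_simps)
  next
    case False
    then have "0 \<le> \<eta> * - y" using \<open>0 < \<eta>\<close> by (intro mult_nonneg_nonneg) auto
    then show ?thesis using False by (simp add: drift_def algebra_simps)
  qed
  also have "\<dots> \<le> (\<bar>\<beta>\<bar> + \<eta> + 1) * (1 + \<bar>y\<bar>)" using \<open>0 < \<eta>\<close> by (simp add: algebra_simps)
  finally show ?thesis .
qed

lemma drift_continuous: "continuous_on UNIV (drift \<beta> \<eta>)"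
proof -
  have "continuous_on UNIV (\<lambda>x. - \<beta> - \<eta> * max 0 x - min 0 x)"
    by (intro continuous_intros)
  also have "(\<lambda>x. - \<beta> - \<eta> * max 0 x - min 0 x) = drift \<beta> \<eta>"
    by (auto simp: drift_def fun_eq_iff max_def min_def)
  finally show ?thesis .
qed

lemma drift_deriv:
  assumes "x \<noteq> 0"
  shows "(drift \<beta> \<eta> has_real_derivative (if 0 \<le> x then - \<eta> else - 1)) (at x)"
proof (cases "0 \<le> x")
  case True
  then have "((\<lambda>x. - \<beta> - \<eta> * x) has_real_derivative - \<eta>) (at x)"
    by (auto intro!: derivative_eq_intros)
  then have "(drift \<beta> \<eta> has_real_derivative - \<eta>) (at x)"
    by (rule has_field_derivative_transform_within_open[of _ _ _ "{0<..}"])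
      (use True assms in \<open>auto simp: drift_def\<close>)
  then show ?thesis using True by simp
next
  case False
  then have "((\<lambda>x. - \<beta> - x) has_real_derivative - 1) (at x)"
    by (auto intro!: derivative_eq_intros)
  then have "(drift \<beta> \<eta> has_real_derivative - 1) (at x)"
    by (rule has_field_derivative_transform_within_open[of _ _ _ "{..<0}"])
      (use False in \<open>auto simp: drift_def\<close>)
  then show ?thesis using False by simp
qed

locale diffusion_density =
  fixes \<beta> \<eta> x0 :: real and p :: "real \<Rightarrow> real \<Rightarrow> real"
  assumes eta: "0 < \<eta>" and density: "transition_density \<beta> \<eta> x0 p"
begin

lemma p_nonneg: "0 < t \<Longrightarrow> 0 \<le> p x t"
  and p_mass: "0 < t \<Longrightarrow> has_bochner_integral lborel (\<lambda>x. p x t) 1"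
  and p_solution: "fokker_planck_solution \<beta> \<eta> p"
  and p_initial: "continuous_on UNIV f \<Longrightarrow> bounded (range f) \<Longrightarrow>
        ((\<lambda>t. LINT x|lborel. f x * p x t) \<longlongrightarrow> f x0) (at_right 0)"
  using density unfolding transition_density_def by auto

text \<open>A gauge integral, the form in which Leibniz's rule and the fundamental theorem are
  applied; \<open>truncated_laplace_eq_lebesgue\<close> converts it.\<close>

definition truncated_laplace :: "complex \<Rightarrow> real \<Rightarrow> real \<Rightarrow> real \<Rightarrow> complex" where
  "truncated_laplace \<theta> \<epsilon> T y = integral {\<epsilon>..T} (\<lambda>t. exp (- (\<theta> * of_real t)) * of_real (p y t))"

lemma p_continuous: "continuous_on (UNIV \<times> {0<..}) (\<lambda>(x, t). p x t)"
  using p_solution unfolding fokker_planck_solution_def by blast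

lemma p_continuous_snd: "continuous_on {0<..} (p x)"
proof -
  have "continuous_on {0<..} (\<lambda>t. case (x, t) of (x, t) \<Rightarrow> p x t)"
    by (rule continuous_on_compose2[OF p_continuous]) (intro continuous_intros, auto)
  then show ?thesis by simp
qed

lemma p_continuous_fst: "0 < t \<Longrightarrow> continuous_on UNIV (\<lambda>x. p x t)"
proof -
  assume t: "0 < t"
  have "continuous_on UNIV (\<lambda>x. case (x, t) of (x, t) \<Rightarrow> p x t)"
    by (rule continuous_on_compose2[OF p_continuous]) (intro continuous_intros, use t in auto)
  then show ?thesis by simp
qed

text \<open>Every time slice has mass 1, so by Fubini the double integral of the modulus is the
  integral of e^(-Re \<theta> t) over the time interval.\<close>

lemma truncated_laplace_integrable:
  assumes e: "0 < \<epsilon>"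
  shows "integrable lborel (truncated_laplace \<theta> \<epsilon> T)"
proof -
  define f where "f t y = indicator {\<epsilon>..T} t *\<^sub>R (exp (- (\<theta> * of_real t)) * of_real (p y t))" for t y
  have e0: "\<epsilon> \<le> t \<Longrightarrow> 0 < t" for t using e by simp
  have "continuous_on ({\<epsilon>..T} \<times> UNIV) (\<lambda>z. case (snd z, fst z) of (x, t) \<Rightarrow> p x t)"
    by (rule continuous_on_compose2[OF p_continuous]) (intro continuous_intros, use e in auto)
  then have "continuous_on ({\<epsilon>..T} \<times> UNIV) (\<lambda>z. p (snd z) (fst z))" by simp
  then have "continuous_on ({\<epsilon>..T} \<times> UNIV) (\<lambda>z. exp (- (\<theta> * of_real (fst z))) * complex_of_real (p (snd z) (fst z)))"
    by (intro continuous_intros)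
  then have "(\<lambda>z. indicator ({\<epsilon>..T} \<times> UNIV) z *\<^sub>R (exp (- (\<theta> * of_real (fst z))) * complex_of_real (p (snd z) (fst z)))) \<in> borel_measurable borel"
    by (intro borel_measurable_continuous_on_indicator borel_closed closed_Times) auto
  also have "(\<lambda>z. indicator ({\<epsilon>..T} \<times> UNIV) z *\<^sub>R (exp (- (\<theta> * of_real (fst z))) * complex_of_real (p (snd z) (fst z)))) = case_prod f"
    by (auto simp: f_def fun_eq_iff indicator_def)
  finally have meas: "case_prod f \<in> borel_measurable (lborel \<Otimes>\<^sub>M lborel)"
    by (simp add: borel_prod[symmetric])
  have nf: "norm (f t y) = indicator {\<epsilon>..T} t * exp (- (Re \<theta> * t)) * p y t" for t y
    using p_nonneg[OF e0, of t y] by (auto simp: f_def indicator_def norm_mult)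
  have mass: "(LINT y|lborel. norm (f t y)) = indicator {\<epsilon>..T} t *\<^sub>R exp (- (Re \<theta> * t))" for t
    using p_mass[OF e0, of t] unfolding nf
    by (auto simp: indicator_def has_bochner_integral_iff)
  have "integrable (lborel \<Otimes>\<^sub>M lborel) (case_prod f)"
  proof (rule lborel_pair.Fubini_integrable[OF meas])
    show "integrable lborel (\<lambda>t. LINT y|lborel. norm (case_prod f (t, y)))"
      using borel_integrable_atLeastAtMost'[of \<epsilon> T "\<lambda>t. exp (- (Re \<theta> * t))"]
      by (simp add: mass set_integrable_def continuous_intros)
    show "AE t in lborel. integrable lborel (\<lambda>y. case_prod f (t, y))"
    proof (rule AE_I2)
      fix t
      show "integrable lborel (\<lambda>y. case_prod f (t, y))"
        using p_mass[OF e0, of t]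
        by (cases "t \<in> {\<epsilon>..T}") (auto simp: f_def has_bochner_integral_iff)
    qed
  qed
  then have "integrable lborel (\<lambda>y. LINT t|lborel. f t y)"
    by (rule lborel_pair.integrable_snd)
  also have "(\<lambda>y. LINT t|lborel. f t y) = truncated_laplace \<theta> \<epsilon> T"
  proof
    fix y
    have "set_integrable lborel {\<epsilon>..T} (\<lambda>t. exp (- (\<theta> * of_real t)) * complex_of_real (p y t))"
      using e by (intro borel_integrable_atLeastAtMost' continuous_intros continuous_on_subset[OF p_continuous_snd]) auto
    from set_borel_integral_eq_integral(2)[OF this]
    show "(LINT t|lborel. f t y) = truncated_laplace \<theta> \<epsilon> T y"
      by (simp add: truncated_laplace_def f_def set_lebesgue_integral_def)
  qed
  finally show ?thesis .
qed

definition endpoint_difference :: "complex \<Rightarrow> real \<Rightarrow> real \<Rightarrow> real \<Rightarrow> complex" where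
  "endpoint_difference \<theta> \<epsilon> T y =
     exp (- (\<theta> * of_real T)) * of_real (p y T) - exp (- (\<theta> * of_real \<epsilon>)) * of_real (p y \<epsilon>)"

text \<open>Leibniz's rule moves the x-derivatives inside, and integration by parts in t turns the
  transform of the time derivative into \<theta> P + r. With F = P' - a P the drift terms in F'
  cancel against those of the equation.\<close>

lemma truncated_laplace_forced_equation:
  assumes e: "0 < \<epsilon>" "\<epsilon> \<le> T"
  obtains F where "forced_equation (drift \<beta> \<eta>) (\<bar>\<beta>\<bar> + \<eta> + 1) \<theta> (truncated_laplace \<theta> \<epsilon> T) F
    (endpoint_difference \<theta> \<epsilon> T)"
proof -
  obtain px pxx pt where
    px: "\<And>x t. 0 < t \<Longrightarrow> ((\<lambda>y. p y t) has_real_derivative px x t) (at x)" and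
    pxx: "\<And>x t. 0 < t \<Longrightarrow> x \<noteq> 0 \<Longrightarrow> ((\<lambda>y. px y t) has_real_derivative pxx x t) (at x)" and
    pt: "\<And>x t. 0 < t \<Longrightarrow> x \<noteq> 0 \<Longrightarrow> ((\<lambda>s. p x s) has_real_derivative pt x t) (at t)" and
    cpx: "continuous_on (UNIV \<times> {0<..}) (\<lambda>(x, t). px x t)" and
    cpxx: "continuous_on ((- {0}) \<times> {0<..}) (\<lambda>(x, t). pxx x t)" and
    cpt: "continuous_on ((- {0}) \<times> {0<..}) (\<lambda>(x, t). pt x t)" and
    pde: "\<And>x t. 0 < t \<Longrightarrow> x \<noteq> 0 \<Longrightarrow> pt x t = - deriv (\<lambda>y. drift \<beta> \<eta> y * p y t) x + pxx x t"
    using p_solution unfolding fokker_planck_solution_def by blast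
  let ?k = "\<lambda>t. exp (- (\<theta> * of_real t))"
  define L where "L q y = integral (cbox \<epsilon> T) (\<lambda>t. ?k t * complex_of_real (q y t))" for q :: "real \<Rightarrow> real \<Rightarrow> real" and y
  have P_eq: "truncated_laplace \<theta> \<epsilon> T = L p"
    by (simp add: fun_eq_iff truncated_laplace_def L_def cbox_interval)
  have ck: "continuous_on (U \<times> cbox \<epsilon> T) (\<lambda>(x, t). ?k t * complex_of_real (q x t))"
    if "continuous_on (V \<times> {0<..}) (\<lambda>(x, t). q x t)" "U \<subseteq> V" for q U V
  proof -
    have "continuous_on (U \<times> cbox \<epsilon> T) (\<lambda>z. q (fst z) (snd z))"
      using continuous_on_subset[OF that(1), of "U \<times> cbox \<epsilon> T"] that(2) e by (force simp: case_prod_beta)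
    then show ?thesis unfolding case_prod_beta by (intro continuous_intros)
  qed
  have ck1: "continuous_on (cbox \<epsilon> T) (\<lambda>t. ?k t * complex_of_real (q x t))"
    if "continuous_on (V \<times> {0<..}) (\<lambda>(x, t). q x t)" "x \<in> V" for q V x
  proof -
    have "continuous_on (cbox \<epsilon> T) (\<lambda>t. case (x, t) of (x, t) \<Rightarrow> ?k t * complex_of_real (q x t))"
      by (rule continuous_on_compose2[OF ck[OF that(1) order_refl]]) (intro continuous_intros, use that(2) in auto)
    then show ?thesis by simp
  qed
  note int1 = integrable_continuous[OF ck1]
  \<comment> \<open>V is the region where the derivative is known and continuous, U an open convex
    neighbourhood of x inside it: the whole line for \<open>p\<close>, an open half line avoiding 0
    for its derivative.\<close>
  have LD: "(L q has_vector_derivative L q' x) (at x)"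
    if q: "\<And>x t. 0 < t \<Longrightarrow> x \<in> V \<Longrightarrow> ((\<lambda>y. q y t) has_real_derivative q' x t) (at x)"
      and c: "continuous_on (V \<times> {0<..}) (\<lambda>(x, t). q x t)" and c': "continuous_on (V \<times> {0<..}) (\<lambda>(x, t). q' x t)"
      and U: "U \<subseteq> V" "x \<in> U" "convex U" "open U" for q q' U V x
  proof -
    have "(L q has_vector_derivative L q' x) (at x within U)"
      unfolding L_def
    proof (rule leibniz_rule_vector_derivative)
      show "((\<lambda>x. ?k t * complex_of_real (q x t)) has_vector_derivative ?k t * complex_of_real (q' y t)) (at y within U)"
        if "y \<in> U" "t \<in> cbox \<epsilon> T" for y t
        using q[of t y] that U e
        by (intro has_vector_derivative_mult_right has_vector_derivative_of_real has_vector_derivative_at_within)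
          auto
      show "(\<lambda>t. ?k t * complex_of_real (q y t)) integrable_on cbox \<epsilon> T" if "y \<in> U" for y
        using int1[OF c] that U by blast
      show "continuous_on (U \<times> cbox \<epsilon> T) (\<lambda>(x, t). ?k t * complex_of_real (q' x t))"
        using ck[OF c' U(1)] .
    qed (use U in auto)
    then show ?thesis using U at_within_open by metis
  qed
  have dP: "(L p has_vector_derivative L px y) (at y)" for y
    by (rule LD[OF px p_continuous cpx, of UNIV]) auto
  have dPx: "(L px has_vector_derivative L pxx y) (at y)" if "y \<noteq> 0" for y
  proof (cases "0 < y")
    case True
    show ?thesis
      by (rule LD[OF pxx continuous_on_subset[OF cpx] cpxx, of "{0<..}"]) (use True in auto)
  next
    case False
    show ?thesis
      by (rule LD[OF pxx continuous_on_subset[OF cpx] cpxx, of "{..<0}"]) (use False that in auto)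
  qed
  have Lpt: "L pt y = endpoint_difference \<theta> \<epsilon> T y + \<theta> * L p y" if y: "y \<noteq> 0" for y
  proof -
    have "((\<lambda>t. ?k t * complex_of_real (pt y t) - \<theta> * (?k t * complex_of_real (p y t))) has_integral
        ?k T * of_real (p y T) - ?k \<epsilon> * of_real (p y \<epsilon>)) {\<epsilon>..T}"
    proof (rule fundamental_theorem_of_calculus[OF e(2)])
      fix t assume t: "t \<in> {\<epsilon>..T}"
      have dk: "(?k has_vector_derivative - \<theta> * ?k t) (at t)"
        by (auto intro!: has_vector_derivative_real_field derivative_eq_intros)
      have dp: "((\<lambda>t. complex_of_real (p y t)) has_vector_derivative of_real (pt y t)) (at t)"
        using pt[of t y] t e y
        by (intro has_vector_derivative_of_real) simp
      from has_vector_derivative_mult[OF dk dp]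
      have "((\<lambda>t. ?k t * complex_of_real (p y t)) has_vector_derivative
          ?k t * complex_of_real (pt y t) - \<theta> * (?k t * complex_of_real (p y t))) (at t)"
        by (simp add: algebra_simps)
      then show "((\<lambda>t. ?k t * complex_of_real (p y t)) has_vector_derivative
          ?k t * complex_of_real (pt y t) - \<theta> * (?k t * complex_of_real (p y t))) (at t within {\<epsilon>..T})"
        by (rule has_vector_derivative_at_within)
    qed
    then have "integral (cbox \<epsilon> T) (\<lambda>t. ?k t * complex_of_real (pt y t) - \<theta> * (?k t * complex_of_real (p y t)))
        = endpoint_difference \<theta> \<epsilon> T y"
      by (simp add: integral_unique endpoint_difference_def cbox_interval)
    moreover have "integral (cbox \<epsilon> T) (\<lambda>t. ?k t * complex_of_real (pt y t) - \<theta> * (?k t * complex_of_real (p y t)))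
        = L pt y - \<theta> * L p y"
      unfolding L_def
      using int1[OF cpt, of y] int1[OF p_continuous, of y] y
      by (subst Henstock_Kurzweil_Integration.integral_diff)
        (auto intro: integrable_on_mult_right)
    ultimately show ?thesis by (simp add: algebra_simps)
  qed
  define a' where "a' y = (if 0 \<le> y then - \<eta> else - 1)" for y :: real
  have Lpxx: "L pxx y = L pt y + of_real (a' y) * L p y + of_real (drift \<beta> \<eta> y) * L px y" if y: "y \<noteq> 0" for y
  proof -
    have "pxx y t = pt y t + (a' y * p y t + drift \<beta> \<eta> y * px y t)" if t: "0 < t" for t
    proof -
      have "((\<lambda>y. drift \<beta> \<eta> y * p y t) has_real_derivative a' y * p y t + px y t * drift \<beta> \<eta> y) (at y)"
        unfolding a'_def by (intro DERIV_mult drift_deriv y px t)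
      then show ?thesis using pde[OF t y] by (simp add: DERIV_imp_deriv algebra_simps)
    qed
    then have "L pxx y = integral (cbox \<epsilon> T) (\<lambda>t. (?k t * of_real (pt y t) + of_real (a' y) * (?k t * of_real (p y t)))
        + of_real (drift \<beta> \<eta> y) * (?k t * of_real (px y t)))"
      unfolding L_def using e
      by (intro Henstock_Kurzweil_Integration.integral_cong) (auto simp: algebra_simps)
    also have "\<dots> = L pt y + of_real (a' y) * L p y + of_real (drift \<beta> \<eta> y) * L px y"
      unfolding L_def
      using int1[OF cpt, of y] int1[OF p_continuous, of y] int1[OF cpx, of y] y
      by (simp add: Henstock_Kurzweil_Integration.integral_add integrable_on_cmult_left
          Henstock_Kurzweil_Integration.integrable_add)
    finally show ?thesis .
  qed
  have cPx: "continuous_on UNIV (L px)"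
    unfolding L_def
    by (rule integral_continuous_on_param) (rule ck[OF cpx order_refl])
  have cP: "continuous_on UNIV (L p)"
    by (rule has_vector_derivative_imp_continuous_on[OF dP])
  have ca: "continuous_on UNIV (\<lambda>y. complex_of_real (drift \<beta> \<eta> y))"
    by (intro continuous_on_of_real drift_continuous)
  have "forced_equation (drift \<beta> \<eta>) (\<bar>\<beta>\<bar> + \<eta> + 1) \<theta> (truncated_laplace \<theta> \<epsilon> T)
      (\<lambda>y. L px y - of_real (drift \<beta> \<eta> y) * L p y) (endpoint_difference \<theta> \<epsilon> T)"
  proof
    show "continuous_on UNIV (drift \<beta> \<eta>)" by (rule drift_continuous)
    show "\<bar>drift \<beta> \<eta> y\<bar> \<le> (\<bar>\<beta>\<bar> + \<eta> + 1) * (1 + \<bar>y\<bar>)" for y by (rule abs_drift_le[OF eta])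
    show "(truncated_laplace \<theta> \<epsilon> T has_vector_derivative
        L px y - of_real (drift \<beta> \<eta> y) * L p y + of_real (drift \<beta> \<eta> y) * truncated_laplace \<theta> \<epsilon> T y) (at y)" for y
      unfolding P_eq using dP by simp
    show "((\<lambda>y. L px y - of_real (drift \<beta> \<eta> y) * L p y) has_vector_derivative
        \<theta> * truncated_laplace \<theta> \<epsilon> T y + endpoint_difference \<theta> \<epsilon> T y) (at y)" if y: "y \<noteq> 0" for y
    proof -
      have "((\<lambda>y. complex_of_real (drift \<beta> \<eta> y)) has_vector_derivative of_real (a' y)) (at y)"
        using drift_deriv[OF y] unfolding a'_def
        by (intro has_vector_derivative_of_real) simp
      from has_vector_derivative_diff[OF dPx[OF y] has_vector_derivative_mult[OF this dP]]
      show ?thesis unfolding Lpxx[OF y] Lpt[OF y] P_eq by (simp add: algebra_simps)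
    qed
    show "continuous_on UNIV (\<lambda>y. L px y - of_real (drift \<beta> \<eta> y) * L p y)"
      by (intro continuous_intros cPx cP ca)
    show "continuous_on UNIV (endpoint_difference \<theta> \<epsilon> T)"
      unfolding endpoint_difference_def using e by (intro continuous_intros p_continuous_fst) auto
    show "integrable lborel (truncated_laplace \<theta> \<epsilon> T)"
      using e by (intro truncated_laplace_integrable)
    show "integrable lborel (endpoint_difference \<theta> \<epsilon> T)"
      unfolding endpoint_difference_def using e p_mass[of \<epsilon>] p_mass[of T]
      by (auto simp: has_bochner_integral_iff)
  qed
  then show thesis by (rule that)
qed

end

section \<open>Limits of the truncated transforms\<close>

context diffusion_density begin

definition p_mean :: "(real \<Rightarrow> complex) \<Rightarrow> real \<Rightarrow> complex" where
  "p_mean g t = (LINT y|lborel. g y * of_real (p y t))"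

lemma p_mean_integrable:
  assumes g: "continuous_on UNIV g" "\<And>y. norm (g y) \<le> M" and t: "0 < t"
  shows "integrable lborel (\<lambda>y. g y * complex_of_real (p y t))"
proof (rule Bochner_Integration.integrable_bound)
  have pi: "integrable lborel (\<lambda>y. p y t)" using p_mass[OF t] by (simp add: has_bochner_integral_iff)
  then show "integrable lborel (\<lambda>y. M * p y t)" by simp
  show "(\<lambda>y. g y * complex_of_real (p y t)) \<in> borel_measurable lborel"
    using borel_measurable_continuous_onI[OF g(1)] pi by simp
  show "AE y in lborel. norm (g y * complex_of_real (p y t)) \<le> norm (M * p y t)"
    by (intro AE_I2) (auto simp: norm_mult abs_mult intro!: mult_right_mono order_trans[OF g(2) abs_ge_self])
qed

lemma norm_p_mean_le:
  assumes g: "continuous_on UNIV g" "\<And>y. norm (g y) \<le> M" and t: "0 < t"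
  shows "norm (p_mean g t) \<le> M"
proof -
  have "norm (p_mean g t) \<le> (LINT y|lborel. M * p y t)"
    unfolding p_mean_def
    using p_mean_integrable[OF g t] p_mass[OF t] p_nonneg[OF t] g(2)
    by (intro Bochner_Integration.integral_norm_bound_integral)
      (auto simp: has_bochner_integral_iff norm_mult intro!: mult_right_mono)
  also have "\<dots> = M" using p_mass[OF t] by (simp add: has_bochner_integral_iff)
  finally show ?thesis .
qed

text \<open>The Dirac condition speaks of real test functions, so it is applied to real and
  imaginary parts separately.\<close>

lemma p_mean_initial:
  assumes g: "continuous_on UNIV g" "\<And>y. norm (g y) \<le> M"
  shows "(p_mean g \<longlongrightarrow> g x0) (at_right 0)"
proof -
  have part: "((\<lambda>t. LINT y|lborel. h (g y) * p y t) \<longlongrightarrow> h (g x0)) (at_right 0)"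
    if h: "h = Re \<or> h = Im" for h
  proof (rule p_initial)
    show "continuous_on UNIV (\<lambda>y. h (g y))"
      using h g(1) by (auto intro!: continuous_intros)
    show "bounded (range (\<lambda>y. h (g y)))"
      using h g(2) abs_Re_le_cmod abs_Im_le_cmod by (intro boundedI[of _ M]) (auto intro: order_trans)
  qed
  have eq: "Re (p_mean g t) = (LINT y|lborel. Re (g y) * p y t)" "Im (p_mean g t) = (LINT y|lborel. Im (g y) * p y t)"
    if "0 < t" for t
    unfolding p_mean_def using p_mean_integrable[OF g that] by (simp_all flip: integral_Re integral_Im)
  have ev: "\<forall>\<^sub>F t::real in at_right 0. 0 < t" by (rule eventually_at_right_less)
  show ?thesis
    unfolding tendsto_complex_iff
  proof
    show "((\<lambda>t. Re (p_mean g t)) \<longlongrightarrow> Re (g x0)) (at_right 0)"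
      by (rule Lim_transform_eventually[OF part[of Re] eventually_mono[OF ev]]) (simp_all add: eq)
    show "((\<lambda>t. Im (p_mean g t)) \<longlongrightarrow> Im (g x0)) (at_right 0)"
      by (rule Lim_transform_eventually[OF part[of Im] eventually_mono[OF ev]]) (simp_all add: eq)
  qed
qed

lemma set_integrable_truncated:
  "0 < \<epsilon> \<Longrightarrow> set_integrable lborel {\<epsilon>..T} (\<lambda>t. exp (- (\<theta> * of_real t)) * complex_of_real (p x t))"
  by (intro borel_integrable_atLeastAtMost' continuous_intros continuous_on_subset[OF p_continuous_snd]) auto

lemma truncated_laplace_eq_lebesgue:
  "0 < \<epsilon> \<Longrightarrow> truncated_laplace \<theta> \<epsilon> T x =
    (LINT t:{\<epsilon>..T}|lborel. exp (- (\<theta> * of_real t)) * complex_of_real (p x t))"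
  unfolding truncated_laplace_def by (rule set_borel_integral_eq_integral(2)[OF set_integrable_truncated, symmetric])

text \<open>The successor keeps both endpoints positive and in order from n = 0 on, where the window
  is the single point 1.\<close>

abbreviation "window n \<equiv> {inverse (real (Suc n))..real (Suc n)}"

lemma window_pos: "t \<in> window n \<Longrightarrow> 0 < t"
  using less_le_trans[of 0 "inverse (real (Suc n))" t] by (simp del: of_nat_Suc)

lemma window_indicator_tendsto:
  fixes f :: "real \<Rightarrow> 'a :: real_normed_vector"
  shows "(\<lambda>n. indicator (window n) t *\<^sub>R f t) \<longlonglongrightarrow> indicator {0<..} t *\<^sub>R f t"
proof (cases "0 < t")
  case True
  have "(\<lambda>n. inverse (real (Suc n))) \<longlonglongrightarrow> 0" by (rule LIMSEQ_inverse_real_of_nat)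
  then have "\<forall>\<^sub>F n in sequentially. inverse (real (Suc n)) < t" using True by (rule order_tendstoD)
  moreover have "\<forall>\<^sub>F n in sequentially. t \<le> real (Suc n)"
    by real_asymp
  ultimately have "\<forall>\<^sub>F n in sequentially. indicator (window n) t *\<^sub>R f t = indicator {0<..} t *\<^sub>R f t"
    by eventually_elim (use True in \<open>auto simp: indicator_def\<close>)
  then show ?thesis by (rule tendsto_eventually)
next
  case False
  then have "t \<notin> window n" for n using window_pos by blast
  then show ?thesis using False by simp
qed

text \<open>For real \<open>\<theta>\<close> the truncated transforms increase, so their convergence gives integrability.\<close>

lemma laplace_integrable:
  assumes lim: "convergent (\<lambda>n. truncated_laplace (of_real \<sigma>) (inverse (real (Suc n))) (real (Suc n)) x)"
    and \<theta>: "Re \<theta> = \<sigma>"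
  shows "set_integrable lborel {0<..} (\<lambda>t. exp (- (\<theta> * of_real t)) * complex_of_real (p x t))"
proof -
  let ?f = "\<lambda>t. exp (- (\<sigma> * t)) * p x t"
  have cont: "continuous_on {0<..} ?f" by (intro continuous_intros p_continuous_snd)
  have int: "set_integrable lborel (window n) ?f" for n
    by (intro borel_integrable_atLeastAtMost' continuous_on_subset[OF cont])
      (auto simp del: atLeastAtMost_iff intro: window_pos)
  obtain L where L: "(\<lambda>n. truncated_laplace (of_real \<sigma>) (inverse (real (Suc n))) (real (Suc n)) x) \<longlonglongrightarrow> L"
    using lim by (auto simp: convergent_def)
  have "truncated_laplace (of_real \<sigma>) (inverse (real (Suc n))) (real (Suc n)) x
      = of_real (LINT t:window n|lborel. ?f t)" for n
  proof -
    have "(\<lambda>t. exp (- (complex_of_real \<sigma> * of_real t)) * complex_of_real (p x t)) = (\<lambda>t. of_real (?f t))"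
      by (simp add: fun_eq_iff flip: exp_of_real)
    then show ?thesis
      by (subst truncated_laplace_eq_lebesgue) (simp_all only: set_integral_complex_of_real positive_imp_inverse_positive of_nat_0_less_iff zero_less_Suc)
  qed
  then have "(\<lambda>n. Re (of_real (LINT t:window n|lborel. ?f t))) \<longlonglongrightarrow> Re L"
    using tendsto_Re[OF L] by simp
  then have ilim: "(\<lambda>n. LINT t|lborel. indicator (window n) t *\<^sub>R ?f t) \<longlonglongrightarrow> Re L"
    by (simp add: set_lebesgue_integral_def)
  have "integrable lborel (\<lambda>t. indicator {0<..} t *\<^sub>R ?f t)"
  proof (rule integrable_monotone_convergence[OF _ _ _ ilim])
    show "integrable lborel (\<lambda>t. indicator (window n) t *\<^sub>R ?f t)" for n
      using int[of n] by (simp add: set_integrable_def)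
    show "AE t in lborel. mono (\<lambda>n. indicator (window n) t *\<^sub>R ?f t)"
    proof (intro AE_I2 monoI)
      fix t and m n :: nat assume mn: "m \<le> n"
      show "indicator (window m) t *\<^sub>R ?f t \<le> indicator (window n) t *\<^sub>R ?f t"
      proof (cases "t \<in> window m")
        case True
        have "inverse (real (Suc n)) \<le> inverse (real (Suc m))" using mn by (intro le_imp_inverse_le) auto
        moreover have "real (Suc m) \<le> real (Suc n)" using mn by simp
        ultimately have "t \<in> window n" using True by (meson atLeastAtMost_iff order_trans)
        then show ?thesis using True by simp
      next
        case False
        then show ?thesis
          using p_nonneg[of t x] window_pos[of t n] by (simp add: indicator_def del: atLeastAtMost_iff)
      qed
    qed
    show "AE t in lborel. (\<lambda>n. indicator (window n) t *\<^sub>R ?f t) \<longlonglongrightarrow> indicator {0<..} t *\<^sub>R ?f t"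
      by (intro AE_I2 window_indicator_tendsto)
    show "(\<lambda>t. indicator {0<..} t *\<^sub>R ?f t) \<in> borel_measurable lborel"
      using borel_measurable_continuous_on_indicator[OF _ cont] by simp
  qed
  then have "set_integrable lborel {0<..} ?f" by (simp add: set_integrable_def)
  \<comment> \<open>The modulus of e^(-\<theta> t) is e^(-\<sigma> t), so the real integrand
    dominates the complex one.\<close>
  then show ?thesis
  proof (rule set_integrable_bound)
    have c: "continuous_on {0<..} (\<lambda>t. exp (- (\<theta> * of_real t)) * complex_of_real (p x t))"
      by (intro continuous_intros p_continuous_snd)
    show "set_borel_measurable lborel {0<..} (\<lambda>t. exp (- (\<theta> * of_real t)) * complex_of_real (p x t))"
      unfolding set_borel_measurable_def using borel_measurable_continuous_on_indicator[OF _ c] by simp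
    show "AE t in lborel. t \<in> {0<..} \<longrightarrow> norm (exp (- (\<theta> * of_real t)) * complex_of_real (p x t)) \<le> norm (?f t)"
      by (simp add: norm_mult abs_mult \<theta>)
  qed
qed

text \<open>Convergence of the truncated integrals at \<theta> could be merely conditional. The
  sequence at Re \<theta> supplies absolute integrability, after which dominated convergence
  identifies L.\<close>

lemma has_laplace_transformI:
  assumes real: "convergent (\<lambda>n. truncated_laplace (of_real (Re \<theta>)) (inverse (real (Suc n))) (real (Suc n)) x)"
    and lim: "(\<lambda>n. truncated_laplace \<theta> (inverse (real (Suc n))) (real (Suc n)) x) \<longlonglongrightarrow> L"
  shows "has_laplace_transform (p x) \<theta> L"
proof -
  let ?f = "\<lambda>t. exp (- (\<theta> * of_real t)) * complex_of_real (p x t)"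
  have int: "set_integrable lborel {0<..} ?f"
    using laplace_integrable[OF real] by simp
  have "(\<lambda>n. LINT t|lborel. indicator (window n) t *\<^sub>R ?f t) \<longlonglongrightarrow> (LINT t|lborel. indicator {0<..} t *\<^sub>R ?f t)"
  proof (rule integral_dominated_convergence)
    show "integrable lborel (\<lambda>t. norm (indicator {0<..} t *\<^sub>R ?f t))"
      using int by (intro integrable_norm) (simp add: set_integrable_def)
    show "(\<lambda>t. indicator {0<..} t *\<^sub>R ?f t) \<in> borel_measurable lborel"
      using int by (simp add: set_integrable_def)
    show "(\<lambda>t. indicator (window n) t *\<^sub>R ?f t) \<in> borel_measurable lborel" for n
      using set_integrable_truncated[of "inverse (real (Suc n))" "real (Suc n)"] by (simp add: set_integrable_def)
    show "AE t in lborel. (\<lambda>n. indicator (window n) t *\<^sub>R ?f t) \<longlonglongrightarrow> indicator {0<..} t *\<^sub>R ?f t"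
      by (intro AE_I2 window_indicator_tendsto)
    show "AE t in lborel. norm (indicator (window n) t *\<^sub>R ?f t) \<le> norm (indicator {0<..} t *\<^sub>R ?f t)" for n
      using window_pos[of _ n] by (intro AE_I2) (auto simp: indicator_def simp del: atLeastAtMost_iff)
  qed
  also have "(\<lambda>n. LINT t|lborel. indicator (window n) t *\<^sub>R ?f t) =
      (\<lambda>n. truncated_laplace \<theta> (inverse (real (Suc n))) (real (Suc n)) x)"
    by (simp add: truncated_laplace_eq_lebesgue set_lebesgue_integral_def)
  finally have "L = (LINT t:{0<..}|lborel. ?f t)"
    using lim unfolding set_lebesgue_integral_def by (rule LIMSEQ_unique[rotated])
  with int show ?thesis by (simp add: has_laplace_transform_def)
qed

end

text \<open>The pair of adjoint solutions is kept abstract so that the limit argument can be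
  instantiated both at \<theta> and at Re \<theta>.\<close>

locale green_functions = diffusion_density +
  fixes \<theta> :: complex and u1 v1 u2 v2 :: "real \<Rightarrow> complex"
  assumes Re_pos: "0 < Re \<theta>"
    and u1: "(u1 has_vector_derivative v1 y) (at y)"
    and v1: "(v1 has_vector_derivative \<theta> * u1 y - of_real (drift \<beta> \<eta> y) * v1 y) (at y)"
    and u2: "(u2 has_vector_derivative v2 y) (at y)"
    and v2: "(v2 has_vector_derivative \<theta> * u2 y - of_real (drift \<beta> \<eta> y) * v2 y) (at y)"
    and bounded1: "\<exists>M. \<forall>y\<le>z. norm (u1 y) \<le> M \<and> norm (v1 y) \<le> M"
    and bounded2: "\<exists>M. \<forall>y\<ge>z. norm (u2 y) \<le> M \<and> norm (v2 y) \<le> M"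
    and wronskian_nonzero: "v1 0 * u2 0 - u1 0 * v2 0 \<noteq> 0"
begin

text \<open>The weight is taken at x rather than x0: Green's identity divides by the Wronskian at x,
  which equals W / m(x).\<close>

definition "green x = u1 (min x x0) * u2 (max x x0) * of_real (drift_weight \<beta> \<eta> x) / (v1 0 * u2 0 - u1 0 * v2 0)"

text \<open>The function g is bounded and continuous, so the lower endpoint yields g(x0) through the
  initial condition, while the upper endpoint contributes at most e^(-Re \<theta> T) M1 M2.\<close>

lemma truncated_laplace_tendsto:
  "(\<lambda>n. truncated_laplace \<theta> (inverse (real (Suc n))) (real (Suc n)) x) \<longlonglongrightarrow> green x"
proof -
  define g where "g y = u1 (min x y) * u2 (max x y)" for y
  define W where "W = v1 0 * u2 0 - u1 0 * v2 0"
  define m where "m = complex_of_real (drift_weight \<beta> \<eta> x)"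
  have m: "m \<noteq> 0" by (simp add: m_def drift_weight_def)
  have W: "W \<noteq> 0" using wronskian_nonzero by (simp add: W_def)
  have mW: "m * (v1 x * u2 x - u1 x * v2 x) = W"
    unfolding m_def W_def by (rule drift_weight_wronskian[OF u1 v1 u2 v2])
  obtain M1 where M1: "\<And>y. y \<le> x \<Longrightarrow> norm (u1 y) \<le> M1" "\<And>y. y \<le> x \<Longrightarrow> norm (v1 y) \<le> M1"
    using bounded1[of x] by blast
  obtain M2 where M2: "\<And>y. x \<le> y \<Longrightarrow> norm (u2 y) \<le> M2" "\<And>y. x \<le> y \<Longrightarrow> norm (v2 y) \<le> M2"
    using bounded2[of x] by blast
  have c1: "continuous_on UNIV u1" and c2: "continuous_on UNIV u2"
    by (rule has_vector_derivative_imp_continuous_on[OF u1] has_vector_derivative_imp_continuous_on[OF u2])+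
  have g_cont: "continuous_on UNIV g"
    unfolding g_def
    by (intro continuous_on_mult continuous_on_compose2[OF c1] continuous_on_compose2[OF c2] continuous_intros) auto
  \<comment> \<open>The minimum never exceeds x and the maximum never falls below it, so the
    one-sided bounds combine into one valid for all y.\<close>
  have g_le: "norm (g y) \<le> M1 * M2" for y
    unfolding g_def norm_mult using M1(1)[of x] by (intro mult_mono M1 M2) (auto intro: order_trans[OF norm_ge_zero])
  have identity: "truncated_laplace \<theta> \<epsilon> T x =
      (exp (- (\<theta> * of_real \<epsilon>)) * p_mean g \<epsilon> - exp (- (\<theta> * of_real T)) * p_mean g T) * m / W"
    if e: "0 < \<epsilon>" "\<epsilon> \<le> T" for \<epsilon> T
  proof -
    obtain F where "forced_equation (drift \<beta> \<eta>) (\<bar>\<beta>\<bar> + \<eta> + 1) \<theta> (truncated_laplace \<theta> \<epsilon> T) F (endpoint_difference \<theta> \<epsilon> T)"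
      using truncated_laplace_forced_equation[OF e] .
    then interpret forced_equation "drift \<beta> \<eta>" "\<bar>\<beta>\<bar> + \<eta> + 1" \<theta> "truncated_laplace \<theta> \<epsilon> T" F "endpoint_difference \<theta> \<epsilon> T" .
    have "(u1 x * v2 x - v1 x * u2 x) * truncated_laplace \<theta> \<epsilon> T x = (LINT y|lborel. g y * endpoint_difference \<theta> \<epsilon> T y)"
      unfolding g_def by (rule green_identity[symmetric]) (fact u1 v1 u2 v2 | erule M1 M2)+
    also have "\<dots> = (LINT y|lborel. exp (- (\<theta> * of_real T)) * (g y * of_real (p y T)) - exp (- (\<theta> * of_real \<epsilon>)) * (g y * of_real (p y \<epsilon>)))"
      by (simp add: endpoint_difference_def algebra_simps)
    also have "\<dots> = exp (- (\<theta> * of_real T)) * p_mean g T - exp (- (\<theta> * of_real \<epsilon>)) * p_mean g \<epsilon>"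
      unfolding p_mean_def using e p_mean_integrable[OF g_cont g_le, of T] p_mean_integrable[OF g_cont g_le, of \<epsilon>]
      by (subst Bochner_Integration.integral_diff) auto
    finally have "exp (- (\<theta> * of_real \<epsilon>)) * p_mean g \<epsilon> - exp (- (\<theta> * of_real T)) * p_mean g T
        = (v1 x * u2 x - u1 x * v2 x) * truncated_laplace \<theta> \<epsilon> T x"
      by (simp add: algebra_simps)
    then have "(exp (- (\<theta> * of_real \<epsilon>)) * p_mean g \<epsilon> - exp (- (\<theta> * of_real T)) * p_mean g T) * m
        = W * truncated_laplace \<theta> \<epsilon> T x"
      unfolding mW[symmetric] by (simp only: mult_ac)
    then show ?thesis using W by simp
  qed
  have e_lim: "filterlim (\<lambda>n. inverse (real (Suc n))) (at_right 0) sequentially"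
    using LIMSEQ_inverse_real_of_nat by (auto simp: filterlim_at intro: always_eventually)
  have l1: "(\<lambda>n. exp (- (\<theta> * of_real (inverse (real (Suc n))))) * p_mean g (inverse (real (Suc n)))) \<longlonglongrightarrow> exp (- (\<theta> * of_real 0)) * g x0"
    by (intro tendsto_intros LIMSEQ_inverse_real_of_nat filterlim_compose[OF p_mean_initial[OF g_cont g_le] e_lim])
  have l2: "(\<lambda>n. exp (- (\<theta> * of_real (real (Suc n)))) * p_mean g (real (Suc n))) \<longlonglongrightarrow> 0"
  proof (rule Lim_null_comparison)
    show "\<forall>\<^sub>F n in sequentially. norm (exp (- (\<theta> * of_real (real (Suc n)))) * p_mean g (real (Suc n)))
        \<le> exp (- (Re \<theta> * real (Suc n))) * (M1 * M2)"
      using norm_p_mean_le[OF g_cont g_le] by (intro always_eventually allI) (simp add: norm_mult)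
    have "(\<lambda>n. exp (- (Re \<theta> * real (Suc n)))) \<longlonglongrightarrow> 0" using Re_pos by real_asymp
    then show "(\<lambda>n. exp (- (Re \<theta> * real (Suc n))) * (M1 * M2)) \<longlonglongrightarrow> 0" by (rule tendsto_mult_left_zero)
  qed
  have "(\<lambda>n. (exp (- (\<theta> * of_real (inverse (real (Suc n))))) * p_mean g (inverse (real (Suc n)))
      - exp (- (\<theta> * of_real (real (Suc n)))) * p_mean g (real (Suc n))) * m / W) \<longlonglongrightarrow> (exp (- (\<theta> * of_real 0)) * g x0 - 0) * m / W"
    by (intro tendsto_divide tendsto_mult[OF tendsto_diff[OF l1 l2]] tendsto_const W)
  moreover have "inverse (real (Suc n)) \<le> real (Suc n)" for n
    by (simp add: inverse_eq_divide divide_le_eq) (simp add: algebra_simps)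
  ultimately show ?thesis
    by (simp only: identity positive_imp_inverse_positive of_nat_0_less_iff zero_less_Suc)
      (simp add: green_def g_def W_def m_def)
qed

end

section \<open>The Green function\<close>

text \<open>The case k = -1, d = -\<beta> of the scaling lemma, bounded at -\<infinity>. Its mirror
  image, k = 1 and d = \<beta>, is used to continue the right-hand solution to negative y.\<close>

lemma hermite_fn_left_solution:
  assumes "0 < Re \<theta>"
  shows "((\<lambda>y. hermite_fn \<theta> (of_real (- y - \<beta>))) has_vector_derivative - hermite_fn' \<theta> (of_real (- y - \<beta>))) (at y)"
    and "((\<lambda>y. - hermite_fn' \<theta> (of_real (- y - \<beta>))) has_vector_derivative
      \<theta> * hermite_fn \<theta> (of_real (- y - \<beta>)) + of_real (\<beta> + y) * - hermite_fn' \<theta> (of_real (- y - \<beta>))) (at y)"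
proof -
  have k: "(- 1 :: real) \<noteq> 0" "(- 1 :: real)\<^sup>2 = 1" by simp_all
  have arg: "- 1 * y + - \<beta> = - y - \<beta>" for y by simp
  have coeff: "- 1 * (- y - \<beta>) = \<beta> + y" by simp
  note sol = hermite_fn_scaled_solution[OF assms k(1), of "- \<beta>" y,
      unfolded k(2) arg coeff of_real_1 div_by_1, unfolded of_real_minus[of 1] of_real_1 mult_minus1]
  show "((\<lambda>y. hermite_fn \<theta> (of_real (- y - \<beta>))) has_vector_derivative - hermite_fn' \<theta> (of_real (- y - \<beta>))) (at y)"
    by (rule sol(1))
  show "((\<lambda>y. - hermite_fn' \<theta> (of_real (- y - \<beta>))) has_vector_derivative
      \<theta> * hermite_fn \<theta> (of_real (- y - \<beta>)) + of_real (\<beta> + y) * - hermite_fn' \<theta> (of_real (- y - \<beta>))) (at y)"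
    by (rule sol(2))
qed

lemma hermite_fn_left_solution_reflected:
  assumes "0 < Re \<theta>"
  shows "((\<lambda>y. hermite_fn \<theta> (of_real (y + \<beta>))) has_vector_derivative hermite_fn' \<theta> (of_real (y + \<beta>))) (at y)"
    and "((\<lambda>y. hermite_fn' \<theta> (of_real (y + \<beta>))) has_vector_derivative
      \<theta> * hermite_fn \<theta> (of_real (y + \<beta>)) + of_real (\<beta> + y) * hermite_fn' \<theta> (of_real (y + \<beta>))) (at y)"
  using hermite_fn_scaled_solution[OF assms, of 1 \<beta> y] by (simp_all add: add.commute)

text \<open>The case k = sqrt \<eta>, d = \<beta> / sqrt \<eta>, bounded at +\<infinity>. The
  version with both signs reversed is used to continue the left-hand solution to positive y.\<close>

lemma hermite_fn_right_solution:
  assumes "0 < Re \<theta>" "0 < \<eta>"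
  shows "((\<lambda>y. hermite_fn (\<theta> / of_real \<eta>) (of_real ((\<eta> * y + \<beta>) / sqrt \<eta>))) has_vector_derivative
      of_real (sqrt \<eta>) * hermite_fn' (\<theta> / of_real \<eta>) (of_real ((\<eta> * y + \<beta>) / sqrt \<eta>))) (at y)"
    and "((\<lambda>y. of_real (sqrt \<eta>) * hermite_fn' (\<theta> / of_real \<eta>) (of_real ((\<eta> * y + \<beta>) / sqrt \<eta>))) has_vector_derivative
      \<theta> * hermite_fn (\<theta> / of_real \<eta>) (of_real ((\<eta> * y + \<beta>) / sqrt \<eta>))
      + of_real (\<beta> + \<eta> * y) * (of_real (sqrt \<eta>) * hermite_fn' (\<theta> / of_real \<eta>) (of_real ((\<eta> * y + \<beta>) / sqrt \<eta>)))) (at y)"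
proof -
  have k: "sqrt \<eta> \<noteq> 0" "(sqrt \<eta>)\<^sup>2 = \<eta>" using assms by auto
  have arg: "sqrt \<eta> * y + \<beta> / sqrt \<eta> = (\<eta> * y + \<beta>) / sqrt \<eta>" for y
    using assms k by (simp add: field_simps)
  have coeff: "sqrt \<eta> * ((\<eta> * y + \<beta>) / sqrt \<eta>) = \<beta> + \<eta> * y" using k(1) by simp
  show "((\<lambda>y. hermite_fn (\<theta> / of_real \<eta>) (of_real ((\<eta> * y + \<beta>) / sqrt \<eta>))) has_vector_derivative
      of_real (sqrt \<eta>) * hermite_fn' (\<theta> / of_real \<eta>) (of_real ((\<eta> * y + \<beta>) / sqrt \<eta>))) (at y)"
    using hermite_fn_scaled_solution(1)[OF assms(1) k(1), of "\<beta> / sqrt \<eta>" y] unfolding k(2) arg .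
  show "((\<lambda>y. of_real (sqrt \<eta>) * hermite_fn' (\<theta> / of_real \<eta>) (of_real ((\<eta> * y + \<beta>) / sqrt \<eta>))) has_vector_derivative
      \<theta> * hermite_fn (\<theta> / of_real \<eta>) (of_real ((\<eta> * y + \<beta>) / sqrt \<eta>))
      + of_real (\<beta> + \<eta> * y) * (of_real (sqrt \<eta>) * hermite_fn' (\<theta> / of_real \<eta>) (of_real ((\<eta> * y + \<beta>) / sqrt \<eta>)))) (at y)"
    using hermite_fn_scaled_solution(2)[OF assms(1) k(1), of "\<beta> / sqrt \<eta>" y] unfolding k(2) arg coeff .
qed

lemma hermite_fn_right_solution_reflected:
  assumes "0 < Re \<theta>" "0 < \<eta>"
  shows "((\<lambda>y. hermite_fn (\<theta> / of_real \<eta>) (of_real (- (\<eta> * y + \<beta>) / sqrt \<eta>))) has_vector_derivative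
      - of_real (sqrt \<eta>) * hermite_fn' (\<theta> / of_real \<eta>) (of_real (- (\<eta> * y + \<beta>) / sqrt \<eta>))) (at y)"
    and "((\<lambda>y. - of_real (sqrt \<eta>) * hermite_fn' (\<theta> / of_real \<eta>) (of_real (- (\<eta> * y + \<beta>) / sqrt \<eta>))) has_vector_derivative
      \<theta> * hermite_fn (\<theta> / of_real \<eta>) (of_real (- (\<eta> * y + \<beta>) / sqrt \<eta>))
      + of_real (\<beta> + \<eta> * y) * (- of_real (sqrt \<eta>) * hermite_fn' (\<theta> / of_real \<eta>) (of_real (- (\<eta> * y + \<beta>) / sqrt \<eta>)))) (at y)"
proof -
  have k: "- sqrt \<eta> \<noteq> 0" "(- sqrt \<eta>)\<^sup>2 = \<eta>" using assms by auto
  have arg: "- sqrt \<eta> * y + - (\<beta> / sqrt \<eta>) = - (\<eta> * y + \<beta>) / sqrt \<eta>" for y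
    using assms k by (simp add: field_simps)
  have coeff: "- sqrt \<eta> * (- (\<eta> * y + \<beta>) / sqrt \<eta>) = \<beta> + \<eta> * y" using k(1) by simp
  show "((\<lambda>y. hermite_fn (\<theta> / of_real \<eta>) (of_real (- (\<eta> * y + \<beta>) / sqrt \<eta>))) has_vector_derivative
      - of_real (sqrt \<eta>) * hermite_fn' (\<theta> / of_real \<eta>) (of_real (- (\<eta> * y + \<beta>) / sqrt \<eta>))) (at y)"
    using hermite_fn_scaled_solution(1)[OF assms(1) k(1), of "- (\<beta> / sqrt \<eta>)" y] unfolding k(2) arg of_real_minus[of "sqrt \<eta>"] .
  show "((\<lambda>y. - of_real (sqrt \<eta>) * hermite_fn' (\<theta> / of_real \<eta>) (of_real (- (\<eta> * y + \<beta>) / sqrt \<eta>))) has_vector_derivative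
      \<theta> * hermite_fn (\<theta> / of_real \<eta>) (of_real (- (\<eta> * y + \<beta>) / sqrt \<eta>))
      + of_real (\<beta> + \<eta> * y) * (- of_real (sqrt \<eta>) * hermite_fn' (\<theta> / of_real \<eta>) (of_real (- (\<eta> * y + \<beta>) / sqrt \<eta>)))) (at y)"
    using hermite_fn_scaled_solution(2)[OF assms(1) k(1), of "- (\<beta> / sqrt \<eta>)" y] unfolding k(2) arg coeff of_real_minus[of "sqrt \<eta>"] .
qed

lemma solution_combine:
  fixes f f' g g' :: "real \<Rightarrow> complex"
  assumes "(f has_vector_derivative f' y) (at y)" "(f' has_vector_derivative \<theta> * f y + c * f' y) (at y)"
    and "(g has_vector_derivative g' y) (at y)" "(g' has_vector_derivative \<theta> * g y + c * g' y) (at y)"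
  shows "((\<lambda>y. A * f y + B * g y) has_vector_derivative A * f' y + B * g' y) (at y)"
    and "((\<lambda>y. A * f' y + B * g' y) has_vector_derivative \<theta> * (A * f y + B * g y) + c * (A * f' y + B * g' y)) (at y)"
proof -
  show "((\<lambda>y. A * f y + B * g y) has_vector_derivative A * f' y + B * g' y) (at y)"
    by (intro has_vector_derivative_add has_vector_derivative_mult_right assms)
  have "((\<lambda>y. A * f' y + B * g' y) has_vector_derivative A * (\<theta> * f y + c * f' y) + B * (\<theta> * g y + c * g' y)) (at y)"
    by (intro has_vector_derivative_add has_vector_derivative_mult_right assms)
  then show "((\<lambda>y. A * f' y + B * g' y) has_vector_derivative \<theta> * (A * f y + B * g y) + c * (A * f' y + B * g' y)) (at y)"
    by (simp add: algebra_simps)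
qed

text \<open>Each bounded solution is continued across 0 by a combination of the two solutions on the
  other side. The constant \<kappa> is the reciprocal of the Wronskian of the left pair at 0, the
  source of the factor Gamma(\<theta>) / sqrt(2 pi) in the final formulas. Values of u1 are recorded
  for y \<le> 0, which covers min x x0 when x0 < 0.\<close>

lemma (in diffusion_density) green_functions_exist:
  assumes \<theta>: "0 < Re \<theta>"
  defines "\<kappa> \<equiv> Gamma \<theta> * of_real (exp (- \<beta>\<^sup>2 / 2)) / of_real (sqrt (2 * pi))"
  obtains u1 v1 u2 v2 where "green_functions \<beta> \<eta> x0 p \<theta> u1 v1 u2 v2"
    and "\<And>y. y \<le> 0 \<Longrightarrow> u1 y = hermite_fn \<theta> (of_real (- y - \<beta>))"
    and "\<And>y. y \<le> 0 \<Longrightarrow> u2 y = \<kappa> * (reflected_wronskian \<theta> \<eta> \<beta> * hermite_fn \<theta> (of_real (- y - \<beta>))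
        + left_right_wronskian \<theta> \<eta> \<beta> * hermite_fn \<theta> (of_real (y + \<beta>)))"
    and "\<And>y. 0 < y \<Longrightarrow> u2 y = hermite_fn (\<theta> / of_real \<eta>) (of_real ((\<eta> * y + \<beta>) / sqrt \<eta>))"
    and "v1 0 * u2 0 - u1 0 * v2 0 = left_right_wronskian \<theta> \<eta> \<beta>"
proof -
  have \<theta>': "0 < Re (\<theta> / of_real \<eta>)" using \<theta> eta by simp
  define l1 where "l1 y = hermite_fn \<theta> (of_real (- y - \<beta>))" for y
  define l1' where "l1' y = - hermite_fn' \<theta> (of_real (- y - \<beta>))" for y
  define l2 where "l2 y = hermite_fn \<theta> (of_real (y + \<beta>))" for y
  define l2' where "l2' y = hermite_fn' \<theta> (of_real (y + \<beta>))" for y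
  define r1 where "r1 y = hermite_fn (\<theta> / of_real \<eta>) (of_real (- (\<eta> * y + \<beta>) / sqrt \<eta>))" for y
  define r1' where "r1' y = - of_real (sqrt \<eta>) * hermite_fn' (\<theta> / of_real \<eta>) (of_real (- (\<eta> * y + \<beta>) / sqrt \<eta>))" for y
  define r2 where "r2 y = hermite_fn (\<theta> / of_real \<eta>) (of_real ((\<eta> * y + \<beta>) / sqrt \<eta>))" for y
  define r2' where "r2' y = of_real (sqrt \<eta>) * hermite_fn' (\<theta> / of_real \<eta>) (of_real ((\<eta> * y + \<beta>) / sqrt \<eta>))" for y
  note l1 = hermite_fn_left_solution[OF \<theta>, of \<beta>, folded l1_def l1'_def]
  note l2 = hermite_fn_left_solution_reflected[OF \<theta>, of \<beta>, folded l2_def l2'_def]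
  note r1 = hermite_fn_right_solution_reflected[OF \<theta> eta, of \<beta>, folded r1_def r1'_def]
  note r2 = hermite_fn_right_solution[OF \<theta> eta, of \<beta>, folded r2_def r2'_def]
  define W where "W = left_right_wronskian \<theta> \<eta> \<beta>"
  define N where "N = reflected_wronskian \<theta> \<eta> \<beta>"
  have W: "W = l1' 0 * r2 0 - l1 0 * r2' 0" and N: "N = l2 0 * r2' 0 - l2' 0 * r2 0"
    by (simp_all add: W_def N_def left_right_wronskian_def reflected_wronskian_def l1_def l1'_def l2_def l2'_def r2_def r2'_def)
  have W0: "W \<noteq> 0" unfolding W_def by (rule left_right_wronskian_nonzero[OF eta \<theta>])
  have G: "Gamma \<theta> \<noteq> 0" using not_nonpos_Ints_Re_pos[OF \<theta>] by (simp add: Gamma_eq_zero_iff)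
  have K: "\<kappa> * (l1' 0 * l2 0 - l1 0 * l2' 0) = 1"
  proof -
    have "l1' 0 * l2 0 - l1 0 * l2' 0 = - (hermite_fn' \<theta> (of_real (- \<beta>)) * hermite_fn \<theta> (- of_real (- \<beta>))
        + hermite_fn \<theta> (of_real (- \<beta>)) * hermite_fn' \<theta> (- of_real (- \<beta>)))"
      by (simp add: l1_def l1'_def l2_def l2'_def)
    also have "\<dots> = exp ((of_real (- \<beta>))\<^sup>2 / 2) * of_real (sqrt (2 * pi)) / Gamma \<theta>"
      unfolding hermite_fn_wronskian[OF \<theta>] by simp
    finally show ?thesis
      unfolding \<kappa>_def using G by (simp add: exp_minus field_simps flip: exp_of_real del: real_sqrt_mult)
  qed
  \<comment> \<open>Cramer's rule for continuing \<open>l1\<close> by \<open>r1\<close> and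
    \<open>r2\<close>; the denominator is the Wronskian of that pair at 0.\<close>
  define A B where "A = (l1 0 * r2' 0 - l1' 0 * r2 0) / (r1 0 * r2' 0 - r1' 0 * r2 0)"
    and "B = (r1 0 * l1' 0 - r1' 0 * l1 0) / (r1 0 * r2' 0 - r1' 0 * r2 0)"
  have D: "r1 0 * r2' 0 - r1' 0 * r2 0 \<noteq> 0"
  proof -
    have "r1 0 * r2' 0 - r1' 0 * r2 0 = of_real (sqrt \<eta>) *
       (hermite_fn' (\<theta> / of_real \<eta>) (of_real (\<beta> / sqrt \<eta>)) * hermite_fn (\<theta> / of_real \<eta>) (- of_real (\<beta> / sqrt \<eta>))
        + hermite_fn (\<theta> / of_real \<eta>) (of_real (\<beta> / sqrt \<eta>)) * hermite_fn' (\<theta> / of_real \<eta>) (- of_real (\<beta> / sqrt \<eta>)))"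
      by (simp add: r1_def r1'_def r2_def r2'_def algebra_simps)
    moreover have "Gamma (\<theta> / of_real \<eta>) \<noteq> 0" using not_nonpos_Ints_Re_pos[OF \<theta>'] by (simp add: Gamma_eq_zero_iff)
    ultimately show ?thesis unfolding hermite_fn_wronskian[OF \<theta>'] using eta by simp
  qed
  have m1: "l1 0 = A * r1 0 + B * r2 0" "l1' 0 = A * r1' 0 + B * r2' 0"
    using D unfolding A_def B_def by (simp_all add: divide_simps) (simp_all add: algebra_simps)
  \<comment> \<open>Cramer's rule again: N and W are the Wronskians of \<open>r2\<close> with
    \<open>l2\<close> and \<open>l1\<close>, and \<kappa> divides by the Wronskian of the left
    pair.\<close>
  have m2: "\<kappa> * N * l1 0 + \<kappa> * W * l2 0 = r2 0" "\<kappa> * N * l1' 0 + \<kappa> * W * l2' 0 = r2' 0"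
  proof -
    have "\<kappa> * N * l1 0 + \<kappa> * W * l2 0 = \<kappa> * (l1' 0 * l2 0 - l1 0 * l2' 0) * r2 0"
      unfolding W N by (simp add: algebra_simps)
    then show "\<kappa> * N * l1 0 + \<kappa> * W * l2 0 = r2 0" unfolding K by simp
    have "\<kappa> * N * l1' 0 + \<kappa> * W * l2' 0 = \<kappa> * (l1' 0 * l2 0 - l1 0 * l2' 0) * r2' 0"
      unfolding W N by (simp add: algebra_simps)
    then show "\<kappa> * N * l1' 0 + \<kappa> * W * l2' 0 = r2' 0" unfolding K by simp
  qed
  define u1 where "u1 = (\<lambda>y. if y \<le> 0 then l1 y else A * r1 y + B * r2 y)"
  define v1 where "v1 = (\<lambda>y. if y \<le> 0 then l1' y else A * r1' y + B * r2' y)"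
  define u2 where "u2 = (\<lambda>y. if y \<le> 0 then \<kappa> * N * l1 y + \<kappa> * W * l2 y else r2 y)"
  define v2 where "v2 = (\<lambda>y. if y \<le> 0 then \<kappa> * N * l1' y + \<kappa> * W * l2' y else r2' y)"
  have d1: "(u1 has_vector_derivative v1 y) (at y)"
      "(v1 has_vector_derivative \<theta> * u1 y - of_real (drift \<beta> \<eta> y) * v1 y) (at y)" for y
    unfolding u1_def v1_def
    by (rule glued_solution[where \<theta> = \<theta> and \<beta> = \<beta> and \<eta> = \<eta>, OF l1 solution_combine[OF r1 r2] m1])+
  have d2: "(u2 has_vector_derivative v2 y) (at y)"
      "(v2 has_vector_derivative \<theta> * u2 y - of_real (drift \<beta> \<eta> y) * v2 y) (at y)" for y
    unfolding u2_def v2_def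
    by (rule glued_solution[where \<theta> = \<theta> and \<beta> = \<beta> and \<eta> = \<eta>, OF solution_combine[OF l1 l2] r2 m2])+
  have cont: "continuous_on UNIV u1" "continuous_on UNIV v1" "continuous_on UNIV u2" "continuous_on UNIV v2"
    by (rule has_vector_derivative_imp_continuous_on[OF d1(1)] has_vector_derivative_imp_continuous_on[OF d1(2)]
        has_vector_derivative_imp_continuous_on[OF d2(1)] has_vector_derivative_imp_continuous_on[OF d2(2)])+
  have W_eq: "v1 0 * u2 0 - u1 0 * v2 0 = W"
    by (simp add: u1_def v1_def u2_def v2_def m2) (simp add: W)
  have "green_functions \<beta> \<eta> x0 p \<theta> u1 v1 u2 v2"
  proof
    show "0 < Re \<theta>" by (rule \<theta>)
    show "\<exists>M. \<forall>y\<le>z. norm (u1 y) \<le> M \<and> norm (v1 y) \<le> M" for z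
    proof -
      \<comment> \<open>For y \<le> 0 the argument -y - \<beta> is at least -\<beta>, so one half
        plane serves the whole left branch.\<close>
      obtain C where C: "\<And>w. - \<beta> \<le> Re w \<Longrightarrow> norm (hermite_fn \<theta> w) \<le> C" "\<And>w. - \<beta> \<le> Re w \<Longrightarrow> norm (hermite_fn' \<theta> w) \<le> C"
        using hermite_fn_bounded[OF \<theta>, of "- \<beta>"] by blast
      show ?thesis
        by (intro bounded_pair bounded_atMost_extend[where c = 0 and C = C] cont)
          (auto simp: u1_def v1_def l1_def l1'_def intro!: C)
    qed
    show "\<exists>M. \<forall>y\<ge>z. norm (u2 y) \<le> M \<and> norm (v2 y) \<le> M" for z
    proof -
      obtain C where C: "\<And>w. \<beta> / sqrt \<eta> \<le> Re w \<Longrightarrow> norm (hermite_fn (\<theta> / of_real \<eta>) w) \<le> C"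
          "\<And>w. \<beta> / sqrt \<eta> \<le> Re w \<Longrightarrow> norm (hermite_fn' (\<theta> / of_real \<eta>) w) \<le> C"
        using hermite_fn_bounded[OF \<theta>', of "\<beta> / sqrt \<eta>"] by blast
      have le: "\<beta> / sqrt \<eta> \<le> Re (of_real ((\<eta> * y + \<beta>) / sqrt \<eta>))" if "0 \<le> y" for y
        using that eta by (simp only: Re_complex_of_real) (intro divide_right_mono, simp_all)
      have b: "norm (r2 y) \<le> C" "norm (r2' y) \<le> sqrt \<eta> * C" if "0 \<le> y" for y
        using C[OF le[OF that]] eta unfolding r2_def r2'_def norm_mult by (simp_all del: of_real_divide of_real_add of_real_mult)
      \<comment> \<open>The threshold 1 stays clear of y = 0, where \<open>u2\<close> is defined by
        its left branch.\<close>
      have "\<exists>M. \<forall>y\<ge>z. norm (u2 y) \<le> M"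
        by (rule bounded_atLeast_extend[OF cont(3), where c = 1 and C = C]) (simp add: u2_def b)
      moreover have "\<exists>M. \<forall>y\<ge>z. norm (v2 y) \<le> M"
        by (rule bounded_atLeast_extend[OF cont(4), where c = 1 and C = "sqrt \<eta> * C"]) (simp add: v2_def b)
      ultimately show ?thesis by (rule bounded_pair)
    qed
    show "v1 0 * u2 0 - u1 0 * v2 0 \<noteq> 0" unfolding W_eq by (rule W0)
  qed (rule d1 d2)+
  then show thesis
  proof (rule that)
    show "u1 y = hermite_fn \<theta> (of_real (- y - \<beta>))" if "y \<le> 0" for y
      using that by (simp only: u1_def l1_def if_True)
    show "u2 y = \<kappa> * (reflected_wronskian \<theta> \<eta> \<beta> * hermite_fn \<theta> (of_real (- y - \<beta>))
        + left_right_wronskian \<theta> \<eta> \<beta> * hermite_fn \<theta> (of_real (y + \<beta>)))" if "y \<le> 0" for y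
      using that by (simp only: u2_def l1_def l2_def if_True W_def[symmetric] N_def[symmetric] distrib_left mult.assoc)
    show "u2 y = hermite_fn (\<theta> / of_real \<eta>) (of_real ((\<eta> * y + \<beta>) / sqrt \<eta>))" if "0 < y" for y
      using that by (simp only: u2_def r2_def not_le[symmetric] if_False)
    show "v1 0 * u2 0 - u1 0 * v2 0 = left_right_wronskian \<theta> \<eta> \<beta>"
      using W_eq by (simp only: W_def)
  qed
qed

text \<open>A second Green function, built at Re \<theta>, proves convergence of the real truncated
  transforms and hence absolute integrability; the value comes from the given solutions.\<close>

lemma (in diffusion_density) laplace_transform_green:
  assumes "green_functions \<beta> \<eta> x0 p \<theta> u1 v1 u2 v2"
  shows "has_laplace_transform (p x) \<theta>
    (u1 (min x x0) * u2 (max x x0) * of_real (drift_weight \<beta> \<eta> x) / (v1 0 * u2 0 - u1 0 * v2 0))"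
proof -
  interpret green_functions \<beta> \<eta> x0 p \<theta> u1 v1 u2 v2 by fact
  obtain w1 z1 w2 z2 where "green_functions \<beta> \<eta> x0 p (of_real (Re \<theta>)) w1 z1 w2 z2"
    using Re_pos by (rule green_functions_exist[of "of_real (Re \<theta>)", unfolded Re_complex_of_real]) (rule that)
  then interpret rl: green_functions \<beta> \<eta> x0 p "of_real (Re \<theta>)" w1 z1 w2 z2 .
  have "has_laplace_transform (p x) \<theta> (green x)"
  proof (rule has_laplace_transformI)
    show "convergent (\<lambda>n. truncated_laplace (of_real (Re \<theta>)) (inverse (real (Suc n))) (real (Suc n)) x)"
      using rl.truncated_laplace_tendsto by (auto simp: convergent_def)
  qed (rule truncated_laplace_tendsto)
  then show ?thesis by (simp only: green_def)
qed

text \<open>V \<noteq> 0 is asserted together with the formulas because a quotient by 0 has the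
  default value 0. Each transform statement includes absolute convergence.\<close>

theorem theorem10:
  fixes \<beta> \<eta> x0 :: real and \<theta> :: complex and p :: "real \<Rightarrow> real \<Rightarrow> real"
  assumes "\<eta> > 0" and "x0 < 0" and "Re \<theta> > 0"
    and "transition_density \<beta> \<eta> x0 p"
  shows "\<V> \<theta> \<eta> \<beta> \<noteq> 0 \<and>
    (\<forall>x>0. has_laplace_transform (p x) \<theta>
       (of_real (exp (\<beta> * (x0 - x) / 2)) * of_real (exp ((x0\<^sup>2 - \<eta> * x\<^sup>2) / 4))
        * (parabolic_cylinder (- \<theta>) (of_real (- x0 - \<beta>))
           * parabolic_cylinder (- \<theta> / of_real \<eta>) (of_real ((\<eta> * x + \<beta>) / sqrt \<eta>))
           / \<V> \<theta> \<eta> \<beta>))) \<and>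
    (\<forall>x<x0. has_laplace_transform (p x) \<theta>
       (of_real (exp (\<beta> * (x0 - x) / 2)) * of_real (exp ((x0\<^sup>2 - x\<^sup>2) / 4))
        * (Gamma \<theta> * parabolic_cylinder (- \<theta>) (of_real (- x - \<beta>)) / of_real (sqrt (2 * pi)))
        * (parabolic_cylinder (- \<theta>) (of_real (x0 + \<beta>))
           + parabolic_cylinder (- \<theta>) (of_real (- x0 - \<beta>)) * (\<M> \<theta> \<eta> \<beta> / \<V> \<theta> \<eta> \<beta>)))) \<and>
    (\<forall>x. x0 < x \<and> x < 0 \<longrightarrow> has_laplace_transform (p x) \<theta>
       (of_real (exp (\<beta> * (x0 - x) / 2)) * of_real (exp ((x0\<^sup>2 - x\<^sup>2) / 4))
        * (Gamma \<theta> * parabolic_cylinder (- \<theta>) (of_real (- x0 - \<beta>)) / of_real (sqrt (2 * pi)))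
        * (parabolic_cylinder (- \<theta>) (of_real (x + \<beta>))
           + parabolic_cylinder (- \<theta>) (of_real (- x - \<beta>)) * (\<M> \<theta> \<eta> \<beta> / \<V> \<theta> \<eta> \<beta>))))"
proof -
  interpret diffusion_density \<beta> \<eta> x0 p using assms by unfold_locales
  note \<eta> = assms(1) and x0 = assms(2) and \<theta> = assms(3)
  have \<theta>': "0 < Re (\<theta> / of_real \<eta>)" using \<theta> \<eta> by simp
  define W where "W = left_right_wronskian \<theta> \<eta> \<beta>"
  define N where "N = reflected_wronskian \<theta> \<eta> \<beta>"
  define \<kappa> where "\<kappa> = Gamma \<theta> * of_real (exp (- \<beta>\<^sup>2 / 2)) / of_real (sqrt (2 * pi))"
  let ?h = "\<lambda>y::real. hermite_fn \<theta> (of_real y)"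
  obtain u1 v1 u2 v2 where gf: "green_functions \<beta> \<eta> x0 p \<theta> u1 v1 u2 v2"
    and u1: "\<And>y. y \<le> 0 \<Longrightarrow> u1 y = ?h (- y - \<beta>)"
    and u2: "\<And>y. y \<le> 0 \<Longrightarrow> u2 y = \<kappa> * (N * ?h (- y - \<beta>) + W * ?h (y + \<beta>))"
    and u2': "\<And>y. 0 < y \<Longrightarrow> u2 y = hermite_fn (\<theta> / of_real \<eta>) (of_real ((\<eta> * y + \<beta>) / sqrt \<eta>))"
    and Wr: "v1 0 * u2 0 - u1 0 * v2 0 = W"
    by (rule green_functions_exist[OF \<theta>, folded W_def N_def \<kappa>_def]) (rule that)
  note laplace = laplace_transform_green[OF gf, unfolded Wr]
  have W0: "W \<noteq> 0" unfolding W_def by (rule left_right_wronskian_nonzero[OF \<eta> \<theta>])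
  have V: "\<V> \<theta> \<eta> \<beta> = of_real (exp (- \<beta>\<^sup>2 / 4 - \<beta>\<^sup>2 / (4 * \<eta>))) * W"
    and M: "\<M> \<theta> \<eta> \<beta> = of_real (exp (- \<beta>\<^sup>2 / 4 - \<beta>\<^sup>2 / (4 * \<eta>))) * N"
    unfolding W_def N_def by (rule V_M_eq_wronskians[OF \<eta> \<theta>])+
  have MV: "\<M> \<theta> \<eta> \<beta> / \<V> \<theta> \<eta> \<beta> = N / W" by (simp add: V M)
  have D: "parabolic_cylinder (- s) (of_real y) = of_real (exp (- y\<^sup>2 / 4)) * hermite_fn s (of_real y)"
    if "0 < Re s" for s y
    unfolding parabolic_cylinder_eq_hermite_fn[OF that] by (simp flip: exp_of_real)
  have md: "- \<theta> / complex_of_real \<eta> = - (\<theta> / of_real \<eta>)" by simp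
  \<comment> \<open>Cases (ii) and (iii) are one computation, with a the smaller and b the larger of
    x and x0.\<close>
  have left: "of_real (exp (\<beta> * (x0 - x) / 2)) * of_real (exp ((x0\<^sup>2 - x\<^sup>2) / 4))
        * (Gamma \<theta> * parabolic_cylinder (- \<theta>) (of_real (- a - \<beta>)) / of_real (sqrt (2 * pi)))
        * (parabolic_cylinder (- \<theta>) (of_real (b + \<beta>))
           + parabolic_cylinder (- \<theta>) (of_real (- b - \<beta>)) * (\<M> \<theta> \<eta> \<beta> / \<V> \<theta> \<eta> \<beta>))
      = u1 a * u2 b * of_real (drift_weight \<beta> \<eta> x) / W"
    if x: "x \<le> 0" and ab: "a = x \<and> b = x0 \<or> a = x0 \<and> b = x" for x a b
  proof -
    have ab0: "a \<le> 0" "b \<le> 0" using ab x x0 by auto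
    \<comment> \<open>The Gaussian factors are symmetric in a and b, so both orders leave the
      exponent -\<beta>^2/2 - \<beta> x - x^2/2: the constant inside \<kappa> and the weight at
      x.\<close>
    have e: "exp (\<beta> * (x0 - x) / 2) * exp ((x0\<^sup>2 - x\<^sup>2) / 4) * exp (- (- a - \<beta>)\<^sup>2 / 4) * exp (- (b + \<beta>)\<^sup>2 / 4)
        = exp (- \<beta>\<^sup>2 / 2) * drift_weight \<beta> \<eta> x"
      using ab x unfolding drift_weight_def
      by (auto simp: power2_eq_square field_simps simp flip: exp_add)
    have b2: "(- b - \<beta>)\<^sup>2 = (b + \<beta>)\<^sup>2" by (simp add: power2_eq_square algebra_simps)
    have "of_real (exp (\<beta> * (x0 - x) / 2)) * of_real (exp ((x0\<^sup>2 - x\<^sup>2) / 4))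
        * (Gamma \<theta> * parabolic_cylinder (- \<theta>) (of_real (- a - \<beta>)) / of_real (sqrt (2 * pi)))
        * (parabolic_cylinder (- \<theta>) (of_real (b + \<beta>))
           + parabolic_cylinder (- \<theta>) (of_real (- b - \<beta>)) * (\<M> \<theta> \<eta> \<beta> / \<V> \<theta> \<eta> \<beta>))
      = of_real (exp (\<beta> * (x0 - x) / 2) * exp ((x0\<^sup>2 - x\<^sup>2) / 4) * exp (- (- a - \<beta>)\<^sup>2 / 4) * exp (- (b + \<beta>)\<^sup>2 / 4))
        * (Gamma \<theta> / of_real (sqrt (2 * pi))) * ?h (- a - \<beta>) * (?h (b + \<beta>) + ?h (- b - \<beta>) * (N / W))"
      unfolding D[OF \<theta>] MV b2 of_real_mult
      by (simp only: divide_inverse distrib_left distrib_right mult_ac)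
    also have "\<dots> = u1 a * u2 b * of_real (drift_weight \<beta> \<eta> x) / W"
    proof -
      \<comment> \<open>The factors become free variables so that field arithmetic does not touch
        the exponentials inside them.\<close>
      have alg: "E * m * (G / S) * h1 * (h2 + h3 * (N / W)) = h1 * (G * E / S * (N * h3 + W * h2)) * m / W"
        if "S \<noteq> 0" for E m G S h1 h2 h3 :: complex
        using that W0 by (simp add: field_simps)
      show ?thesis
        unfolding e u1[OF ab0(1)] u2[OF ab0(2)] \<kappa>_def of_real_mult by (rule alg) simp
    qed
    finally show ?thesis .
  qed
  have right: "of_real (exp (\<beta> * (x0 - x) / 2)) * of_real (exp ((x0\<^sup>2 - \<eta> * x\<^sup>2) / 4))
        * (parabolic_cylinder (- \<theta>) (of_real (- x0 - \<beta>))
           * parabolic_cylinder (- \<theta> / of_real \<eta>) (of_real ((\<eta> * x + \<beta>) / sqrt \<eta>))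
           / \<V> \<theta> \<eta> \<beta>)
      = u1 x0 * u2 x * of_real (drift_weight \<beta> \<eta> x) / W" if x: "0 < x" for x
  proof -
    have sq: "((\<eta> * x + \<beta>) / sqrt \<eta>)\<^sup>2 = (\<eta> * x + \<beta>)\<^sup>2 / \<eta>" using \<eta> by (simp add: power_divide)
    \<comment> \<open>The terms in x0 collapse to -\<beta>^2/4, those in x to -\<beta>^2/(4 \<eta>)
      plus the exponent of the weight. The constant part is the factor between V and W, so it
      cancels.\<close>
    have "exp (\<beta> * (x0 - x) / 2) * exp ((x0\<^sup>2 - \<eta> * x\<^sup>2) / 4) * exp (- (- x0 - \<beta>)\<^sup>2 / 4)
        * exp (- ((\<eta> * x + \<beta>) / sqrt \<eta>)\<^sup>2 / 4)
        = exp (- \<beta>\<^sup>2 / 4 - \<beta>\<^sup>2 / (4 * \<eta>)) * drift_weight \<beta> \<eta> x"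
      using x \<eta> unfolding drift_weight_def sq
      by (simp add: power2_eq_square field_simps flip: exp_add)
    note e = this
    have "of_real (exp (\<beta> * (x0 - x) / 2)) * of_real (exp ((x0\<^sup>2 - \<eta> * x\<^sup>2) / 4))
        * (parabolic_cylinder (- \<theta>) (of_real (- x0 - \<beta>))
           * parabolic_cylinder (- \<theta> / of_real \<eta>) (of_real ((\<eta> * x + \<beta>) / sqrt \<eta>))
           / \<V> \<theta> \<eta> \<beta>)
      = of_real (exp (\<beta> * (x0 - x) / 2) * exp ((x0\<^sup>2 - \<eta> * x\<^sup>2) / 4) * exp (- (- x0 - \<beta>)\<^sup>2 / 4)
        * exp (- ((\<eta> * x + \<beta>) / sqrt \<eta>)\<^sup>2 / 4)) * (u1 x0 * u2 x / \<V> \<theta> \<eta> \<beta>)"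
      unfolding md D[OF \<theta>] D[OF \<theta>'] u1[OF less_imp_le[OF x0]] u2'[OF x] of_real_mult times_divide_eq_right
      by (simp only: mult_ac)
    also have "\<dots> = u1 x0 * u2 x * of_real (drift_weight \<beta> \<eta> x) / W"
      unfolding e V of_real_mult by simp
    finally show ?thesis .
  qed
  show ?thesis
  proof (intro conjI allI impI)
    show "\<V> \<theta> \<eta> \<beta> \<noteq> 0" using W0 by (simp add: V)
  next
    fix x :: real assume x: "0 < x"
    then show "has_laplace_transform (p x) \<theta>
       (of_real (exp (\<beta> * (x0 - x) / 2)) * of_real (exp ((x0\<^sup>2 - \<eta> * x\<^sup>2) / 4))
        * (parabolic_cylinder (- \<theta>) (of_real (- x0 - \<beta>))
           * parabolic_cylinder (- \<theta> / of_real \<eta>) (of_real ((\<eta> * x + \<beta>) / sqrt \<eta>))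
           / \<V> \<theta> \<eta> \<beta>))"
      unfolding right[OF x] using laplace[of x] x0 by (simp add: min_def max_def split: if_splits)
  next
    fix x assume x: "x < x0"
    then have "x \<le> 0" using x0 by simp
    from left[OF this, of x x0] laplace[of x] x
    show "has_laplace_transform (p x) \<theta>
       (of_real (exp (\<beta> * (x0 - x) / 2)) * of_real (exp ((x0\<^sup>2 - x\<^sup>2) / 4))
        * (Gamma \<theta> * parabolic_cylinder (- \<theta>) (of_real (- x - \<beta>)) / of_real (sqrt (2 * pi)))
        * (parabolic_cylinder (- \<theta>) (of_real (x0 + \<beta>))
           + parabolic_cylinder (- \<theta>) (of_real (- x0 - \<beta>)) * (\<M> \<theta> \<eta> \<beta> / \<V> \<theta> \<eta> \<beta>)))"
      by (simp only: min.strict_order_iff max.absorb2 less_imp_le min.absorb1 simp_thms)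
  next
    fix x assume x: "x0 < x \<and> x < 0"
    then have "x \<le> 0" by simp
    from left[OF this, of x0 x] laplace[of x] x
    show "has_laplace_transform (p x) \<theta>
       (of_real (exp (\<beta> * (x0 - x) / 2)) * of_real (exp ((x0\<^sup>2 - x\<^sup>2) / 4))
        * (Gamma \<theta> * parabolic_cylinder (- \<theta>) (of_real (- x0 - \<beta>)) / of_real (sqrt (2 * pi)))
        * (parabolic_cylinder (- \<theta>) (of_real (x + \<beta>))
           + parabolic_cylinder (- \<theta>) (of_real (- x - \<beta>)) * (\<M> \<theta> \<eta> \<beta> / \<V> \<theta> \<eta> \<beta>)))"
      by (simp only: max.absorb1 less_imp_le min.absorb2 simp_thms)
  qed
qed

end
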